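(* Let $(\mathcal A,\delta)$ be a $C^*$-dynamical system and let $J$ be an arbitrary ideal in $\mathcal A$ having zero intersection with the kernel of $\delta$. Then there exists a covariant representation of $(\mathcal A,\delta)$ associated with the ideal $J$.
   Context: A $C^*$-dynamical system $(\mathcal A,\delta)$ is a unital $C^*$-algebra $\mathcal A$ with a $*$-endomorphism $\delta:\mathcal A\to\mathcal A$ (not assumed unital or injective). A covariant representation of $(\mathcal A,\delta)$ is a triple $(\pi,U,H)$ where $\pi:\mathcal A\to\mathcal B(H)$ is a non-degenerate faithful $*$-representation on a Hilbert space $H$ and $U\in\mathcal B(H)$ is a partial isometry with $U\pi(a)U^*=\pi(\delta(a))$ for all $a\in\mathcal A$ and $U^*U\in\pi(\mathcal A)'$ (the commutant). Ideals are closed and two-sided. A covariant representation $(\pi,U,H)$ is associated with an ideal $J$ (where $J\cap\operatorname{Ker}\delta=\{0\}$) if $J=\{a\in\mathcal A: U^*U\pi(a)=\pi(a)\}$. *)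

theory Defs
  imports Complex_Main "HOL-Algebra.Module" "HOL-Library.FuncSet"
begin

section \<open>Unital $C^*$-algebras\<close>

text \<open>The unit comes from \<open>monoid_mult\<close> and not from \<open>real_normed_algebra_1\<close>, so that the zero
  algebra is not excluded.\<close>

class unital_cstar_algebra = real_normed_algebra + banach + monoid_mult +
  fixes scaleC :: "complex \<Rightarrow> 'a \<Rightarrow> 'a"
    and star :: "'a \<Rightarrow> 'a"
  assumes scaleC_add_right: "scaleC c (x + y) = scaleC c x + scaleC c y"
    and scaleC_add_left: "scaleC (c + d) x = scaleC c x + scaleC d x"
    and scaleC_scaleC: "scaleC c (scaleC d x) = scaleC (c * d) x"
    and scaleC_of_real: "scaleC (complex_of_real r) x = scaleR r x"
    and mult_scaleC_left: "scaleC c x * y = scaleC c (x * y)"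
    and mult_scaleC_right: "x * scaleC c y = scaleC c (x * y)"
    and norm_scaleC: "norm (scaleC c x) = cmod c * norm x"
    and star_star: "star (star x) = x"
    and star_add: "star (x + y) = star x + star y"
    and star_scaleC: "star (scaleC c x) = scaleC (cnj c) (star x)"
    and star_mult: "star (x * y) = star y * star x"
    and cstar_identity: "norm (star x * x) = (norm x)\<^sup>2"

definition star_endomorphism :: "('a::unital_cstar_algebra \<Rightarrow> 'a) \<Rightarrow> bool" where
  "star_endomorphism \<delta> \<longleftrightarrow>
     (\<forall>a b. \<delta> (a + b) = \<delta> a + \<delta> b) \<and>
     (\<forall>c a. \<delta> (scaleC c a) = scaleC c (\<delta> a)) \<and>
     (\<forall>a b. \<delta> (a * b) = \<delta> a * \<delta> b) \<and>
     (\<forall>a. \<delta> (star a) = star (\<delta> a))"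

definition closed_ideal :: "'a::unital_cstar_algebra set \<Rightarrow> bool" where
  "closed_ideal J \<longleftrightarrow>
     closed J \<and> 0 \<in> J \<and>
     (\<forall>a\<in>J. \<forall>b\<in>J. a + b \<in> J) \<and>
     (\<forall>c. \<forall>a\<in>J. scaleC c a \<in> J) \<and>
     (\<forall>a\<in>J. \<forall>x. x * a \<in> J \<and> a * x \<in> J)"

section \<open>Complex Hilbert spaces with explicit carrier\<close>

text \<open>The Hilbert space of a representation is existentially quantified, so it has to be a value
  rather than a type: it is a module over the ring of complex numbers together with an inner product,
  linear in the first argument. The \<open>mult\<close> and \<open>one\<close> fields that every module record inherits
  from the ring record play no role.\<close>

definition complex_ring :: "complex ring" where
  "complex_ring = \<lparr>carrier = UNIV, mult = (*), one = 1, zero = 0, add = (+)\<rparr>"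

record 'h hilbert = "(complex, 'h) module" +
  ip :: "'h \<Rightarrow> 'h \<Rightarrow> complex"

definition hnorm :: "'h hilbert \<Rightarrow> 'h \<Rightarrow> real" where
  "hnorm H x = sqrt (Re (ip H x x))"

locale hilbert_space = module complex_ring H for H :: "'h hilbert" (structure) +
  assumes ip_add: "\<lbrakk>x \<in> carrier H; y \<in> carrier H; z \<in> carrier H\<rbrakk> \<Longrightarrow>
      ip H (x \<oplus>\<^bsub>H\<^esub> y) z = ip H x z + ip H y z"
    and ip_smult: "\<lbrakk>x \<in> carrier H; y \<in> carrier H\<rbrakk> \<Longrightarrow> ip H (c \<odot>\<^bsub>H\<^esub> x) y = c * ip H x y"
    and ip_cnj: "\<lbrakk>x \<in> carrier H; y \<in> carrier H\<rbrakk> \<Longrightarrow> ip H y x = cnj (ip H x y)"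
    and ip_nonneg: "x \<in> carrier H \<Longrightarrow> 0 \<le> Re (ip H x x)"
    and ip_definite: "\<lbrakk>x \<in> carrier H; ip H x x = 0\<rbrakk> \<Longrightarrow> x = \<zero>\<^bsub>H\<^esub>"
    and complete: "\<lbrakk>\<And>n::nat. X n \<in> carrier H;
        \<And>e. 0 < e \<Longrightarrow> \<exists>N. \<forall>m\<ge>N. \<forall>n\<ge>N. hnorm H (X m \<ominus>\<^bsub>H\<^esub> X n) < e\<rbrakk> \<Longrightarrow>
        \<exists>x\<in>carrier H. (\<lambda>n. hnorm H (X n \<ominus>\<^bsub>H\<^esub> x)) \<longlonglongrightarrow> 0"

section \<open>Bounded operators\<close>

text \<open>Operators are extensional functions, \<open>undefined\<close> off the carrier, so that equality
  in $\mathcal B(H)$ is equality of functions and the product is \<open>compose (carrier H)\<close>.\<close>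

definition bounded_ops :: "'h hilbert \<Rightarrow> ('h \<Rightarrow> 'h) set" where
  "bounded_ops H = {T \<in> carrier H \<rightarrow>\<^sub>E carrier H.
     (\<forall>x\<in>carrier H. \<forall>y\<in>carrier H. T (x \<oplus>\<^bsub>H\<^esub> y) = T x \<oplus>\<^bsub>H\<^esub> T y) \<and>
     (\<forall>c. \<forall>x\<in>carrier H. T (c \<odot>\<^bsub>H\<^esub> x) = c \<odot>\<^bsub>H\<^esub> T x) \<and>
     (\<exists>K. \<forall>x\<in>carrier H. hnorm H (T x) \<le> K * hnorm H x)}"

definition adjoint_op :: "'h hilbert \<Rightarrow> ('h \<Rightarrow> 'h) \<Rightarrow> ('h \<Rightarrow> 'h)" where
  "adjoint_op H T = (THE S. S \<in> bounded_ops H \<and>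
     (\<forall>x\<in>carrier H. \<forall>y\<in>carrier H. ip H (T x) y = ip H x (S y)))"

definition partial_isometry :: "'h hilbert \<Rightarrow> ('h \<Rightarrow> 'h) \<Rightarrow> bool" where
  "partial_isometry H U \<longleftrightarrow> U \<in> bounded_ops H \<and>
     (\<forall>x\<in>carrier H. (\<forall>y\<in>carrier H. U y = \<zero>\<^bsub>H\<^esub> \<longrightarrow> ip H x y = 0) \<longrightarrow> hnorm H (U x) = hnorm H x)"

definition commutant :: "'h hilbert \<Rightarrow> ('h \<Rightarrow> 'h) set \<Rightarrow> ('h \<Rightarrow> 'h) set" where
  "commutant H S = {T \<in> bounded_ops H. \<forall>R\<in>S. compose (carrier H) T R = compose (carrier H) R T}"

section \<open>Representations\<close>

definition star_representation ::
    "'h hilbert \<Rightarrow> ('a::unital_cstar_algebra \<Rightarrow> 'h \<Rightarrow> 'h) \<Rightarrow> bool" where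
  "star_representation H \<pi> \<longleftrightarrow>
     (\<forall>a. \<pi> a \<in> bounded_ops H) \<and>
     (\<forall>a b. \<forall>x\<in>carrier H. \<pi> (a + b) x = \<pi> a x \<oplus>\<^bsub>H\<^esub> \<pi> b x) \<and>
     (\<forall>c a. \<forall>x\<in>carrier H. \<pi> (scaleC c a) x = c \<odot>\<^bsub>H\<^esub> \<pi> a x) \<and>
     (\<forall>a b. \<pi> (a * b) = compose (carrier H) (\<pi> a) (\<pi> b)) \<and>
     (\<forall>a. \<pi> (star a) = adjoint_op H (\<pi> a))"

text \<open>Non-degeneracy: the linear span of $\pi(\mathcal A)H$ is dense in $H$ (scalars are absorbed
  by $\mathcal A$).\<close>

definition nondegenerate ::
    "'h hilbert \<Rightarrow> ('a::unital_cstar_algebra \<Rightarrow> 'h \<Rightarrow> 'h) \<Rightarrow> bool" where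
  "nondegenerate H \<pi> \<longleftrightarrow>
     (\<forall>x\<in>carrier H. \<forall>e>0. \<exists>(n::nat) a h. (\<forall>i<n. h i \<in> carrier H) \<and>
        hnorm H (x \<ominus>\<^bsub>H\<^esub> (\<Oplus>\<^bsub>H\<^esub>i\<in>{..<n}. \<pi> (a i) (h i))) < e)"

definition covariant_representation ::
    "('a::unital_cstar_algebra \<Rightarrow> 'a) \<Rightarrow> 'h hilbert \<Rightarrow> ('a \<Rightarrow> 'h \<Rightarrow> 'h) \<Rightarrow> ('h \<Rightarrow> 'h) \<Rightarrow> bool" where
  "covariant_representation \<delta> H \<pi> U \<longleftrightarrow>
     hilbert_space H \<and> star_representation H \<pi> \<and> nondegenerate H \<pi> \<and> inj \<pi> \<and>
     partial_isometry H U \<and>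
     (\<forall>a. compose (carrier H) (compose (carrier H) U (\<pi> a)) (adjoint_op H U) = \<pi> (\<delta> a)) \<and>
     compose (carrier H) (adjoint_op H U) U \<in> commutant H (range \<pi>)"

definition associated_with ::
    "'h hilbert \<Rightarrow> ('a::unital_cstar_algebra \<Rightarrow> 'h \<Rightarrow> 'h) \<Rightarrow> ('h \<Rightarrow> 'h) \<Rightarrow> 'a set \<Rightarrow> bool" where
  "associated_with H \<pi> U J \<longleftrightarrow>
     J = {a. compose (carrier H) (compose (carrier H) (adjoint_op H U) U) (\<pi> a) = \<pi> a}"

text \<open>HOL cannot quantify existentially over types, so the vectors of the Hilbert space sought
  are taken from one fixed type, of which the carrier may be any subset. This loses no generality.
  Given a covariant representation associated with $J$, choose for every $a \neq 0$ a vector not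
  killed by $\pi(a)$ and for every $a \notin J$ one not killed by $(1 - U^*U)\pi(a)$; the closed
  subspace that these generate under $\pi(\mathcal A)$, $U$ and $U^*$ carries again a covariant
  representation associated with $J$, and its Hilbert dimension is at most
  $\max(|\mathcal A|, \aleph_0)$. The type below has room for $\ell^2(I)$ for every
  $I \subseteq \mathcal A^{\sharp} \times \mathcal A \times \mathbb N$, where $\mathcal A^{\sharp}$
  is the set of all functions from $\mathcal A$ to the complex numbers (states among them).\<close>

type_synonym 'a rep_vec = "(('a \<Rightarrow> complex) \<times> 'a \<times> nat) \<Rightarrow> complex"

end

theory Submission
  imports Defs "HOL-Library.Nat_Bijection"
begin

text \<open>
A covariant representation associated with \<open>J\<close> is the same thing as a faithful representation \<open>\<pi>\<close>
together with a projection \<open>P = U\<^sup>*U\<close> in its commutant such that the restriction of \<open>\<pi>\<close> to the range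
of \<open>P\<close> is unitarily equivalent to \<open>\<pi> \<circ> \<delta>\<close> on the range of \<open>\<pi> (\<delta> 1)\<close>, and such that the restriction
to the range of \<open>1 - P\<close> has kernel \<open>J\<close>. The representation constructed here is a direct sum of two kinds
of pieces.

If \<open>\<sigma>\<close> is a representation with kernel \<open>J\<close>, then the sum of all \<open>\<sigma> \<circ> \<delta>\<^sup>n\<close>, \<open>n \<ge> 0\<close>, each on the range of
\<open>\<sigma> (\<delta>\<^sup>n 1)\<close>, with \<open>U\<close> the shift towards \<open>0\<close>, has \<open>1 - P\<close> equal to the projection on the component
\<open>n = 0\<close>. This piece separates \<open>J\<close> from its complement, but it annihilates the elements \<open>a\<close> all of whose
images \<open>\<delta>\<^sup>n a\<close> lie in \<open>J\<close>. Since \<open>\<delta>\<close> is injective on \<open>J\<close>, it is isometric there (\<open>isometric_on_J\<close>), so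
such an element keeps its norm in the inductive limit of \<open>A \<rightarrow> A \<rightarrow> \<dots>\<close> along \<open>\<delta>\<close>. A representation of
that limit yields components for all integers \<open>n\<close>, on which the shift has \<open>P = 1\<close>; adding these pieces
makes the sum faithful without changing the kernel of the part on the range of \<open>1 - P\<close>.

Both pieces are described by positive functionals: by one that vanishes on \<open>J\<close>
(\<open>functional_vanishing_on_ideal\<close>), respectively by a tower \<open>(F\<^sub>k)\<close> with \<open>F\<^sub>k\<^sub>+\<^sub>1 \<circ> \<delta> = F\<^sub>k\<close>, which is a
functional on the inductive limit (\<open>tower_exists\<close>). The Hilbert space is the reproducing kernel space of
a kernel on formal generators (\<open>K0\<close>). The operators \<open>\<pi> a\<close>, \<open>U\<close> and \<open>U\<^sup>*\<close> send generators
to generators, so on the space of functions they are compositions with maps of the generators, and the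
covariance relations hold already for these maps.

Functionals come from the Hahn-Banach theorem for the sublinear function \<open>upper\<close>, the upper end of the
numerical range. That \<open>upper (- star b * b) \<le> 0\<close> (\<open>upper_minus_star_mult\<close>, the theorem of Kelley and
Vaught) and that the two ends of the numerical range control the norm of a self-adjoint element
(\<open>p_le_max_upper\<close>) is proved by estimating norms of polynomials, for arbitrary \<open>C\<^sup>*\<close>-seminorms.
It therefore applies at once to the norm, to the quotient seminorm of \<open>J\<close> and to the
limit seminorm \<open>lim norm (\<delta>\<^sup>n a)\<close>, whose quotient algebras need not be formed.
\<close>

section \<open>The numerical range in a $C^*$-seminorm\<close>

lemma star_one [simp]: "star (1::'a::unital_cstar_algebra) = 1"
  by (metis mult_1_left mult_1_right star_mult star_star)

lemma star_scaleR [simp]: "star (r *\<^sub>R x) = r *\<^sub>R star (x::'a::unital_cstar_algebra)"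
  by (metis complex_cnj_complex_of_real scaleC_of_real star_scaleC)

lemma star_zero [simp]: "star (0::'a::unital_cstar_algebra) = 0"
  by (metis scaleR_zero_left star_scaleR)

lemma star_minus [simp]: "star (- x) = - star (x::'a::unital_cstar_algebra)"
  by (metis scaleR_minus1_left star_scaleR)

lemma star_diff: "star (x - y) = star x - star (y::'a::unital_cstar_algebra)"
  by (metis diff_conv_add_uminus star_add star_minus)

lemma star_power: "star (x ^ n) = star (x::'a::unital_cstar_algebra) ^ n"
  by (induction n) (auto simp: star_mult power_commutes)

lemma scaleC_minus_left: "scaleC (- c) x = - scaleC c (x::'a::unital_cstar_algebra)"
  by (metis mult_minus1 of_real_1 of_real_minus scaleC_of_real scaleC_scaleC scaleR_minus1_left)

lemma scaleC_scaleR: "scaleC c (r *\<^sub>R x) = r *\<^sub>R scaleC c (x::'a::unital_cstar_algebra)"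
  by (metis mult.commute scaleC_of_real scaleC_scaleC)

lemma scaleC_minus_right: "scaleC c (- x) = - scaleC c (x::'a::unital_cstar_algebra)"
  using scaleC_scaleR[of c "-1" x] by simp

lemma scaleC_diff_right: "scaleC c (x - y) = scaleC c x - scaleC c (y::'a::unital_cstar_algebra)"
  by (metis diff_conv_add_uminus scaleC_add_right scaleC_minus_right)

lemma scaleC_ii_ii: "scaleC \<i> (scaleC \<i> x) = - (x::'a::unital_cstar_algebra)"
  by (metis i_squared mult.commute mult_minus1 of_real_1 of_real_minus scaleC_of_real scaleC_scaleC scaleR_minus1_left)

lemma scaleC_one [simp]: "scaleC 1 x = (x::'a::unital_cstar_algebra)"
  by (metis of_real_1 scaleC_of_real scaleR_one)

lemma scaleC_zero_left [simp]: "scaleC 0 x = (0::'a::unital_cstar_algebra)"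
  by (metis of_real_0 scaleC_of_real scaleR_zero_left)

text \<open>The substitute for the spectral radius formula: a self-adjoint \<open>h\<close> satisfies
  \<open>p (h ^ 2 ^ n) = p h ^ 2 ^ n\<close>, so a bound on its powers that is off by a linear factor is a bound on
  \<open>p h\<close> itself.\<close>

lemma le_of_power_growth:
  fixes x r C :: real
  assumes "0 \<le> x" "0 < r" and g: "\<And>n::nat. x ^ (2 ^ n) \<le> C * (2 ^ n + 1) * r ^ (2 ^ n)"
  shows "x \<le> r"
proof (rule ccontr)
  assume "\<not> x \<le> r"
  define q where "q = x / r"
  have q: "q > 1" using assms \<open>\<not> x \<le> r\<close> by (simp add: q_def)
  have le: "q ^ (2 ^ n) \<le> C * (2 ^ n + 1)" for n
    using g[of n] assms(2) by (simp add: q_def power_divide divide_simps)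
  obtain d where d: "d > 0" "q = 1 + d" using q by (metis add.commute diff_add_cancel diff_gt_0_iff_gt)
  \<comment> \<open>By Bernoulli the square of \<open>q ^ N\<close> already outgrows every linear function of \<open>N\<close>.\<close>
  have bern: "1 + real N * d \<le> q ^ N" for N
    using Bernoulli_inequality[of d N] d by simp
  have dbl: "(1 + 2 ^ n * d) ^ 2 \<le> C * (2 ^ Suc n + 1)" for n
  proof -
    have "(1 + 2 ^ n * d) ^ 2 \<le> (q ^ (2 ^ n)) ^ 2"
      using bern[of "2 ^ n"] d by (intro power_mono) auto
    also have "\<dots> = q ^ (2 ^ Suc n)" by (simp add: power_mult[symmetric] mult.commute)
    finally show ?thesis using le[of "Suc n"] by linarith
  qed
  have C0: "C \<ge> 0" using le[of 0] q by simp
  obtain N :: nat where N: "real N > (3 * C) / d ^ 2" using reals_Archimedean2 by blast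
  have "real N < 2 ^ N" by (metis less_exp of_nat_less_iff of_nat_numeral of_nat_power)
  then have big: "(2::real) ^ N * d ^ 2 > 3 * C" using N d
    by (smt (verit, best) pos_divide_less_eq zero_less_power)
  have "C * (2 ^ Suc N + 1) \<le> 3 * C * 2 ^ N" using C0
    using mult_left_mono[of 1 "2 ^ N" C] by (simp add: algebra_simps)
  also have "\<dots> < (2 ^ N * d ^ 2) * 2 ^ N" using big by (intro mult_strict_right_mono) auto
  also have "\<dots> = (2 ^ N * d) ^ 2" by (simp add: power2_eq_square)
  also have "\<dots> \<le> (1 + 2 ^ N * d) ^ 2" using d by (intro power_mono) auto
  finally show False using dbl[of N] by simp
qed

lemma scaleR_double: "(2 * r) *\<^sub>R x = r *\<^sub>R x + r *\<^sub>R (x::'a::real_vector)"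
    "(r * 2) *\<^sub>R x = r *\<^sub>R x + r *\<^sub>R (x::'a::real_vector)"
  by (simp_all flip: scaleR_add_left)

locale cstar_seminorm =
  fixes p :: "'a::unital_cstar_algebra \<Rightarrow> real"
  assumes p_triangle: "p (x + y) \<le> p x + p y"
    and p_scaleC: "p (scaleC c x) = cmod c * p x"
    and p_mult: "p (x * y) \<le> p x * p y"
    and p_cstar: "p (star x * x) = (p x)\<^sup>2"
    and p_one: "p 1 = 1"
begin

lemma p_scaleR: "p (r *\<^sub>R x) = \<bar>r\<bar> * p x"
  by (metis norm_of_real p_scaleC real_norm_def scaleC_of_real)

lemma p_zero [simp]: "p 0 = 0"
  using p_scaleR[of 0 0] by simp

lemma p_minus [simp]: "p (- x) = p x"
  using p_scaleR[of "-1" x] by simp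

lemma p_nonneg [simp]: "0 \<le> p x"
  using p_triangle[of x "- x"] by simp

lemma p_diff: "p (x - y) \<le> p x + p y"
  using p_triangle[of x "- y"] by simp

lemma p_of_real: "p (r *\<^sub>R 1) = \<bar>r\<bar>"
  by (simp add: p_scaleR p_one)

lemma p_star [simp]: "p (star x) = p x"
proof -
  have le: "p x \<le> p (star x)" for x
  proof (cases "p x = 0")
    case False
    have "p x * p x \<le> p (star x) * p x"
      using p_mult[of "star x" x] by (simp add: p_cstar power2_eq_square)
    moreover have "0 < p x" using False p_nonneg[of x] by linarith
    ultimately show ?thesis by (rule mult_right_le_imp_le)
  next
    case True
    then show ?thesis using p_nonneg[of "star x"] by linarith
  qed
  from le[of x] le[of "star x"] show ?thesis by (simp add: star_star)
qed

lemma p_cstar': "p (x * star x) = (p x)\<^sup>2"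
  using p_cstar[of "star x"] by (simp add: star_star)

lemma p_square: "star h = h \<Longrightarrow> p (h\<^sup>2) = (p h)\<^sup>2"
  using p_cstar[of h] by (simp add: power2_eq_square)

lemma p_power_le: "p (x ^ n) \<le> p x ^ n"
proof (induction n)
  case (Suc n)
  have "p (x ^ Suc n) \<le> p x * p (x ^ n)" using p_mult by simp
  also have "\<dots> \<le> p x * p x ^ n" using Suc by (simp add: mult_left_mono)
  finally show ?case by simp
qed (simp add: p_one)

lemma p_power_2n: "star h = h \<Longrightarrow> p (h ^ (2 ^ n)) = p h ^ (2 ^ n)"
proof (induction n)
  case (Suc n)
  have "p (h ^ (2 ^ Suc n)) = p ((h ^ (2 ^ n))\<^sup>2)" by (simp add: power_mult[symmetric] mult.commute)
  also have "\<dots> = (p h ^ (2 ^ n))\<^sup>2" using Suc by (simp add: p_square star_power)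
  finally show ?case by (simp add: power_mult[symmetric] mult.commute)
qed simp

text \<open>For a state \<open>f\<close> and self-adjoint \<open>x\<close>, \<open>f x \<le> p (t + x) - t\<close> for all \<open>t\<close>; the infimum, which is
  also the limit for \<open>t \<rightarrow> \<infinity>\<close>, is the maximum of the spectrum of the class of \<open>x\<close> modulo the null space of \<open>p\<close>. Thus \<open>upper (- x) \<le> 0\<close> says that
  \<open>x\<close> is positive.\<close>

definition upper :: "'a \<Rightarrow> real" where
  "upper x = (INF t\<in>{0..}. p (t *\<^sub>R 1 + x) - t)"

lemma upper_bdd: "bdd_below ((\<lambda>t. p (t *\<^sub>R 1 + x) - t) ` {0..})"
proof (rule bdd_belowI2[of _ "- p x"])
  fix t :: real assume "t \<in> {0..}"
  then have "t = p ((t *\<^sub>R 1 + x) - x)" by (simp add: p_of_real)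
  also have "\<dots> \<le> p (t *\<^sub>R 1 + x) + p x" by (rule p_diff)
  finally show "- p x \<le> p (t *\<^sub>R 1 + x) - t" by simp
qed

lemma upper_le: "0 \<le> t \<Longrightarrow> upper x \<le> p (t *\<^sub>R 1 + x) - t"
  unfolding upper_def by (rule cINF_lower[OF upper_bdd]) auto

lemma upper_ge: "(\<And>t. 0 \<le> t \<Longrightarrow> c \<le> p (t *\<^sub>R 1 + x) - t) \<Longrightarrow> c \<le> upper x"
  unfolding upper_def by (rule cINF_greatest) auto

lemma upper_less: assumes "upper x < c" obtains t where "0 \<le> t" "p (t *\<^sub>R 1 + x) - t < c"
  using assms upper_ge[of c x] by (meson not_le)

lemma upper_le_p: "upper x \<le> p x"
  using upper_le[of 0 x] by simp

lemma upper_add: "upper (x + y) \<le> upper x + upper y"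
proof (rule field_le_epsilon)
  fix e :: real assume "0 < e"
  obtain s where s: "0 \<le> s" "p (s *\<^sub>R 1 + x) - s < upper x + e / 2"
    using upper_less[of x "upper x + e / 2"] \<open>0 < e\<close> by auto
  obtain t where t: "0 \<le> t" "p (t *\<^sub>R 1 + y) - t < upper y + e / 2"
    using upper_less[of y "upper y + e / 2"] \<open>0 < e\<close> by auto
  have "upper (x + y) \<le> p ((s + t) *\<^sub>R 1 + (x + y)) - (s + t)" using s t by (intro upper_le) simp
  also have "(s + t) *\<^sub>R 1 + (x + y) = (s *\<^sub>R 1 + x) + (t *\<^sub>R 1 + y)" by (simp add: algebra_simps)
  also have "p \<dots> \<le> p (s *\<^sub>R 1 + x) + p (t *\<^sub>R 1 + y)" by (rule p_triangle)
  finally show "upper (x + y) \<le> upper x + upper y + e" using s t by linarith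
qed

lemma upper_scaleR_le: assumes "0 < r" shows "upper (r *\<^sub>R x) \<le> r * upper x"
proof -
  have "upper (r *\<^sub>R x) / r \<le> upper x"
  proof (rule upper_ge)
    fix t :: real assume "0 \<le> t"
    have "upper (r *\<^sub>R x) \<le> p ((r * t) *\<^sub>R 1 + r *\<^sub>R x) - r * t"
      using \<open>0 \<le> t\<close> assms by (intro upper_le) simp
    also have "(r * t) *\<^sub>R 1 + r *\<^sub>R x = r *\<^sub>R (t *\<^sub>R 1 + x)" by (simp add: scaleR_add_right)
    also have "p (r *\<^sub>R (t *\<^sub>R 1 + x)) - r * t = r * (p (t *\<^sub>R 1 + x) - t)"
      using assms by (simp add: p_scaleR right_diff_distrib)
    finally show "upper (r *\<^sub>R x) / r \<le> p (t *\<^sub>R 1 + x) - t"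
      using assms by (simp add: pos_divide_le_eq mult.commute)
  qed
  then show ?thesis using assms by (simp add: divide_simps mult.commute)
qed

lemma upper_zero [simp]: "upper 0 = 0"
proof -
  have "0 \<le> upper 0" by (rule upper_ge) (simp add: p_of_real)
  then show ?thesis using upper_le_p[of 0] by simp
qed

lemma upper_scaleR: "0 \<le> r \<Longrightarrow> upper (r *\<^sub>R x) = r * upper x"
proof (cases "r = 0")
  case False
  assume "0 \<le> r"
  then have "upper x \<le> upper (r *\<^sub>R x) / r"
    using upper_scaleR_le[of "inverse r" "r *\<^sub>R x"] False by (simp add: divide_inverse mult.commute)
  then show ?thesis using upper_scaleR_le[of r x] False \<open>0 \<le> r\<close> by (simp add: divide_simps mult.commute)
qed simp

lemma upper_of_real_le: "upper (r *\<^sub>R 1) \<le> r"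
proof (cases "0 \<le> r")
  case True then show ?thesis using upper_le_p[of "r *\<^sub>R 1"] by (simp add: p_of_real)
next
  case False then show ?thesis using upper_le[of "- r" "r *\<^sub>R 1"] by simp
qed

lemma upper_shift: "upper (r *\<^sub>R 1 + x) = r + upper x"
proof -
  have "upper (r *\<^sub>R 1 + x) \<le> r + upper x" using upper_add[of "r *\<^sub>R 1" x] upper_of_real_le[of r] by linarith
  moreover have "upper x \<le> - r + upper (r *\<^sub>R 1 + x)"
    using upper_add[of "(- r) *\<^sub>R 1" "r *\<^sub>R 1 + x"] upper_of_real_le[of "- r"] by simp
  ultimately show ?thesis by linarith
qed

lemma upper_mono: "upper x \<le> upper (x + y) + upper (- y)"
  using upper_add[of "x + y" "- y"] by simp

text \<open>The element \<open>v = a + i b\<close> is normal with \<open>star v * v = a * a + b * b\<close>, and its real part is \<open>a\<close>.\<close>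

lemma p_real_part_le:
  assumes "star a = a" "star b = b" "a * b = b * a"
  shows "(p a)\<^sup>2 \<le> p (a * a + b * b)"
proof -
  define v where "v = a + scaleC \<i> b"
  have sv: "star v = a - scaleC \<i> b"
    by (simp add: v_def star_add star_scaleC assms scaleC_minus_left)
  have "star v * v = a * a + b * b"
    unfolding sv unfolding v_def
    by (simp add: algebra_simps mult_scaleC_left mult_scaleC_right assms scaleC_ii_ii
        scaleC_add_right scaleC_diff_right)
  then have "(p v)\<^sup>2 = p (a * a + b * b)" using p_cstar[of v] by simp
  moreover have "p a \<le> p v"
  proof -
    have "v + star v = 2 *\<^sub>R a" unfolding sv unfolding v_def
      by (simp add: scaleR_2)
    then have "a = (1/2) *\<^sub>R (v + star v)" by simp
    then have "p a = (1/2) * p (v + star v)" by (metis abs_of_pos half_gt_zero_iff p_scaleR zero_less_one)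
    then show ?thesis using p_triangle[of v "star v"] by simp
  qed
  ultimately show ?thesis by (metis p_nonneg power_mono)
qed

text \<open>Completing \<open>t - x * x\<close> by the imaginary part \<open>sqrt (2 * t) *\<^sub>R x\<close> gives an element whose modulus squared
  is \<open>t * t + x ^ 4\<close>; hence \<open>p (t - x * x) \<le> t + O (1 / t)\<close>.\<close>

lemma upper_minus_square:
  assumes h: "star x = x"
  shows "upper (- (x * x)) \<le> 0"
proof -
  let ?k = "x * x" and ?P = "p (x * x * (x * x))"
  have bound: "upper (- ?k) \<le> ?P / t" if t: "0 < t" for t
  proof -
    have "(p (t *\<^sub>R 1 - ?k))\<^sup>2 \<le>
        p ((t *\<^sub>R 1 - ?k) * (t *\<^sub>R 1 - ?k) + (sqrt (2 * t) *\<^sub>R x) * (sqrt (2 * t) *\<^sub>R x))"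
      by (rule p_real_part_le)
        (auto simp: star_diff star_mult h algebra_simps)
    also have "(t *\<^sub>R 1 - ?k) * (t *\<^sub>R 1 - ?k) + (sqrt (2 * t) *\<^sub>R x) * (sqrt (2 * t) *\<^sub>R x)
       = (t * t) *\<^sub>R 1 + ?k * ?k"
    proof -
      have "(sqrt (2 * t) *\<^sub>R x) * (sqrt (2 * t) *\<^sub>R x) = t *\<^sub>R ?k + t *\<^sub>R ?k"
        using t by (simp add: scaleR_add_left[symmetric])
      then show ?thesis by (simp add: algebra_simps)
    qed
    also have "p \<dots> \<le> t * t + ?P"
      using p_triangle[of "(t * t) *\<^sub>R 1" "?k * ?k"] by (simp add: p_of_real)
    also have "\<dots> \<le> (t + ?P / t)\<^sup>2"
      using t by (simp add: power2_eq_square field_simps)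
    finally have "p (t *\<^sub>R 1 - ?k) \<le> t + ?P / t"
      using t by (meson add_nonneg_nonneg divide_nonneg_pos less_imp_le p_nonneg power2_le_imp_le)
    then show ?thesis using upper_le[of t "- ?k"] t by simp
  qed
  show ?thesis
  proof (rule field_le_epsilon)
    fix e :: real assume e: "0 < e"
    define P where "P = ?P"
    have P: "0 \<le> P" by (simp add: P_def)
    have "upper (- ?k) \<le> P / ((P + 1) / e)" unfolding P_def using e by (intro bound) (simp add: add_nonneg_pos)
    also have "\<dots> \<le> e" using e P by (simp add: field_simps add_nonneg_pos)
    finally show "upper (- ?k) \<le> 0 + e" by simp
  qed
qed

text \<open>The elements \<open>t - x * x\<close> and \<open>2 * sqrt t *\<^sub>R x\<close> have squares that add up to \<open>(t + x * x)\<^sup>2\<close>. Therefore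
  \<open>p (t + x * x)\<close> dominates \<open>2 * sqrt t * p x\<close>, which for \<open>t = p (x * x)\<close> is the largest possible value
  \<open>t + p (x * x)\<close>. As \<open>p (t + x * x)\<close> is convex in \<open>t\<close> with slope at most \<open>1\<close>, it then equals
  \<open>t + p (x * x)\<close> for every \<open>t \<ge> 0\<close>.\<close>

lemma upper_square:
  assumes h: "star x = x"
  shows "upper (x * x) = p (x * x)"
proof (rule antisym[OF upper_le_p upper_ge])
  fix t :: real assume t: "0 \<le> t"
  let ?k = "x * x" let ?T = "p ?k"
  have T: "?T = p x * p x" using p_cstar[of x] h by (simp add: power2_eq_square)
  have dbl: "2 * ?T \<le> p (?T *\<^sub>R 1 + ?k)"
  proof -
    let ?b = "(2 * p x) *\<^sub>R x" and ?a = "?T *\<^sub>R 1 - ?k"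
    have "(p ?b)\<^sup>2 \<le> p (?b * ?b + ?a * ?a)"
      by (rule p_real_part_le) (auto simp: star_diff star_mult h algebra_simps)
    also have "?b * ?b + ?a * ?a = (?T *\<^sub>R 1 + ?k) * (?T *\<^sub>R 1 + ?k)"
    proof -
      have "?b * ?b = 4 *\<^sub>R (?T *\<^sub>R ?k)" by (simp add: T)
      also have "\<dots> = ?T *\<^sub>R ?k + ?T *\<^sub>R ?k + (?T *\<^sub>R ?k + ?T *\<^sub>R ?k)"
        by (simp flip: scaleR_add_left)
      finally show ?thesis by (simp add: algebra_simps)
    qed
    also have "p \<dots> \<le> (p (?T *\<^sub>R 1 + ?k))\<^sup>2" using p_mult by (simp add: power2_eq_square)
    finally have "p ?b \<le> p (?T *\<^sub>R 1 + ?k)" by (simp add: power2_le_iff_abs_le)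
    then show ?thesis by (simp add: p_scaleR T mult.assoc)
  qed
  show "?T \<le> p (t *\<^sub>R 1 + ?k) - t"
  proof (cases "t < ?T")
    case True
    have "(?T - t) *\<^sub>R 1 + (t *\<^sub>R 1 + ?k) = ?T *\<^sub>R 1 + ?k" by (simp add: algebra_simps)
    then have "p (?T *\<^sub>R 1 + ?k) \<le> p ((?T - t) *\<^sub>R 1) + p (t *\<^sub>R 1 + ?k)"
      by (metis p_triangle)
    then have "p (?T *\<^sub>R 1 + ?k) \<le> (?T - t) + p (t *\<^sub>R 1 + ?k)"
      using True by (simp add: p_of_real)
    then show ?thesis using dbl by linarith
  next
    case False
    show ?thesis
    proof (cases "?T = 0")
      case True
      then show ?thesis using p_diff[of "t *\<^sub>R 1 + ?k" ?k] t by (simp add: p_of_real)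
    next
      case False': False
      then have T0: "?T > 0" using p_nonneg[of ?k] by linarith
      then have t0: "t > 0" using False by linarith
      have "t *\<^sub>R (?T *\<^sub>R 1 + ?k) = ?T *\<^sub>R (t *\<^sub>R 1 + ?k) + (t - ?T) *\<^sub>R ?k" by (simp add: algebra_simps)
      then have "p (t *\<^sub>R (?T *\<^sub>R 1 + ?k)) \<le> p (?T *\<^sub>R (t *\<^sub>R 1 + ?k)) + p ((t - ?T) *\<^sub>R ?k)"
        by (metis p_triangle)
      then have "t * p (?T *\<^sub>R 1 + ?k) \<le> ?T * p (t *\<^sub>R 1 + ?k) + (t - ?T) * ?T"
        using t T0 False unfolding p_scaleR by simp
      moreover have "t * (2 * ?T) \<le> t * p (?T *\<^sub>R 1 + ?k)" using dbl t by (rule mult_left_mono)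
      ultimately have "?T * (t + ?T) \<le> ?T * p (t *\<^sub>R 1 + ?k)" by (simp add: algebra_simps)
      then show ?thesis using T0 by simp
    qed
  qed
qed

text \<open>Squares are handled exactly by \<open>upper_square\<close>. With \<open>r = p h\<close>, the fourth powers of \<open>r + h\<close> and
  \<open>r - h\<close> add up to \<open>2 r\<^sup>4 + 12 r\<^sup>2 h\<^sup>2 + 2 h\<^sup>4\<close>, of seminorm at least \<open>14 r\<^sup>4\<close>, so one of the two elements
  has a square of seminorm at least \<open>5/2 r\<^sup>2\<close>, which is impossible unless \<open>upper h\<close> or \<open>upper (- h)\<close> is at
  least \<open>r / 4\<close>. The best constant is \<open>1\<close>; any constant will do, because it is removed by passing
  to powers.\<close>

lemma p_le_max_upper:
  assumes h: "star h = h"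
  shows "p h \<le> 4 * max (upper h) (upper (- h))"
proof (cases "p h = 0")
  case True
  have "0 \<le> upper h + upper (- h)" using upper_add[of h "- h"] by simp
  then show ?thesis using True by simp
next
  case False
  define r where "r = p h"
  have r: "r > 0" using False p_nonneg[of h] unfolding r_def by linarith
  let ?u = "r *\<^sub>R 1 + h" and ?v = "r *\<^sub>R 1 - h"
  have sa: "star ?u = ?u" "star ?v = ?v" by (simp_all add: star_add star_diff h)
  have Mhh: "upper (h * h) = r * r"
    using upper_square[OF h] p_cstar[of h] h by (simp add: r_def power2_eq_square)
  have id: "(?u * ?u) * (?u * ?u) + (?v * ?v) * (?v * ?v)
      = 2 *\<^sub>R ((r ^ 4) *\<^sub>R 1 + ((6 * r\<^sup>2) *\<^sub>R (h * h) + h * h * (h * h)))"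
  proof -
    have uu: "?u * ?u = ((r\<^sup>2) *\<^sub>R 1 + h * h) + (2 * r) *\<^sub>R h"
      and vv: "?v * ?v = ((r\<^sup>2) *\<^sub>R 1 + h * h) - (2 * r) *\<^sub>R h"
      by (simp_all add: algebra_simps power2_eq_square scaleR_double)
    have sum2: "(a + b) * (a + b) + (a - b) * (a - b) = 2 *\<^sub>R (a * a + b * b)" for a b :: 'a
      by (simp add: algebra_simps scaleR_2)
    have "(?u * ?u) * (?u * ?u) + (?v * ?v) * (?v * ?v)
      = 2 *\<^sub>R (((r\<^sup>2) *\<^sub>R 1 + h * h) * ((r\<^sup>2) *\<^sub>R 1 + h * h) + ((2 * r) *\<^sub>R h) * ((2 * r) *\<^sub>R h))"
      unfolding uu vv by (rule sum2)
    also have "(s *\<^sub>R 1 + k) * (s *\<^sub>R 1 + k) = (s * s) *\<^sub>R 1 + ((2 * s) *\<^sub>R k + k * k)" for s and k :: 'a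
      by (simp add: algebra_simps scaleR_double)
    also have "r\<^sup>2 * r\<^sup>2 = r ^ 4" by (simp add: power2_eq_square power4_eq_xxxx)
    also have "((2 * r) *\<^sub>R h) * ((2 * r) *\<^sub>R h) = (4 * r\<^sup>2) *\<^sub>R (h * h)"
      by (simp only: mult_scaleR_left mult_scaleR_right scaleR_scaleR) (simp add: power2_eq_square)
    also have "(r ^ 4) *\<^sub>R 1 + ((2 * r\<^sup>2) *\<^sub>R (h * h) + h * h * (h * h)) + (4 * r\<^sup>2) *\<^sub>R (h * h)
       = (r ^ 4) *\<^sub>R 1 + ((6 * r\<^sup>2) *\<^sub>R (h * h) + h * h * (h * h))"
    proof -
      have "(6 * r\<^sup>2) *\<^sub>R (h * h) = (2 * r\<^sup>2) *\<^sub>R (h * h) + (4 * r\<^sup>2) *\<^sub>R (h * h)"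
        unfolding scaleR_add_left[symmetric] by (rule arg_cong[where f = "\<lambda>s. s *\<^sub>R (h * h)"]) simp
      then show ?thesis by (simp only: add_ac)
    qed
    finally show ?thesis .
  qed
  have "7 * r ^ 4 \<le> upper ((r ^ 4) *\<^sub>R 1 + ((6 * r\<^sup>2) *\<^sub>R (h * h) + h * h * (h * h)))"
  proof -
    have "6 * r ^ 4 = upper ((6 * r\<^sup>2) *\<^sub>R (h * h))" using r by (simp add: upper_scaleR Mhh power2_eq_square power4_eq_xxxx)
    also have "\<dots> \<le> upper ((6 * r\<^sup>2) *\<^sub>R (h * h) + h * h * (h * h)) + upper (- (h * h * (h * h)))"
      by (rule upper_mono)
    also have "upper (- (h * h * (h * h))) \<le> 0" by (rule upper_minus_square) (simp add: star_mult h)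
    finally show ?thesis by (simp add: upper_shift)
  qed
  also have "\<dots> \<le> p ((r ^ 4) *\<^sub>R 1 + ((6 * r\<^sup>2) *\<^sub>R (h * h) + h * h * (h * h)))" by (rule upper_le_p)
  finally have "14 * r ^ 4 \<le> p ((?u * ?u) * (?u * ?u) + (?v * ?v) * (?v * ?v))"
    unfolding id by (simp add: p_scaleR)
  also have "\<dots> \<le> p ((?u * ?u) * (?u * ?u)) + p ((?v * ?v) * (?v * ?v))" by (rule p_triangle)
  also have "\<dots> \<le> (p (?u * ?u))\<^sup>2 + (p (?v * ?v))\<^sup>2"
    using p_mult by (simp add: power2_eq_square add_mono)
  finally have sum: "14 * r ^ 4 \<le> (p (?u * ?u))\<^sup>2 + (p (?v * ?v))\<^sup>2" .
  have key: "r / 4 \<le> upper g" if "7 * r ^ 4 \<le> (p ((r *\<^sub>R 1 + g) * (r *\<^sub>R 1 + g)))\<^sup>2"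
    "star g = g" "g * g = h * h" for g
  proof -
    let ?q = "(r *\<^sub>R 1 + g) * (r *\<^sub>R 1 + g)"
    have "(5 / 2 * r\<^sup>2)\<^sup>2 \<le> (p ?q)\<^sup>2"
    proof -
      have "(5 / 2 * r\<^sup>2)\<^sup>2 = 25 / 4 * r ^ 4" by (simp add: power2_eq_square power4_eq_xxxx)
      also have "\<dots> \<le> 7 * r ^ 4" using r by simp
      finally show ?thesis using that by linarith
    qed
    then have "5 / 2 * r\<^sup>2 \<le> p ?q" using p_nonneg power2_le_imp_le by blast
    also have "p ?q = upper ?q" by (rule upper_square[symmetric]) (simp add: star_add that)
    also have "?q = r\<^sup>2 *\<^sub>R 1 + ((2 * r) *\<^sub>R g + h * h)"
      using that(3) by (simp add: algebra_simps power2_eq_square scaleR_double)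
    also have "upper \<dots> \<le> r\<^sup>2 + (2 * r * upper g + r\<^sup>2)"
      using upper_add[of "(2 * r) *\<^sub>R g" "h * h"] r by (simp add: upper_shift upper_scaleR Mhh power2_eq_square)
    finally have "r * (r / 4) \<le> r * upper g" by (simp add: power2_eq_square)
    then show ?thesis using r by simp
  qed
  have "7 * r ^ 4 \<le> (p (?u * ?u))\<^sup>2 \<or> 7 * r ^ 4 \<le> (p (?v * ?v))\<^sup>2" using sum by linarith
  then have "r / 4 \<le> upper h \<or> r / 4 \<le> upper (- h)"
  proof
    assume "7 * r ^ 4 \<le> (p (?u * ?u))\<^sup>2"
    then show ?thesis using key[OF _ h refl] by blast
  next
    assume "7 * r ^ 4 \<le> (p (?v * ?v))\<^sup>2"
    then show ?thesis using key[of "- h"] h by (metis add_uminus_conv_diff minus_mult_minus star_minus)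
  qed
  then show ?thesis unfolding r_def by (simp add: max_def) linarith
qed

end

section \<open>Positivity of $b^*b$\<close>

context cstar_seminorm
begin

text \<open>Commuting positive elements have a positive product, here for \<open>z * z\<close> and \<open>1 - h\<close>. The inequality between
  means, \<open>g \<le> (1 + g * g) / 2\<close>, bounds \<open>1 - h\<close> below by \<open>(1 - h ^ 2 ^ n) / 2 ^ n\<close>, which tends to \<open>0\<close>.\<close>

lemma upper_weight:
  assumes z: "star z = z" and h: "star h = h" and zh: "z * h = h * z" and h1: "p h \<le> 1"
  shows "upper (z * z * h - z * z) \<le> 0"
proof -
  have step: "upper (z * z * g - z * z) \<le> 1/2 * upper (z * z * (g * g) - z * z)"
    if g: "star g = g" "z * g = g * z" for g
  proof -
    have "2 *\<^sub>R (z * z * g - z * z) = (z * z * (g * g) - z * z) + - ((z - z * g) * (z - z * g))"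
    proof -
      have "z * g * z = z * z * g" "z * g * (z * g) = z * z * (g * g)" using g(2) by (metis mult.assoc)+
      then show ?thesis by (simp add: algebra_simps scaleR_2)
    qed
    then have "2 * upper (z * z * g - z * z) = upper ((z * z * (g * g) - z * z) + - ((z - z * g) * (z - z * g)))"
      using upper_scaleR[of 2 "z * z * g - z * z"] by simp
    also have "\<dots> \<le> upper (z * z * (g * g) - z * z) + upper (- ((z - z * g) * (z - z * g)))" by (rule upper_add)
    also have "upper (- ((z - z * g) * (z - z * g))) \<le> 0"
      by (rule upper_minus_square) (simp add: star_diff star_mult z g)
    finally show ?thesis by simp
  qed
  have comm: "z * h ^ k = h ^ k * z" for k
    by (induction k) (simp_all, metis mult.assoc zh)
  have iter: "upper (z * z * h - z * z) \<le> (1/2) ^ n * upper (z * z * h ^ (2 ^ n) - z * z)" for n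
  proof (induction n)
    case (Suc n)
    have "upper (z * z * h ^ (2 ^ n) - z * z) \<le> 1/2 * upper (z * z * (h ^ (2 ^ n) * h ^ (2 ^ n)) - z * z)"
      by (rule step) (simp_all add: star_power h comm)
    also have "h ^ (2 ^ n) * h ^ (2 ^ n) = h ^ (2 ^ Suc n)" by (simp add: mult_2 flip: power_add)
    finally have "(1/2) ^ n * upper (z * z * h ^ (2 ^ n) - z * z) \<le>
        (1/2) ^ n * (1/2 * upper (z * z * h ^ (2 ^ Suc n) - z * z))" by (simp add: mult_left_mono)
    then have "(1/2) ^ n * upper (z * z * h ^ (2 ^ n) - z * z) \<le>
        (1/2) ^ Suc n * upper (z * z * h ^ (2 ^ Suc n) - z * z)" by (simp only: power_Suc2 mult.assoc)
    with Suc show ?case by (rule order_trans)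
  qed simp
  have bound: "upper (z * z * h - z * z) \<le> (1/2) ^ n * (2 * p (z * z))" for n
  proof -
    have "upper (z * z * h ^ (2 ^ n) - z * z) \<le> p (z * z * h ^ (2 ^ n) - z * z)" by (rule upper_le_p)
    also have "\<dots> \<le> p (z * z * h ^ (2 ^ n)) + p (z * z)" by (rule p_diff)
    also have "p (z * z * h ^ (2 ^ n)) \<le> p (z * z) * p (h ^ (2 ^ n))" by (rule p_mult)
    also have "\<dots> \<le> p (z * z) * 1"
      using p_power_le[of h "2 ^ n"] power_le_one[of "p h" "2 ^ n"] h1
      by (intro mult_left_mono) (auto intro: order_trans)
    finally have "(1/2) ^ n * upper (z * z * h ^ (2 ^ n) - z * z) \<le> (1/2) ^ n * (2 * p (z * z))"
      by (intro mult_left_mono) auto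
    then show ?thesis using iter[of n] by linarith
  qed
  have "(\<lambda>n. (1/2::real) ^ n * (2 * p (z * z))) \<longlonglongrightarrow> 0 * (2 * p (z * z))"
    by (intro tendsto_intros LIMSEQ_power_zero) auto
  then have "(\<lambda>n. (1/2::real) ^ n * (2 * p (z * z))) \<longlonglongrightarrow> 0" by simp
  then show ?thesis by (rule LIMSEQ_le_const) (use bound in blast)
qed

text \<open>On the spectrum this is the inequality \<open>m * k * (1 - k) ^ m \<le> 1\<close> for \<open>k \<le> 1\<close> and even \<open>m\<close>. The
  difference of \<open>1 - w ^ m - m * k * w ^ m\<close>, where \<open>w = 1 - k\<close>, for consecutive \<open>m\<close> is the positive element
  \<open>(m + 1) * k * k * w ^ m\<close>.\<close>

lemma upper_decay:
  assumes k: "star k = k" and k1: "p k \<le> 1"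
  shows "real (2 * n) * upper (k * (1 - k) ^ (2 * n)) \<le> 1"
proof -
  define w where "w = 1 - k"
  have w: "star w = w" by (simp add: w_def star_diff k)
  have kw: "k * w = w * k" by (simp add: w_def algebra_simps)
  have kwn: "k * w ^ m = w ^ m * k" for m
    by (induction m) (simp_all, metis mult.assoc kw)
  have kww: "k * w ^ m * (k * w ^ m) = k * k * w ^ (2 * m)" for m
  proof -
    have "k * w ^ m * (k * w ^ m) = k * (w ^ m * k) * w ^ m" by (simp add: mult.assoc)
    also have "\<dots> = k * k * (w ^ m * w ^ m)" by (simp add: kwn[symmetric] mult.assoc)
    finally show ?thesis by (simp add: mult_2 flip: power_add)
  qed
  have pos: "upper (- (k * k * w ^ m)) \<le> 0" for m
  proof (cases "even m")
    case True
    then obtain i where m: "m = 2 * i" by (auto elim: evenE)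
    have "upper (- (k * w ^ i * (k * w ^ i))) \<le> 0"
      by (rule upper_minus_square) (simp add: star_mult star_power k w kwn)
    then show ?thesis by (simp only: m kww)
  next
    case False
    then obtain i where m: "m = Suc (2 * i)" by (auto elim: oddE)
    let ?z = "k * w ^ i"
    have "upper (?z * ?z * k - ?z * ?z) \<le> 0"
    proof (rule upper_weight)
      show "?z * k = k * ?z" by (simp only: mult.assoc kwn[symmetric])
    qed (use k1 in \<open>simp_all add: star_mult star_power k w kwn\<close>)
    also have "?z * ?z * k - ?z * ?z = - (k * k * w ^ m)"
    proof -
      have "?z * ?z * k - ?z * ?z = - (?z * ?z * w)" by (simp add: w_def algebra_simps)
      also have "?z * ?z * w = k * k * w ^ m" by (simp only: kww) (simp only: m mult.assoc power_Suc2)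
      finally show ?thesis .
    qed
    finally show ?thesis .
  qed
  have D: "upper (- (1 - w ^ m - real m *\<^sub>R (k * w ^ m))) \<le> 0" for m
  proof (induction m)
    case (Suc m)
    have id: "1 - w ^ Suc m - real (Suc m) *\<^sub>R (k * w ^ Suc m) =
        (1 - w ^ m - real m *\<^sub>R (k * w ^ m)) + real (Suc m) *\<^sub>R (k * k * w ^ m)"
    proof -
      have e1: "w ^ Suc m = w ^ m - k * w ^ m" by (simp add: w_def algebra_simps)
      have e2: "real (Suc m) *\<^sub>R x = real m *\<^sub>R x + x" for x :: 'a
        by (simp add: scaleR_add_left)
      show ?thesis unfolding e1 e2 by (simp add: algebra_simps)
    qed
    have "upper (- (1 - w ^ Suc m - real (Suc m) *\<^sub>R (k * w ^ Suc m))) \<le>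
      upper (- (1 - w ^ m - real m *\<^sub>R (k * w ^ m))) + upper (real (Suc m) *\<^sub>R (- (k * k * w ^ m)))"
      unfolding id minus_add_distrib scaleR_minus_right[symmetric] by (rule upper_add)
    also have "upper (real (Suc m) *\<^sub>R (- (k * k * w ^ m))) = real (Suc m) * upper (- (k * k * w ^ m))"
      by (rule upper_scaleR) simp
    also have "\<dots> \<le> 0" using pos[of m] by (intro mult_nonneg_nonpos) auto
    finally show ?case using Suc by linarith
  qed simp
  let ?D = "1 - w ^ (2 * n) - real (2 * n) *\<^sub>R (k * w ^ (2 * n))"
  have "real (2 * n) * upper (k * w ^ (2 * n)) = upper (real (2 * n) *\<^sub>R (k * w ^ (2 * n)))"
    by (simp add: upper_scaleR del: of_nat_mult)
  also have "real (2 * n) *\<^sub>R (k * w ^ (2 * n)) = 1 *\<^sub>R 1 + (- (w ^ (2 * n)) + - ?D)" by simp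
  also have "upper \<dots> = 1 + upper (- (w ^ (2 * n)) + - ?D)" by (rule upper_shift)
  also have "\<dots> \<le> 1 + (upper (- (w ^ (2 * n))) + upper (- ?D))" using upper_add by (rule add_left_mono)
  also have "upper (- ?D) \<le> 0" by (rule D)
  also have "upper (- (w ^ (2 * n))) \<le> 0"
    using upper_minus_square[of "w ^ n"] by (simp add: star_power w mult_2 power_add)
  finally show ?thesis by (simp add: w_def)
qed

text \<open>This replaces the fact that \<open>star b * b\<close> and \<open>b * star b\<close> have the same spectrum up to \<open>0\<close>. The powers of
  \<open>w = t - star b * b\<close> and \<open>w' = t - b * star b\<close> are intertwined by \<open>b\<close>, so a power of \<open>w\<close> is a sum of
  terms that are controlled by powers of \<open>w'\<close>, and it grows at most linearly faster than these.\<close>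

lemma p_one_minus_swap:
  assumes t: "0 < t"
  shows "p (t *\<^sub>R 1 - star b * b) \<le> max t (p (t *\<^sub>R 1 - b * star b))"
proof -
  define w where "w = t *\<^sub>R 1 - star b * b"
  define w' where "w' = t *\<^sub>R 1 - b * star b"
  define r where "r = max t (p w')"
  have r: "0 < r" "t \<le> r" "p w' \<le> r" using t by (auto simp: r_def)
  have sw: "star w = w" by (simp add: w_def star_diff star_mult star_star)
  have intertw: "star b * w' ^ j = w ^ j * star b" for j
  proof (induction j)
    case (Suc j)
    have "star b * w' = w * star b" by (simp add: w_def w'_def algebra_simps)
    then show ?case using Suc by (simp add: mult.assoc) (metis mult.assoc)
  qed simp
  have step: "w ^ Suc N = t *\<^sub>R w ^ N - star b * w' ^ N * b" for N
  proof -
    have "w ^ Suc N = w ^ N * w" by (simp add: power_commutes)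
    also have "\<dots> = t *\<^sub>R w ^ N - w ^ N * star b * b" by (simp add: w_def algebra_simps)
    finally show ?thesis by (simp add: intertw)
  qed
  have bound: "p (w ^ N) * r \<le> (r + real N * (p b)\<^sup>2) * r ^ N" for N
  proof (induction N)
    case (Suc N)
    have "p (star b * w' ^ N * b) \<le> p (star b) * p (w' ^ N) * p b"
      using p_mult by (meson mult_right_mono order_trans p_nonneg)
    also have "\<dots> \<le> p b * r ^ N * p b"
      using p_power_le[of w' N] power_mono[OF r(3), of N]
      by (auto intro!: mult_right_mono mult_left_mono)
    finally have 1: "p (star b * w' ^ N * b) \<le> (p b)\<^sup>2 * r ^ N" by (simp add: power2_eq_square mult_ac)
    have "p (w ^ Suc N) \<le> t * p (w ^ N) + p (star b * w' ^ N * b)"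
      unfolding step using p_diff[of "t *\<^sub>R w ^ N"] t by (simp add: p_scaleR)
    also have "\<dots> \<le> r * p (w ^ N) + (p b)\<^sup>2 * r ^ N"
      using 1 r by (intro add_mono mult_right_mono) auto
    finally have "p (w ^ Suc N) * r \<le> (r * p (w ^ N) + (p b)\<^sup>2 * r ^ N) * r"
      using r by (intro mult_right_mono) auto
    also have "\<dots> = r * (p (w ^ N) * r) + (p b)\<^sup>2 * r ^ Suc N" by (simp add: algebra_simps)
    also have "\<dots> \<le> r * ((r + real N * (p b)\<^sup>2) * r ^ N) + (p b)\<^sup>2 * r ^ Suc N"
      using Suc r by (intro add_right_mono mult_left_mono) auto
    also have "\<dots> = (r + real (Suc N) * (p b)\<^sup>2) * r ^ Suc N" by (simp add: algebra_simps)
    finally show ?case .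
  qed (simp add: p_one)
  have "p w \<le> r"
  proof (rule le_of_power_growth)
    fix n :: nat
    have "p w ^ (2 ^ n) = p (w ^ (2 ^ n))" using sw by (simp add: p_power_2n)
    also have "\<dots> \<le> (r + real (2 ^ n) * (p b)\<^sup>2) * r ^ (2 ^ n) / r"
      using bound[of "2 ^ n"] r by (simp add: pos_le_divide_eq)
    also have "\<dots> = (1 + real (2 ^ n) * ((p b)\<^sup>2 / r)) * r ^ (2 ^ n)"
      using r by (simp add: field_simps)
    also have "\<dots> \<le> (1 + (p b)\<^sup>2 / r) * (2 ^ n + 1) * r ^ (2 ^ n)"
      using r by (intro mult_right_mono) (auto simp: field_simps)
    finally show "p w ^ (2 ^ n) \<le> (1 + (p b)\<^sup>2 / r) * (2 ^ n + 1) * r ^ (2 ^ n)" .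
  qed (use r in auto)
  then show ?thesis by (simp add: w_def w'_def r_def)
qed

lemma upper_swap: "upper (- (star b * b)) \<le> max 0 (upper (- (b * star b)))"
proof (rule field_le_epsilon)
  fix e :: real assume e: "0 < e"
  obtain t where t: "0 \<le> t" "p (t *\<^sub>R 1 + - (b * star b)) - t < upper (- (b * star b)) + e"
    using upper_less[of "- (b * star b)" "upper (- (b * star b)) + e"] e by auto
  have "upper (- (star b * b)) \<le> p (t *\<^sub>R 1 + - (star b * b)) - t" using t by (intro upper_le)
  also have "\<dots> \<le> max 0 (p (t *\<^sub>R 1 + - (b * star b)) - t)"
  proof (cases "t = 0")
    case True then show ?thesis by (simp add: p_cstar p_cstar')
  next
    case False then show ?thesis using p_one_minus_swap[of t b] t by (simp add: max_def split: if_splits)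
  qed
  finally show "upper (- (star b * b)) \<le> max 0 (upper (- (b * star b))) + e" using t e by (simp add: max_def split: if_splits)
qed

text \<open>For \<open>c = (x + i y) / 2\<close> with \<open>x\<close>, \<open>y\<close> self-adjoint, \<open>star c * c + c * star c\<close> is half of
  \<open>x * x + y * y\<close>.\<close>

lemma upper_minus_sum_swap: "upper (- (star c * c + c * star c)) \<le> 0"
proof -
  define x where "x = c + star c"
  define y where "y = scaleC \<i> (c - star c)"
  have sx: "star x = x" by (simp add: x_def star_add star_star add.commute)
  have sy: "star y = y"
    by (simp add: y_def star_scaleC star_diff star_star scaleC_minus_left scaleC_diff_right)
  have "x * x + y * y = 2 *\<^sub>R (star c * c + c * star c)"
    by (simp add: x_def y_def mult_scaleC_left mult_scaleC_right scaleC_ii_ii scaleC_diff_right algebra_simps scaleR_2)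
  then have "2 * upper (- (star c * c + c * star c)) = upper (- (x * x) + - (y * y))"
    using upper_scaleR[of 2 "- (star c * c + c * star c)"]
    by (metis minus_add_distrib scaleR_minus_right zero_le_numeral)
  also have "\<dots> \<le> upper (- (x * x)) + upper (- (y * y))" by (rule upper_add)
  also have "\<dots> \<le> 0" using upper_minus_square[OF sx] upper_minus_square[OF sy] by linarith
  finally show ?thesis by simp
qed

text \<open>The factor \<open>(1 - k) ^ n\<close> is huge where \<open>k = star b * b\<close> is negative and suppresses the positive part of \<open>k\<close>.
  So \<open>c = b * (1 - k) ^ n\<close> has an almost negative \<open>star c * c\<close>; then \<open>c * star c\<close> is almost positive, hence
  so is \<open>star c * c\<close> by the swap, and it must be small.\<close>

lemma p_decay:
  assumes b: "p b \<le> 1" and n: "0 < n"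
  shows "p (star b * b * (1 - star b * b) ^ (2 * n)) \<le> 2 / real n"
proof -
  define k where "k = star b * b"
  define w where "w = 1 - k"
  have k: "star k = k" by (simp add: k_def star_mult star_star)
  have k1: "p k \<le> 1" using b by (simp add: k_def p_cstar power_le_one)
  have w: "star w = w" by (simp add: w_def star_diff k)
  have kw: "k * w = w * k" by (simp add: w_def algebra_simps)
  have kwn: "k * w ^ m = w ^ m * k" for m
    by (induction m) (simp_all, metis mult.assoc kw)
  define c where "c = b * w ^ n"
  have cc: "star c * c = k * w ^ (2 * n)"
  proof -
    have "star c * c = w ^ n * k * w ^ n" by (simp add: c_def star_mult star_power w k_def mult.assoc)
    also have "\<dots> = k * (w ^ n * w ^ n)" by (simp add: kwn[symmetric] mult.assoc)
    finally show ?thesis by (simp add: mult_2 power_add)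
  qed
  have up: "upper (star c * c) \<le> 1 / (2 * n)"
    using upper_decay[OF k k1, of n] n by (simp add: cc w_def pos_le_divide_eq mult.commute)
  have "upper (- (c * star c)) \<le> upper (star c * c) + upper (- (star c * c + c * star c))"
    using upper_add[of "star c * c" "- (star c * c + c * star c)"] by simp
  then have "upper (- (c * star c)) \<le> 1 / (2 * n)" using up upper_minus_sum_swap[of c] by linarith
  then have "upper (- (star c * c)) \<le> 1 / (2 * n)"
    using upper_swap[of c] by (smt (verit) divide_nonneg_nonneg of_nat_0_le_iff)
  then have "max (upper (star c * c)) (upper (- (star c * c))) \<le> 1 / (2 * n)" using up by simp
  moreover have "p (star c * c) \<le> 4 * max (upper (star c * c)) (upper (- (star c * c)))"
    by (rule p_le_max_upper) (simp add: star_mult star_star)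
  ultimately have "p (star c * c) \<le> 4 * (1 / (2 * n))" by linarith
  then show ?thesis by (simp add: cc w_def k_def)
qed

text \<open>The powers of \<open>1 - star b * b\<close> grow at most linearly by \<open>p_decay\<close>.\<close>

lemma p_one_minus_le:
  assumes b: "p b \<le> 1"
  shows "p (1 - star b * b) \<le> 1"
proof -
  define k where "k = star b * b"
  define w where "w = 1 - k"
  have k1: "p k \<le> 1" using b by (simp add: k_def p_cstar power_le_one)
  have w: "star w = w" by (simp add: w_def k_def star_diff star_mult star_star)
  have kw: "k * w ^ m = w ^ m * k" for m
  proof (induction m)
    case (Suc m)
    have "k * w = w * k" by (simp add: w_def algebra_simps)
    with Suc show ?case by simp (metis mult.assoc)
  qed simp
  have w2: "w * w = 1 - k * (2 *\<^sub>R 1 - k)" by (simp add: w_def algebra_simps scaleR_2)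
  have p3: "p (2 *\<^sub>R 1 - k) \<le> 3" using p_diff[of "2 *\<^sub>R 1" k] k1 by (simp add: p_of_real)
  have bound: "p (w ^ (2 * n)) \<le> 6 * real n + 4" for n
  proof (induction n)
    case (Suc n)
    show ?case
    proof (cases "n = 0")
      case True
      have "p w \<le> 2" using p_diff[of 1 k] k1 by (simp add: w_def p_one)
      then have "p w ^ 2 \<le> 2 ^ 2" by (intro power_mono) auto
      then show ?thesis using p_power_le[of w 2] True by simp
    next
      case False
      have "w ^ (2 * Suc n) = w ^ (2 * n + 2)" by simp
      also have "\<dots> = w ^ (2 * n) * (w * w)" by (simp only: power_add power2_eq_square)
      also have "\<dots> = w ^ (2 * n) - k * w ^ (2 * n) * (2 *\<^sub>R 1 - k)"
        unfolding w2 kw by (simp add: right_diff_distrib mult.assoc)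
      finally have "p (w ^ (2 * Suc n)) \<le> p (w ^ (2 * n)) + p (k * w ^ (2 * n) * (2 *\<^sub>R 1 - k))"
        using p_diff by simp
      also have "p (k * w ^ (2 * n) * (2 *\<^sub>R 1 - k)) \<le> p (k * w ^ (2 * n)) * p (2 *\<^sub>R 1 - k)"
        by (rule p_mult)
      also have "\<dots> \<le> 2 * 3"
      proof (intro mult_mono)
        have "p (k * w ^ (2 * n)) \<le> 2 / real n" using p_decay[OF b] False by (simp add: k_def w_def)
        also have "\<dots> \<le> 2" using False by (simp add: divide_le_eq)
        finally show "p (k * w ^ (2 * n)) \<le> 2" .
      qed (use p3 in auto)
      finally show ?thesis using Suc by simp
    qed
  qed (simp add: p_one)
  have "p w ^ 2 \<le> 1"
  proof (rule le_of_power_growth)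
    fix n :: nat
    have "(p w ^ 2) ^ (2 ^ n) = p w ^ (2 ^ Suc n)" by (simp add: power_mult)
    also have "\<dots> = p (w ^ (2 * 2 ^ n))" using p_power_2n[OF w, of "Suc n"] by simp
    also have "\<dots> \<le> 6 * (2 ^ n + 1) * 1 ^ (2 ^ n)" using bound[of "2 ^ n"] by simp
    finally show "(p w ^ 2) ^ (2 ^ n) \<le> 6 * (2 ^ n + 1) * 1 ^ (2 ^ n)" .
  qed auto
  then have "p w \<le> 1" by (simp add: power_le_one_iff abs_le_square_iff)
  then show ?thesis by (simp add: w_def k_def)
qed

theorem upper_minus_star_mult: "upper (- (star b * b)) \<le> 0"
proof (cases "p b = 0")
  case True
  then show ?thesis using upper_le_p[of "- (star b * b)"] by (simp add: p_cstar)
next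
  case False
  then have pb: "0 < p b" using p_nonneg[of b] by linarith
  define c where "c = inverse (p b) *\<^sub>R b"
  have "p c = 1" using pb by (simp add: c_def p_scaleR)
  then have "upper (- (star c * c)) \<le> 0"
    using p_one_minus_le[of c] upper_le[of 1 "- (star c * c)"] by simp
  moreover have "- (star b * b) = (p b)\<^sup>2 *\<^sub>R (- (star c * c))"
    using pb by (simp add: c_def power2_eq_square field_simps)
  ultimately show ?thesis
    using upper_scaleR[of "(p b)\<^sup>2" "- (star c * c)"] pb by (simp add: mult_nonneg_nonpos)
qed

lemma upper_star_mult_pos: "0 < p b \<Longrightarrow> 0 < upper (star b * b)"
proof -
  assume b: "0 < p b"
  have "0 < p (star b * b)" using b by (simp add: p_cstar)
  also have "p (star b * b) \<le> 4 * max (upper (star b * b)) (upper (- (star b * b)))"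
    by (rule p_le_max_upper) (simp add: star_mult star_star)
  finally show ?thesis using upper_minus_star_mult[of b] by (simp add: max_def split: if_splits)
qed

end

section \<open>Square roots, endomorphisms and ideals\<close>

lemma zero_of_one_zero: "(1::'a::unital_cstar_algebra) = 0 \<Longrightarrow> (x::'a) = 0"
  by (metis mult_1_left mult_zero_left)

lemma cstar_seminorm_norm: "(1::'a::unital_cstar_algebra) \<noteq> 0 \<Longrightarrow> cstar_seminorm (norm :: 'a \<Rightarrow> real)"
proof
  assume ne: "(1::'a) \<noteq> 0"
  have "norm (1::'a) * norm (1::'a) = norm (1::'a) * 1"
    using cstar_identity[of "1::'a"] by (simp add: power2_eq_square)
  then show "norm (1::'a) = 1" using ne by simp
qed (auto simp: norm_triangle_ineq norm_scaleC norm_mult_ineq cstar_identity)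

lemma norm_star: "norm (star x) = norm (x::'a::unital_cstar_algebra)"
proof (cases "(1::'a) = 0")
  case True
  then show ?thesis using zero_of_one_zero[of x] zero_of_one_zero[of "star x"] by simp
next
  case False
  interpret cstar_seminorm "norm :: 'a \<Rightarrow> real" using False by (rule cstar_seminorm_norm)
  show ?thesis by simp
qed

lemma tendsto_star: "(f \<longlongrightarrow> l) F \<Longrightarrow> ((\<lambda>x. star (f x)) \<longlongrightarrow> star (l::'a::unital_cstar_algebra)) F"
  unfolding tendsto_iff dist_norm by (simp flip: star_diff add: norm_star)

text \<open>The elements \<open>1 - (1 - star b * b) ^ n\<close> act as right units for \<open>b\<close> in the limit. They lie in every ideal that
  contains \<open>b\<close> and take the place of an approximate unit.\<close>

lemma approximate_kernel:
  fixes b :: "'a::unital_cstar_algebra"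
  assumes b: "norm b \<le> 1"
  shows "(\<lambda>n. b * (1 - star b * b) ^ n) \<longlonglongrightarrow> 0"
proof (cases "(1::'a) = 0")
  case True
  have "(\<lambda>n. b * (1 - star b * b) ^ n) = (\<lambda>n. 0)" using zero_of_one_zero[OF True] by blast
  then show ?thesis by simp
next
  case False
  interpret cstar_seminorm "norm :: 'a \<Rightarrow> real" using False by (rule cstar_seminorm_norm)
  define k where "k = star b * b"
  define v where "v n = (1 - k) ^ n" for n
  have sv: "star (v n) = v n" for n by (simp add: v_def k_def star_power star_diff star_mult star_star)
  have comm: "v n * k = k * v n" for n
  proof (induction n)
    case (Suc n)
    have "v (Suc n) * k = (1 - k) * (k * v n)" using Suc by (simp add: v_def mult.assoc)
    also have "\<dots> = k * v (Suc n)" by (simp add: v_def algebra_simps)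
    finally show ?case .
  qed (simp add: v_def)
  have small: "(norm (b * v n))\<^sup>2 \<le> 2 / real n" if "0 < n" for n
  proof -
    have "(norm (b * v n))\<^sup>2 = norm (star (b * v n) * (b * v n))" by (simp add: cstar_identity)
    also have "star (b * v n) * (b * v n) = v n * k * v n" by (simp add: star_mult sv k_def mult.assoc)
    also have "\<dots> = k * (v n * v n)" by (simp only: comm mult.assoc)
    also have "v n * v n = (1 - k) ^ (2 * n)" by (simp only: v_def mult_2 power_add)
    also have "norm (k * (1 - k) ^ (2 * n)) \<le> 2 / real n"
      unfolding k_def using b that by (rule p_decay)
    finally show ?thesis .
  qed
  have "(\<lambda>n. 2 / real n) \<longlonglongrightarrow> 0" by (rule lim_const_over_n)
  then have "(\<lambda>n. (norm (b * v n))\<^sup>2) \<longlonglongrightarrow> 0"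
    by (intro tendsto_sandwich[of "\<lambda>_. 0" "\<lambda>n. (norm (b * v n))\<^sup>2" sequentially "\<lambda>n. 2 / real n"])
      (use small in \<open>auto intro!: eventually_sequentiallyI[of 1]\<close>)
  then have "(\<lambda>n. sqrt ((norm (b * v n))\<^sup>2)) \<longlonglongrightarrow> sqrt 0" by (rule tendsto_real_sqrt)
  then show ?thesis by (simp add: tendsto_norm_zero_iff v_def k_def)
qed

text \<open>With \<open>d = 1 - e\<close> the equation says \<open>d * d = 1 - h\<close>. The iteration \<open>e \<mapsto> (h + e * e) / 2\<close> from \<open>0\<close> is dominated
  term by term by the real iteration for \<open>h = 1\<close>, which is monotone and bounded by \<open>1\<close>; thus it converges
  even for \<open>norm h = 1\<close>.\<close>

lemma square_root_exists:
  fixes h :: "'a::unital_cstar_algebra"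
  assumes h: "star h = h" "norm h \<le> 1"
  obtains e where "star e = e" "norm e \<le> 1" "e + e = h + e * e" "\<And>z. z * h = h * z \<Longrightarrow> z * e = e * z"
proof -
  define E where "E = rec_nat 0 (\<lambda>_ x. (1/2) *\<^sub>R (h + x * x))"
  define t :: "nat \<Rightarrow> real" where "t = rec_nat 0 (\<lambda>_ x. (1/2) * (1 + x * x))"
  have E: "E 0 = 0" "E (Suc n) = (1/2) *\<^sub>R (h + E n * E n)" for n by (simp_all add: E_def)
  have t: "t 0 = 0" "t (Suc n) = (1/2) * (1 + t n * t n)" for n by (simp_all add: t_def)
  have t01: "0 \<le> t n \<and> t n \<le> 1" for n
  proof (induction n)
    case (Suc n)
    then have "t n * t n \<le> 1 * 1" by (intro mult_mono) auto
    then show ?case by (simp add: t)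
  qed (simp add: t)
  have Et: "norm (E n) \<le> t n" for n
  proof (induction n)
    case (Suc n)
    have "norm (E n * E n) \<le> t n * t n"
      using Suc norm_mult_ineq[of "E n" "E n"] t01[of n] mult_mono[OF Suc Suc] by auto
    then have "norm (h + E n * E n) \<le> 1 + t n * t n" using h norm_triangle_ineq[of h "E n * E n"] by linarith
    then show ?case by (simp add: E t)
  qed (simp add: E t)
  have step: "norm (E (Suc n) - E n) \<le> t (Suc n) - t n" for n
  proof (induction n)
    case (Suc n)
    let ?d = "E (Suc n) - E n" and ?s = "t (Suc n) - t n"
    have "E (Suc (Suc n)) - E (Suc n) = (1/2) *\<^sub>R (E (Suc n) * ?d + ?d * E n)"
      unfolding E(2)[of "Suc n"] E(2)[of n] by (simp add: algebra_simps)
    then have "norm (E (Suc (Suc n)) - E (Suc n)) = (1/2) * norm (E (Suc n) * ?d + ?d * E n)"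
      by simp
    also have "\<dots> \<le> (1/2) * (norm (E (Suc n) * ?d) + norm (?d * E n))"
      by (intro mult_left_mono norm_triangle_ineq) simp
    also have "\<dots> \<le> (1/2) * (t (Suc n) * ?s + ?s * t n)"
    proof (intro mult_left_mono add_mono)
      show "norm (E (Suc n) * ?d) \<le> t (Suc n) * ?s"
        by (rule order_trans[OF norm_mult_ineq mult_mono[OF Et Suc]]) (use t01 in auto)
      show "norm (?d * E n) \<le> ?s * t n"
        by (rule order_trans[OF norm_mult_ineq mult_mono[OF Suc Et]]) (use Suc norm_ge_zero order_trans in blast)+
    qed simp
    also have "\<dots> = t (Suc (Suc n)) - t (Suc n)"
      unfolding t(2)[of "Suc n"] t(2)[of n] by (simp add: algebra_simps)
    finally show ?case .
  qed (use h in \<open>simp add: E t\<close>)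
  have diff: "norm (E (m + k) - E m) \<le> t (m + k) - t m" for m k
  proof (induction k)
    case (Suc k)
    have "norm (E (m + Suc k) - E m) \<le> norm (E (Suc (m + k)) - E (m + k)) + norm (E (m + k) - E m)"
      using norm_triangle_ineq[of "E (Suc (m + k)) - E (m + k)" "E (m + k) - E m"] by simp
    then show ?case using Suc step[of "m + k"] by simp
  qed simp
  have mono: "incseq t"
    by (rule incseq_SucI) (use step norm_ge_zero order_trans in \<open>smt (verit)\<close>)
  have "convergent t" using incseq_convergent[OF mono, of 1] t01 by (metis convergent_def)
  then have Ct: "Cauchy t" by (rule convergent_Cauchy)
  have "Cauchy E"
  proof (rule CauchyI)
    fix x :: real assume "0 < x"
    then obtain N where N: "\<And>m n. m \<ge> N \<Longrightarrow> n \<ge> N \<Longrightarrow> norm (t m - t n) < x"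
      using CauchyD[OF Ct] by blast
    have *: "norm (E n - E m) < x" if "m \<ge> N" "n \<ge> m" for m n
      using diff[of m "n - m"] N[of n m] that by auto
    show "\<exists>N. \<forall>m\<ge>N. \<forall>n\<ge>N. norm (E m - E n) < x"
      by (rule exI[of _ N]) (use * in \<open>metis norm_minus_commute nle_le\<close>)
  qed
  then obtain e where e: "E \<longlonglongrightarrow> e" using Cauchy_convergent convergent_def by blast
  have sE: "star (E n) = E n" for n by (induction n) (simp_all add: E h star_add star_mult)
  have zE: "z * E n = E n * z" if z: "z * h = h * z" for z n
  proof (induction n)
    case (Suc n)
    have "z * (E n * E n) = E n * E n * z" using Suc by (metis mult.assoc)
    then show ?case by (simp add: E z algebra_simps)
  qed (simp add: E)
  show ?thesis
  proof
    show "star e = e" using tendsto_star[OF e] e by (simp add: sE LIMSEQ_unique)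
    show "norm e \<le> 1" by (rule LIMSEQ_le_const2[OF tendsto_norm[OF e]]) (use Et t01 order_trans in blast)
    have "(\<lambda>n. (1/2) *\<^sub>R (h + E n * E n)) \<longlonglongrightarrow> (1/2) *\<^sub>R (h + e * e)"
      by (intro tendsto_intros e)
    moreover have "(\<lambda>n. E (Suc n)) \<longlonglongrightarrow> e" using e by (rule LIMSEQ_Suc)
    ultimately have "e = (1/2) *\<^sub>R (h + e * e)" unfolding E by (rule LIMSEQ_unique[symmetric])
    then have "2 *\<^sub>R e = h + e * e" by (metis (no_types) scaleR_half_double scaleR_2 scaleR_right_distrib)
    then show "e + e = h + e * e" by (simp add: scaleR_2)
    show "z * e = e * z" if "z * h = h * z" for z
    proof (rule LIMSEQ_unique)
      show "(\<lambda>n. z * E n) \<longlonglongrightarrow> z * e" by (intro tendsto_intros e)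
      show "(\<lambda>n. z * E n) \<longlonglongrightarrow> e * z" unfolding zE[OF that] by (intro tendsto_intros e)
    qed
  qed
qed

text \<open>The difference satisfies \<open>2 * (e - f) = e * (e - f) + (e - f) * f\<close>.\<close>

lemma square_root_unique:
  fixes e f h :: "'a::unital_cstar_algebra"
  assumes "e + e = h + e * e" "f + f = h + f * f" "norm e \<le> 1" "norm f < 1"
  shows "e = f"
proof -
  let ?d = "e - f"
  have "?d + ?d = (e + e) - (f + f)" by simp
  also have "\<dots> = e * e - f * f" unfolding assms(1,2) by simp
  also have "\<dots> = e * ?d + ?d * f" by (simp add: algebra_simps)
  finally have "2 *\<^sub>R ?d = e * ?d + ?d * f" by (simp add: scaleR_2)
  then have "2 * norm ?d = norm (e * ?d + ?d * f)" by (metis abs_numeral norm_scaleR)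
  also have "\<dots> \<le> norm e * norm ?d + norm ?d * norm f"
    by (intro order_trans[OF norm_triangle_ineq] add_mono norm_mult_ineq)
  also have "\<dots> \<le> 1 * norm ?d + norm ?d * norm f" by (intro add_right_mono mult_right_mono assms) simp
  finally have "norm ?d * (1 - norm f) \<le> 0" by (simp add: algebra_simps)
  then have "norm ?d \<le> 0" using assms(4) by (simp add: mult_le_0_iff)
  then show ?thesis by simp
qed

lemma one_minus_square_exists:
  fixes h :: "'a::unital_cstar_algebra"
  assumes h: "star h = h" "norm h \<le> 1"
  obtains d where "star d = d" "d * d = 1 - h"
proof -
  obtain e where e: "star e = e" "e + e = h + e * e" using square_root_exists[OF h] by metis
  show ?thesis
  proof
    show "star (1 - e) = 1 - e" by (simp add: star_diff e)
    have "h = e + e - e * e" using e(2) by (simp add: algebra_simps)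
    then show "(1 - e) * (1 - e) = 1 - h" by (simp add: algebra_simps)
  qed
qed

locale star_endo =
  fixes \<delta> :: "'a::unital_cstar_algebra \<Rightarrow> 'a"
  assumes endo: "star_endomorphism \<delta>"
begin

lemma d_add: "\<delta> (a + b) = \<delta> a + \<delta> b" using endo by (simp add: star_endomorphism_def)
lemma d_scaleC: "\<delta> (scaleC c a) = scaleC c (\<delta> a)" using endo by (simp add: star_endomorphism_def)
lemma d_mult: "\<delta> (a * b) = \<delta> a * \<delta> b" using endo by (simp add: star_endomorphism_def)
lemma d_star: "\<delta> (star a) = star (\<delta> a)" using endo by (simp add: star_endomorphism_def)
lemma d_scaleR: "\<delta> (r *\<^sub>R a) = r *\<^sub>R \<delta> a" using d_scaleC[of "complex_of_real r" a] by (simp add: scaleC_of_real)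
lemma d_zero: "\<delta> 0 = 0" using d_scaleR[of 0 0] by simp
lemma d_minus: "\<delta> (- a) = - \<delta> a" using d_scaleR[of "-1" a] by simp
lemma d_diff: "\<delta> (a - b) = \<delta> a - \<delta> b" using d_add[of a "- b"] by (simp add: d_minus)
lemma d_power: "\<delta> (a ^ Suc n) = \<delta> a ^ Suc n" by (induction n) (simp_all add: d_mult)
lemma d_unit: "\<delta> 1 * \<delta> a = \<delta> a" "\<delta> a * \<delta> 1 = \<delta> a" using d_mult[of 1 a] d_mult[of a 1] by simp_all

lemma norm_d_one: "norm (\<delta> 1) \<le> 1"
proof -
  have "norm (\<delta> 1) * norm (\<delta> 1) = norm (\<delta> 1)"
    using cstar_identity[of "\<delta> 1"] by (simp add: d_star[symmetric] d_mult[symmetric] power2_eq_square)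
  then show ?thesis by (metis mult_cancel_left1 norm_zero norm_eq_zero order_refl zero_le_one)
qed

text \<open>The image of \<open>1 - h = d * d\<close> is again a square, so \<open>upper (\<delta> h)\<close> is at most \<open>1\<close>; the factor \<open>4\<close> of
  \<open>p_le_max_upper\<close> disappears on powers of \<open>h\<close>.\<close>

lemma norm_le: "norm (\<delta> a) \<le> norm a"
proof (cases "a = 0")
  case True
  then show ?thesis by (simp add: d_zero)
next
  case a: False
  then have "(1::'a) \<noteq> 0" using zero_of_one_zero by blast
  then interpret cstar_seminorm "norm :: 'a \<Rightarrow> real" by (rule cstar_seminorm_norm)
  have up: "upper (\<delta> h) \<le> 1" if h: "star h = h" "norm h \<le> 1" for h
  proof -
    obtain d where d: "star d = d" "d * d = 1 - h" using one_minus_square_exists[OF h] .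
    have "\<delta> h = \<delta> 1 + - (\<delta> d * \<delta> d)" by (simp flip: d_mult d_diff d_minus d_add add: d)
    then have "upper (\<delta> h) \<le> upper (\<delta> 1) + upper (- (\<delta> d * \<delta> d))" by (metis upper_add)
    also have "upper (- (\<delta> d * \<delta> d)) \<le> 0" by (rule upper_minus_square) (simp flip: d_star add: d)
    finally show ?thesis using upper_le_p[of "\<delta> 1"] norm_d_one by linarith
  qed
  have four: "norm (\<delta> h) \<le> 4" if h: "star h = h" "norm h \<le> 1" for h
    using p_le_max_upper[of "\<delta> h"] up[OF h] up[of "- h"] h by (simp add: d_minus flip: d_star)
  have sa: "norm (\<delta> h) \<le> 1" if h: "star h = h" "norm h \<le> 1" for h
  proof (rule le_of_power_growth)
    fix n :: nat
    obtain m where m: "(2::nat) ^ n = Suc m" by (metis not0_implies_Suc power_not_zero zero_neq_numeral)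
    have "norm (\<delta> h) ^ (2 ^ n) = norm (\<delta> (h ^ (2 ^ n)))"
      using p_power_2n[of "\<delta> h" n] h unfolding m d_power by (simp flip: d_star)
    also have "\<dots> \<le> 4"
      by (rule four) (use h p_power_le[of h "2 ^ n"] power_le_one[of "norm h" "2 ^ n"] in \<open>auto simp: star_power\<close>)
    also have "4 \<le> 4 * (2 ^ n + 1) * (1::real) ^ (2 ^ n)" by simp
    finally show "norm (\<delta> h) ^ (2 ^ n) \<le> 4 * (2 ^ n + 1) * 1 ^ (2 ^ n)" .
  qed auto
  define c where "c = inverse (norm a) *\<^sub>R a"
  have "norm c = 1" using a by (simp add: c_def)
  then have "norm (star c * c) \<le> 1" by (simp add: cstar_identity)
  then have "norm (\<delta> (star c * c)) \<le> 1" by (intro sa) (simp_all add: star_mult star_star)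
  then have "(norm (\<delta> c))\<^sup>2 \<le> 1" by (simp add: d_mult d_star cstar_identity)
  then have "norm (\<delta> c) \<le> 1" by (simp add: power_le_one_iff)
  then show ?thesis using a by (simp add: c_def d_scaleR divide_simps)
qed

end

locale cstar_ideal =
  fixes J :: "'a::unital_cstar_algebra set"
  assumes ideal: "closed_ideal J"
begin

lemma J_closed: "closed J" and J_zero: "0 \<in> J" and J_add: "a \<in> J \<Longrightarrow> b \<in> J \<Longrightarrow> a + b \<in> J"
  and J_scaleC: "a \<in> J \<Longrightarrow> scaleC c a \<in> J" and J_left: "a \<in> J \<Longrightarrow> x * a \<in> J"
  and J_right: "a \<in> J \<Longrightarrow> a * x \<in> J"
  using ideal by (auto simp: closed_ideal_def)

lemma J_scaleR: "a \<in> J \<Longrightarrow> r *\<^sub>R a \<in> J"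
  using J_scaleC[of a "complex_of_real r"] by (simp add: scaleC_of_real)

lemma J_minus: "a \<in> J \<Longrightarrow> - a \<in> J"
  using J_scaleR[of a "-1"] by simp

lemma J_one_minus_power: "m \<in> J \<Longrightarrow> 1 - (1 - m) ^ n \<in> J"
proof (induction n)
  case (Suc n)
  have "1 - (1 - m) ^ Suc n = (1 - (1 - m) ^ n) + m * (1 - m) ^ n" by (simp add: algebra_simps)
  then show ?case using Suc by (metis J_add J_right)
qed (simp add: J_zero)

text \<open>For \<open>b\<close> a multiple of \<open>star j\<close>, the elements \<open>b * (1 - (1 - star b * b) ^ n)\<close> lie in \<open>J\<close>, because
  \<open>star b * b\<close> is a multiple of \<open>j * star j\<close>, and they converge to \<open>b\<close>.\<close>

lemma J_star: assumes j: "j \<in> J" shows "star j \<in> J"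
proof (cases "j = 0")
  case True
  then show ?thesis using j by simp
next
  case j0: False
  define b where "b = inverse (norm j) *\<^sub>R star j"
  have b1: "norm b = 1" using j0 by (simp add: b_def norm_star)
  have m: "star b * b \<in> J" using J_right[OF j, of "star j"] by (simp add: b_def star_star J_scaleR)
  define v where "v n = (1 - star b * b) ^ n" for n
  have "(\<lambda>n. b - b * v n) \<longlonglongrightarrow> b - 0"
    unfolding v_def using b1 by (intro tendsto_diff tendsto_const approximate_kernel) simp
  moreover have "b - b * v n \<in> J" for n
    using J_left[OF J_one_minus_power[OF m, of n], of b] by (simp add: v_def right_diff_distrib)
  ultimately have "b \<in> J" using closed_sequentially[OF J_closed] by (metis diff_zero)
  then have "norm j *\<^sub>R b \<in> J" by (rule J_scaleR)
  then show ?thesis using j0 by (simp add: b_def)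
qed

definition quotient_norm :: "'a \<Rightarrow> real" where
  "quotient_norm a = (INF j\<in>J. norm (a + j))"

lemma quotient_norm_le: "j \<in> J \<Longrightarrow> quotient_norm a \<le> norm (a + j)"
  unfolding quotient_norm_def by (rule cINF_lower) (auto intro: bdd_belowI[of _ 0])

lemma quotient_norm_ge: "(\<And>j. j \<in> J \<Longrightarrow> c \<le> norm (a + j)) \<Longrightarrow> c \<le> quotient_norm a"
  unfolding quotient_norm_def by (rule cINF_greatest) (use J_zero in auto)

lemma quotient_norm_nonneg: "0 \<le> quotient_norm a"
  by (rule quotient_norm_ge) simp

lemma quotient_norm_approx:
  assumes "0 < e" obtains j where "j \<in> J" "norm (a + j) < quotient_norm a + e"
  using assms quotient_norm_ge[of "quotient_norm a + e" a] by (meson less_add_same_cancel1 not_le)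

lemma quotient_norm_eq_0_iff: "quotient_norm a = 0 \<longleftrightarrow> a \<in> J"
proof
  assume "a \<in> J"
  then show "quotient_norm a = 0"
    using quotient_norm_le[OF J_minus, of a a] quotient_norm_nonneg[of a] by simp
next
  assume 0: "quotient_norm a = 0"
  have "\<exists>j\<in>J. dist j a < e" if e: "0 < e" for e
  proof -
    obtain j where "j \<in> J" "norm (a + j) < e" using quotient_norm_approx[OF e, of a] 0 by auto
    then show ?thesis by (intro bexI[of _ "- j"]) (auto simp: J_minus dist_norm norm_minus_commute)
  qed
  then show "a \<in> J" using J_closed unfolding closed_def open_dist by (metis ComplD ComplI)
qed

lemma quotient_norm_mult: "quotient_norm (a * b) \<le> quotient_norm a * quotient_norm b"
proof (rule field_le_epsilon)
  fix e :: real assume e: "0 < e"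
  define s where "s = quotient_norm a + quotient_norm b + 1"
  have s: "1 \<le> s" using quotient_norm_nonneg by (simp add: s_def)
  define d where "d = min 1 (e / s)"
  have d: "0 < d" "d \<le> 1" "d * s \<le> e" using e s by (auto simp: d_def min_def field_simps)
  obtain i where i: "i \<in> J" "norm (a + i) < quotient_norm a + d" using quotient_norm_approx[OF d(1)] .
  obtain j where j: "j \<in> J" "norm (b + j) < quotient_norm b + d" using quotient_norm_approx[OF d(1)] .
  have "a * j + i * b + i * j \<in> J" using i j by (simp add: J_add J_left J_right)
  then have "quotient_norm (a * b) \<le> norm (a * b + (a * j + i * b + i * j))" by (rule quotient_norm_le)
  also have "a * b + (a * j + i * b + i * j) = (a + i) * (b + j)" by (simp add: algebra_simps)
  also have "norm \<dots> \<le> norm (a + i) * norm (b + j)" by (rule norm_mult_ineq)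
  also have "\<dots> \<le> (quotient_norm a + d) * (quotient_norm b + d)"
    using i j d quotient_norm_nonneg[of a] by (intro mult_mono) auto
  also have "\<dots> = quotient_norm a * quotient_norm b + d * (quotient_norm a + quotient_norm b + d)"
    by (simp add: algebra_simps)
  also have "d * (quotient_norm a + quotient_norm b + d) \<le> d * s"
    using d by (intro mult_left_mono) (auto simp: s_def)
  finally show "quotient_norm (a * b) \<le> quotient_norm a * quotient_norm b + e" using d by linarith
qed

lemma quotient_norm_triangle: "quotient_norm (a + b) \<le> quotient_norm a + quotient_norm b"
proof (rule field_le_epsilon)
  fix e :: real assume e: "0 < e"
  obtain i where i: "i \<in> J" "norm (a + i) < quotient_norm a + e / 2" using quotient_norm_approx[of "e / 2"] e by auto
  obtain j where j: "j \<in> J" "norm (b + j) < quotient_norm b + e / 2" using quotient_norm_approx[of "e / 2"] e by auto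
  have "quotient_norm (a + b) \<le> norm (a + b + (i + j))" using i j by (intro quotient_norm_le J_add)
  also have "a + b + (i + j) = (a + i) + (b + j)" by simp
  also have "norm \<dots> \<le> norm (a + i) + norm (b + j)" by (rule norm_triangle_ineq)
  finally show "quotient_norm (a + b) \<le> quotient_norm a + quotient_norm b + e" using i j by linarith
qed

lemma quotient_norm_star_le: "quotient_norm (star a) \<le> quotient_norm a"
proof (rule quotient_norm_ge)
  fix j assume "j \<in> J"
  then have "quotient_norm (star a) \<le> norm (star a + star j)" by (intro quotient_norm_le J_star)
  then show "quotient_norm (star a) \<le> norm (a + j)" by (simp flip: star_add add: norm_star)
qed

lemma quotient_norm_scaleC: "quotient_norm (scaleC c a) = cmod c * quotient_norm a"
proof -
  have le: "quotient_norm (scaleC c a) \<le> cmod c * quotient_norm a" if "c \<noteq> 0" for c a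
  proof -
    have "quotient_norm (scaleC c a) / cmod c \<le> quotient_norm a"
    proof (rule quotient_norm_ge)
      fix j assume "j \<in> J"
      then have "quotient_norm (scaleC c a) \<le> norm (scaleC c a + scaleC c j)" by (intro quotient_norm_le J_scaleC)
      then show "quotient_norm (scaleC c a) / cmod c \<le> norm (a + j)"
        using that by (simp flip: scaleC_add_right add: norm_scaleC divide_simps mult.commute)
    qed
    then show ?thesis using that by (simp add: divide_simps mult.commute)
  qed
  show ?thesis
  proof (cases "c = 0")
    case True then show ?thesis using quotient_norm_eq_0_iff[of 0] J_zero by simp
  next
    case False
    have "quotient_norm (scaleC (inverse c) (scaleC c a)) \<le> cmod (inverse c) * quotient_norm (scaleC c a)"
      using False by (intro le) simp
    then have "cmod c * quotient_norm a \<le> quotient_norm (scaleC c a)"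
      using False by (simp add: scaleC_scaleC norm_inverse norm_divide field_simps)
    then show ?thesis using le[OF False, of a] by simp
  qed
qed

text \<open>Let \<open>j \<in> J\<close> be self-adjoint. Multiplying \<open>a\<close> by a contraction \<open>v\<close> with \<open>1 - v \<in> J\<close> and \<open>j * v\<close> small, as
  provided by \<open>approximate_kernel\<close>, does not change its class and gives
  \<open>(norm (a * v))\<^sup>2 \<le> norm (v * (star a * a + j) * v) + norm (v * j * v)\<close>.\<close>

lemma quotient_norm_cstar: "quotient_norm (star a * a) = (quotient_norm a)\<^sup>2"
proof (rule antisym)
  have "quotient_norm (star a * a) \<le> quotient_norm (star a) * quotient_norm a" by (rule quotient_norm_mult)
  also have "\<dots> \<le> quotient_norm a * quotient_norm a"
    by (intro mult_right_mono quotient_norm_star_le quotient_norm_nonneg)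
  finally show "quotient_norm (star a * a) \<le> (quotient_norm a)\<^sup>2" by (simp add: power2_eq_square)
  show "(quotient_norm a)\<^sup>2 \<le> quotient_norm (star a * a)"
  proof (cases "(1::'a) = 0")
    case True
    have "a = 0" "star a * a = 0" using zero_of_one_zero[OF True] by blast+
    then show ?thesis using quotient_norm_eq_0_iff[of 0] J_zero by simp
  next
    case False
    interpret cstar_seminorm "norm :: 'a \<Rightarrow> real" using False by (rule cstar_seminorm_norm)
    show ?thesis
    proof (rule quotient_norm_ge)
      fix j assume j: "j \<in> J"
      \<comment> \<open>replacing \<open>j\<close> by its real part does not increase the norm of \<open>star a * a + j\<close>\<close>
      define i where "i = (1/2) *\<^sub>R (j + star j)"
      have i: "i \<in> J" "star i = i"
        by (simp_all add: i_def J_scaleR J_add J_star j star_add star_star add.commute)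
      have "star a * a + i = (1/2) *\<^sub>R ((star a * a + j) + star (star a * a + j))"
      proof -
        have "(star a * a + j) + star (star a * a + j) = 2 *\<^sub>R (star a * a) + (j + star j)"
          by (simp add: star_add star_mult star_star scaleR_2)
        then show ?thesis unfolding i_def by (simp only: scaleR_add_right[of "1/2" "2 *\<^sub>R (star a * a)"]) simp
      qed
      then have "norm (star a * a + i) = 1/2 * norm ((star a * a + j) + star (star a * a + j))"
        by (metis abs_of_pos half_gt_zero_iff norm_scaleR zero_less_one)
      also have "\<dots> \<le> norm (star a * a + j)"
        using norm_triangle_ineq[of "star a * a + j" "star (star a * a + j)"] by simp
      finally have ij: "norm (star a * a + i) \<le> norm (star a * a + j)" .
      define c where "c = norm i + 1"
      have c: "0 < c" "norm i \<le> c" using norm_ge_zero[of i] by (simp_all add: c_def add_nonneg_pos)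
      define y where "y = inverse c *\<^sub>R i"
      have y: "norm y \<le> 1" "star y = y" "y \<in> J" "i = c *\<^sub>R y"
        using c i by (simp_all add: y_def J_scaleR field_simps)
      define v where "v n = (1 - y * y) ^ n" for n
      have v1: "norm (v n) \<le> 1" for n
      proof -
        have "norm (v n) \<le> norm (1 - y * y) ^ n" unfolding v_def by (rule p_power_le)
        also have "\<dots> \<le> 1" using p_one_minus_le[OF y(1)] y(2) by (intro power_le_one) simp_all
        finally show ?thesis .
      qed
      have sv: "star (v n) = v n" for n by (simp add: v_def star_power star_diff star_mult y)
      have av: "(quotient_norm a)\<^sup>2 \<le> norm (star a * a + j) + c * norm (y * v n)" for n
      proof -
        have "- (a * (1 - v n)) \<in> J"
          unfolding v_def by (intro J_minus J_left J_one_minus_power y)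
        then have "quotient_norm a \<le> norm (a + - (a * (1 - v n)))" by (rule quotient_norm_le)
        also have "a + - (a * (1 - v n)) = a * v n" by (simp add: right_diff_distrib)
        finally have "(quotient_norm a)\<^sup>2 \<le> (norm (a * v n))\<^sup>2"
          using quotient_norm_nonneg by (intro power_mono)
        also have "\<dots> = norm (star (a * v n) * (a * v n))" by (simp add: cstar_identity)
        also have "star (a * v n) * (a * v n) = v n * (star a * a + i) * v n - c *\<^sub>R (v n * (y * v n))"
          by (simp add: star_mult sv y(4) algebra_simps)
        also have "norm \<dots> \<le> norm (v n * (star a * a + i) * v n) + norm (c *\<^sub>R (v n * (y * v n)))"
          by (rule norm_triangle_ineq4)
        also have "norm (v n * (star a * a + i) * v n) \<le> norm (v n) * norm (star a * a + i) * norm (v n)"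
          by (meson mult_right_mono norm_ge_zero norm_mult_ineq order_trans)
        also have "\<dots> \<le> 1 * norm (star a * a + i) * 1"
          using v1 by (intro mult_mono) auto
        also have "norm (c *\<^sub>R (v n * (y * v n))) \<le> c * (norm (v n) * norm (y * v n))"
          using c norm_mult_ineq by (simp add: mult_left_mono)
        also have "\<dots> \<le> c * (1 * norm (y * v n))"
          using c v1 by (intro mult_left_mono mult_right_mono) auto
        finally show ?thesis using ij by simp
      qed
      have "(\<lambda>n. y * v n) \<longlonglongrightarrow> 0" using approximate_kernel[OF y(1)] by (simp add: v_def y(2))
      then have "(\<lambda>n. norm (star a * a + j) + c * norm (y * v n)) \<longlonglongrightarrow> norm (star a * a + j) + c * 0"
        by (intro tendsto_intros tendsto_norm_zero)
      then have "(\<lambda>n. norm (star a * a + j) + c * norm (y * v n)) \<longlonglongrightarrow> norm (star a * a + j)" by simp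
      then show "(quotient_norm a)\<^sup>2 \<le> norm (star a * a + j)"
        by (rule LIMSEQ_le_const) (use av in blast)
    qed
  qed
qed

end

text \<open>A \<open>C\<^sup>*\<close>-seminorm takes only the values \<open>0\<close> and \<open>1\<close> at the unit, and it vanishes if the value is \<open>0\<close>.\<close>

lemma cstar_seminormI:
  fixes q :: "'a::unital_cstar_algebra \<Rightarrow> real"
  assumes "\<And>x y. q (x + y) \<le> q x + q y" "\<And>c x. q (scaleC c x) = cmod c * q x"
    "\<And>x y. q (x * y) \<le> q x * q y" "\<And>x. q (star x * x) = (q x)\<^sup>2"
    and a: "q a \<noteq> 0" and nonneg: "\<And>x. 0 \<le> q x"
  shows "cstar_seminorm q"
proof
  have "q 1 \<noteq> 0"
  proof
    assume "q 1 = 0"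
    then have "q a \<le> 0" using assms(3)[of a 1] by simp
    then show False using a nonneg[of a] by simp
  qed
  moreover have "q 1 * q 1 = q 1" using assms(4)[of 1] by (simp add: power2_eq_square)
  ultimately show "q 1 = 1" by simp
qed (use assms in auto)

lemma (in cstar_ideal) cstar_seminorm_quotient:
  "a \<notin> J \<Longrightarrow> cstar_seminorm quotient_norm"
  by (rule cstar_seminormI[of quotient_norm a])
    (simp_all add: quotient_norm_triangle quotient_norm_scaleC quotient_norm_mult quotient_norm_cstar
      quotient_norm_nonneg quotient_norm_eq_0_iff)

context star_endo
begin

abbreviation dn :: "nat \<Rightarrow> 'a \<Rightarrow> 'a" where "dn n \<equiv> \<delta> ^^ n"

lemma dn_add: "dn n (a + b) = dn n a + dn n b" by (induction n) (simp_all add: d_add)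
lemma dn_scaleC: "dn n (scaleC c a) = scaleC c (dn n a)" by (induction n) (simp_all add: d_scaleC)
lemma dn_mult: "dn n (a * b) = dn n a * dn n b" by (induction n) (simp_all add: d_mult)
lemma dn_star: "dn n (star a) = star (dn n a)" by (induction n) (simp_all add: d_star)

text \<open>The norm of the image of \<open>a\<close> in the inductive limit of the iterates of \<open>\<delta>\<close>.\<close>

definition limit_norm :: "'a \<Rightarrow> real" where
  "limit_norm a = lim (\<lambda>n. norm (dn n a))"

lemma limit_norm_tendsto: "(\<lambda>n. norm (dn n a)) \<longlonglongrightarrow> limit_norm a"
proof -
  have "decseq (\<lambda>n. norm (dn n a))" by (rule decseq_SucI) (simp add: norm_le)
  then obtain L where "(\<lambda>n. norm (dn n a)) \<longlonglongrightarrow> L"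
    using decseq_convergent[of "\<lambda>n. norm (dn n a)" 0] by auto
  then show ?thesis unfolding limit_norm_def by (simp add: limI)
qed

lemma limit_norm_delta: "limit_norm (\<delta> a) = limit_norm a"
  using LIMSEQ_Suc[OF limit_norm_tendsto[of a]] limit_norm_tendsto[of "\<delta> a"]
  by (simp add: funpow_swap1 LIMSEQ_unique)

lemma cstar_seminorm_limit: "limit_norm a \<noteq> 0 \<Longrightarrow> cstar_seminorm limit_norm"
proof (rule cstar_seminormI[of limit_norm a])
  show "limit_norm (x + y) \<le> limit_norm x + limit_norm y" for x y
    by (rule LIMSEQ_le[OF limit_norm_tendsto tendsto_add[OF limit_norm_tendsto limit_norm_tendsto]])
      (auto simp: dn_add norm_triangle_ineq)
  show "limit_norm (x * y) \<le> limit_norm x * limit_norm y" for x y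
    by (rule LIMSEQ_le[OF limit_norm_tendsto tendsto_mult[OF limit_norm_tendsto limit_norm_tendsto]])
      (auto simp: dn_mult norm_mult_ineq)
  show "limit_norm (scaleC c x) = cmod c * limit_norm x" for c x
    by (rule LIMSEQ_unique[OF limit_norm_tendsto])
      (simp add: dn_scaleC norm_scaleC tendsto_mult_left limit_norm_tendsto)
  show "limit_norm (star x * x) = (limit_norm x)\<^sup>2" for x
    by (rule LIMSEQ_unique[OF limit_norm_tendsto])
      (simp add: dn_mult dn_star cstar_identity tendsto_power limit_norm_tendsto)
  show "0 \<le> limit_norm x" for x
    by (rule LIMSEQ_le_const[OF limit_norm_tendsto]) auto
qed

end

locale cstar_system = star_endo \<delta> + cstar_ideal J
  for \<delta> :: "'a::unital_cstar_algebra \<Rightarrow> 'a" and J :: "'a set" +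
  assumes faithful: "J \<inter> {a. \<delta> a = 0} = {0}"
begin

text \<open>If \<open>\<delta>\<close> shrinks an element of \<open>J\<close>, there is a positive \<open>k \<in> J\<close> of norm \<open>1\<close> with \<open>norm (\<delta> k) < 1\<close>. Choose \<open>s\<close>
  strictly between \<open>norm (\<delta> k)\<close> and \<open>1\<close>. Twice the positive part of \<open>y = k - s\<close> is \<open>X = y + (1 - e)\<close>, where
  \<open>1 - e\<close> is the absolute value of \<open>y\<close>. It is not \<open>0\<close> since \<open>s < norm k\<close>, and \<open>\<delta>\<close> kills it since the image of
  \<open>y\<close> is negative. Then \<open>k * X\<close> is a nonzero element of \<open>J\<close> in the kernel of \<open>\<delta>\<close>.\<close>

lemma isometric_on_J:
  assumes a: "a \<in> J"
  shows "norm (\<delta> a) = norm a"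
proof (rule ccontr)
  assume ne: "norm (\<delta> a) \<noteq> norm a"
  then have a0: "a \<noteq> 0" by (auto simp: d_zero)
  then have "(1::'a) \<noteq> 0" using zero_of_one_zero by blast
  then interpret cstar_seminorm "norm :: 'a \<Rightarrow> real" by (rule cstar_seminorm_norm)
  define c where "c = inverse (norm a) *\<^sub>R a"
  have c: "c \<in> J" "norm c = 1" using a a0 by (simp_all add: c_def J_scaleR)
  have dc: "norm (\<delta> c) < 1" using ne norm_le[of a] a0 by (simp add: c_def d_scaleR divide_simps)
  define x where "x = star c * c"
  have sx: "star x = x" by (simp add: x_def star_mult star_star)
  have x: "x \<in> J" "norm x = 1" using c by (simp_all add: x_def J_left cstar_identity)
  define k where "k = x * x"
  have sk: "star k = k" by (simp add: k_def star_mult sx)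
  have k: "k \<in> J" "norm k = 1" using x sx cstar_identity[of x] by (simp_all add: k_def J_left)
  define r where "r = norm (\<delta> k)"
  have "r = ((norm (\<delta> c))\<^sup>2)\<^sup>2"
  proof -
    have "r = norm (star (\<delta> x) * \<delta> x)" by (simp add: r_def k_def d_mult sx flip: d_star)
    also have "\<dots> = (norm (\<delta> x))\<^sup>2" by (rule cstar_identity)
    also have "norm (\<delta> x) = (norm (\<delta> c))\<^sup>2" by (simp add: x_def d_mult d_star cstar_identity)
    finally show ?thesis .
  qed
  then have r: "0 \<le> r" "r < 1" using dc by (auto simp: power_less_one_iff abs_square_less_1)
  \<comment> \<open>cut at a level above \<open>norm (\<delta> k)\<close> and below the norm of \<open>k\<close>\<close>
  define s where "s = (r + 1) / 2"
  have s: "r < s" "s < 1" "0 < s" using r by (auto simp: s_def)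
  define y where "y = k - s *\<^sub>R 1"
  have sy: "star y = y" by (simp add: y_def star_diff sk)
  have "y = (1 - s) *\<^sub>R k - s *\<^sub>R (1 - k)" by (simp add: y_def algebra_simps)
  then have "norm y \<le> norm ((1 - s) *\<^sub>R k) + norm (s *\<^sub>R (1 - k))" by (metis norm_triangle_ineq4)
  also have "\<dots> \<le> (1 - s) * 1 + s * 1"
    using p_one_minus_le[of x] x sx s k by (auto simp: k_def[symmetric])
  finally have y1: "norm y \<le> 1" by simp
  define h where "h = 1 - y * y"
  have sh: "star h = h" by (simp add: h_def star_diff star_mult sy)
  have h1: "norm h \<le> 1" using p_one_minus_le[OF y1] by (simp add: h_def sy)
  obtain e where e: "norm e \<le> 1" "e + e = h + e * e" "\<And>z. z * h = h * z \<Longrightarrow> z * e = e * z"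
    using square_root_exists[OF sh h1] by metis
  have ye: "y * e = e * y" by (rule e(3)) (simp add: h_def algebra_simps)
  define X where "X = y + (1 - e)"
  have dX: "\<delta> X = 0"
  proof -
    \<comment> \<open>\<open>\<delta> 1 - f\<close> is the obvious square root of \<open>\<delta> y * \<delta> y\<close>, as \<open>- \<delta> y\<close> is positive\<close>
    define f where "f = \<delta> 1 + \<delta> y"
    have 1: "f + f = \<delta> h + f * f" by (simp add: f_def h_def d_diff d_mult algebra_simps d_unit flip: d_mult)
    have 2: "\<delta> e + \<delta> e = \<delta> h + \<delta> e * \<delta> e" by (simp flip: d_add d_mult add: e(2))
    have 3: "norm (\<delta> e) \<le> 1" using norm_le[of e] e(1) by simp
    have 4: "norm f < 1"
    proof -
      have "f = \<delta> k + (1 - s) *\<^sub>R \<delta> 1" by (simp add: f_def y_def d_diff d_scaleR algebra_simps)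
      then have "norm f \<le> norm (\<delta> k) + norm ((1 - s) *\<^sub>R \<delta> 1)" by (metis norm_triangle_ineq)
      also have "\<dots> \<le> r + (1 - s) * 1"
        using s norm_d_one by (auto simp: r_def)
      finally show ?thesis using s by simp
    qed
    have "\<delta> e = f" by (rule square_root_unique[OF 2 1 3 4])
    then show ?thesis by (simp add: X_def d_add d_diff f_def)
  qed
  have "k * X \<in> J" by (intro J_right k)
  moreover have "\<delta> (k * X) = 0" by (simp add: d_mult dX)
  ultimately have kX: "k * X = 0" using faithful by blast
  have AA: "(1 - e) * (1 - e) = y * y"
  proof -
    have "h = e + e - e * e" using e(2) by (simp add: algebra_simps)
    then have "y * y = 1 - (e + e - e * e)" by (simp add: h_def algebra_simps)
    then show ?thesis by (simp add: algebra_simps)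
  qed
  have "y * X = (1 - e) * X"
    unfolding X_def distrib_left AA by (simp add: algebra_simps ye)
  then have "k * X = (1 - e) * X + s *\<^sub>R X" by (simp add: y_def algebra_simps)
  then have "(1 + s) *\<^sub>R X = e * X" using kX by (simp add: algebra_simps)
  then have "(1 + s) * norm X = norm (e * X)" using s by (metis abs_of_pos add_pos_pos norm_scaleR zero_less_one)
  also have "\<dots> \<le> 1 * norm X" by (rule order_trans[OF norm_mult_ineq mult_right_mono[OF e(1)]]) simp
  finally have "s * norm X \<le> 0" by (simp add: algebra_simps)
  then have "X = 0" using s by (simp add: mult_le_0_iff)
  then have "e = (1 - s) *\<^sub>R 1 + k" by (simp add: X_def y_def algebra_simps)
  then have "(1 - s) + upper k \<le> norm e" using upper_shift upper_le_p by metis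
  moreover have "upper k = 1" using upper_square[OF sx] k by (simp add: k_def)
  ultimately show False using e(1) s by linarith
qed

lemma limit_norm_on_J:
  assumes "\<And>n. dn n a \<in> J"
  shows "limit_norm a = norm a"
proof -
  have "norm (dn n a) = norm a" for n
    by (induction n) (simp_all add: isometric_on_J assms)
  then show ?thesis using limit_norm_tendsto[of a] by (simp add: LIMSEQ_const_iff)
qed

end

section \<open>Positive functionals\<close>

definition sublinear :: "('v::real_vector \<Rightarrow> real) \<Rightarrow> bool" where
  "sublinear q \<longleftrightarrow> (\<forall>x y. q (x + y) \<le> q x + q y) \<and> (\<forall>r\<ge>0. \<forall>x. q (r *\<^sub>R x) = r * q x)"

lemma sublinear_add: "sublinear q \<Longrightarrow> q (x + y) \<le> q x + q y"
  and sublinear_scale: "sublinear q \<Longrightarrow> 0 \<le> r \<Longrightarrow> q (r *\<^sub>R x) = r * q x"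
  by (auto simp: sublinear_def)

lemma sublinear_zero: "sublinear q \<Longrightarrow> q 0 = 0"
  using sublinear_scale[of q 0 0] by simp

lemma sublinear_minus: "sublinear q \<Longrightarrow> - q (- x) \<le> q x"
  using sublinear_add[of q x "- x"] sublinear_zero[of q] by simp

lemma sublinearI:
  assumes add: "\<And>x y. q (x + y) \<le> q x + q y"
    and scale: "\<And>r x. 0 < r \<Longrightarrow> q (r *\<^sub>R x) \<le> r * q x" and zero: "q 0 = 0"
  shows "sublinear q"
  unfolding sublinear_def
proof (intro conjI allI impI add)
  fix r :: real and x assume r: "0 \<le> r"
  show "q (r *\<^sub>R x) = r * q x"
  proof (cases "r = 0")
    case False
    then have "0 < r" using r by simp
    moreover have "q x \<le> inverse r * q (r *\<^sub>R x)"
      using scale[of "inverse r" "r *\<^sub>R x"] \<open>0 < r\<close> by simp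
    ultimately show ?thesis using scale[of r x] by (simp add: field_simps)
  qed (simp add: zero)
qed

text \<open>A chain of sublinear functions below \<open>p\<close> has a pointwise infimum, as \<open>- p (- x)\<close> is a common lower bound.\<close>

lemma sublinear_minimal_exists:
  assumes p: "sublinear p"
  obtains m where "sublinear m" "m \<le> p" "\<And>q. sublinear q \<Longrightarrow> q \<le> m \<Longrightarrow> q = m"
proof -
  define A where "A = {q. sublinear q \<and> q \<le> p}"
  let ?P = "\<lambda>a b :: 'a \<Rightarrow> real. b \<le> a"
  have "\<exists>m\<in>A. \<forall>a\<in>A. ?P m a \<longrightarrow> a = m"
  proof (rule predicate_Zorn)
    show "partial_order_on A (relation_of ?P A)"
      by (rule partial_order_on_relation_ofI) auto
    fix C assume "C \<in> Chains (relation_of ?P A)"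
    then have C: "C \<subseteq> A" and chain: "\<And>a b. a \<in> C \<Longrightarrow> b \<in> C \<Longrightarrow> a \<le> b \<or> b \<le> a"
      by (auto simp: Chains_def relation_of_def)
    show "\<exists>u\<in>A. \<forall>a\<in>C. u \<le> a"
    proof (cases "C = {}")
      case True
      then show ?thesis using p by (auto simp: A_def)
    next
      case ne: False
      have sub: "sublinear a" "a \<le> p" if "a \<in> C" for a using that C by (auto simp: A_def)
      have bdd: "bdd_below ((\<lambda>a. a x) ` C)" for x
      proof (rule bdd_belowI2)
        fix a assume a: "a \<in> C"
        have "- p (- x) \<le> - a (- x)" using sub(2)[OF a] by (simp add: le_fun_def)
        also have "\<dots> \<le> a x" by (rule sublinear_minus[OF sub(1)[OF a]])
        finally show "- p (- x) \<le> a x" .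
      qed
      define u where "u x = (INF a\<in>C. a x)" for x
      have le: "u x \<le> a x" if "a \<in> C" for a x
        unfolding u_def using bdd that by (rule cINF_lower)
      have ge: "c \<le> u x" if "\<And>a. a \<in> C \<Longrightarrow> c \<le> a x" for c x
        unfolding u_def using ne that by (rule cINF_greatest)
      have "sublinear u"
      proof (rule sublinearI)
        fix x y
        have *: "u (x + y) \<le> a x + b y" if ab: "a \<in> C" "b \<in> C" for a b
          using chain[OF ab]
        proof
          assume "a \<le> b"
          then show ?thesis using le[OF ab(1), of "x + y"] sublinear_add[OF sub(1)[OF ab(1)], of x y]
            by (smt (verit) le_fun_def)
        next
          assume "b \<le> a"
          then show ?thesis using le[OF ab(2), of "x + y"] sublinear_add[OF sub(1)[OF ab(2)], of x y]
            by (smt (verit) le_fun_def)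
        qed
        have "u (x + y) - u x \<le> u y"
        proof (rule ge)
          fix b assume b: "b \<in> C"
          have "u (x + y) - b y \<le> u x" by (rule ge) (use *[OF _ b] in \<open>simp add: algebra_simps\<close>)
          then show "u (x + y) - u x \<le> b y" by simp
        qed
        then show "u (x + y) \<le> u x + u y" by simp
      next
        fix r :: real and x assume r: "0 < r"
        have "u (r *\<^sub>R x) / r \<le> u x"
          by (rule ge) (use r le[of _ "r *\<^sub>R x"] in \<open>simp add: sublinear_scale[OF sub(1)] divide_simps mult.commute\<close>)
        then show "u (r *\<^sub>R x) \<le> r * u x" using r by (simp add: divide_simps mult.commute)
      next
        have zero: "a 0 = 0" if "a \<in> C" for a using that sub(1) sublinear_zero by blast
        obtain a where "a \<in> C" using ne by blast
        then have "u 0 \<le> 0" using le[of a 0] zero[of a] by linarith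
        moreover have "0 \<le> u 0" by (rule ge) (simp add: zero)
        ultimately show "u 0 = 0" by simp
      qed
      moreover have "u \<le> p" using ne le sub(2) by (meson all_not_in_conv le_fun_def order_trans)
      ultimately show ?thesis using le by (intro bexI[of _ u]) (auto simp: A_def le_fun_def)
    qed
  qed
  then obtain m where m: "m \<in> A" and min: "\<And>a. a \<in> A \<Longrightarrow> a \<le> m \<Longrightarrow> a = m" by blast
  show ?thesis
  proof
    show "q = m" if "sublinear q" "q \<le> m" for q
      using that m by (intro min) (auto simp: A_def intro: order_trans)
  qed (use m in \<open>auto simp: A_def\<close>)
qed

text \<open>Pairs \<open>(w, c)\<close> record lower bounds \<open>c \<le> f w\<close> that are prescribed for a linear \<open>f \<le> q\<close>. The sublinear function
  \<open>qW\<close> is the largest one below \<open>q\<close> that allows for them. A ray prescribes the value at one vector, the graph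
  of a linear function prescribes an extension.\<close>

locale sublinear_cone =
  fixes q :: "'v::real_vector \<Rightarrow> real" and W :: "('v \<times> real) set"
  assumes q: "sublinear q"
    and W_zero: "(0, 0) \<in> W"
    and W_add: "(v, c) \<in> W \<Longrightarrow> (w, d) \<in> W \<Longrightarrow> (v + w, c + d) \<in> W"
    and W_scale: "0 < r \<Longrightarrow> (w, c) \<in> W \<Longrightarrow> (r *\<^sub>R w, r * c) \<in> W"
    and W_le: "(w, c) \<in> W \<Longrightarrow> c \<le> q w"
begin

definition qW :: "'v \<Rightarrow> real" where
  "qW x = (INF (w, c)\<in>W. q (x + w) - c)"

lemma qW_le: assumes "(w, c) \<in> W" shows "qW x \<le> q (x + w) - c"
proof -
  have "bdd_below ((\<lambda>(w, c). q (x + w) - c) ` W)"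
  proof (rule bdd_belowI2[of _ "- q (- x)"], clarify)
    fix w c assume wc: "(w, c) \<in> W"
    have "c \<le> q w" by (rule W_le[OF wc])
    also have "q w \<le> q (x + w) + q (- x)" using sublinear_add[OF q, of "x + w" "- x"] by simp
    finally show "- q (- x) \<le> q (x + w) - c" by simp
  qed
  then show ?thesis unfolding qW_def using assms by (auto dest: cINF_lower)
qed

lemma qW_ge: assumes "\<And>w c. (w, c) \<in> W \<Longrightarrow> b \<le> q (x + w) - c" shows "b \<le> qW x"
  unfolding qW_def by (rule cINF_greatest) (use assms W_zero in auto)

lemma sublinear_qW: "sublinear qW"
proof (rule sublinearI)
  fix x y
  have "qW (x + y) - qW x \<le> qW y"
  proof (rule qW_ge)
    fix w c assume wc: "(w, c) \<in> W"
    have "qW (x + y) - (q (y + w) - c) \<le> qW x"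
    proof (rule qW_ge)
      fix v d assume "(v, d) \<in> W"
      then have "qW (x + y) \<le> q (x + y + (v + w)) - (d + c)" using wc by (intro qW_le W_add)
      also have "x + y + (v + w) = (x + v) + (y + w)" by simp
      also have "q \<dots> \<le> q (x + v) + q (y + w)" by (rule sublinear_add[OF q])
      finally show "qW (x + y) - (q (y + w) - c) \<le> q (x + v) - d" by simp
    qed
    then show "qW (x + y) - qW x \<le> q (y + w) - c" by simp
  qed
  then show "qW (x + y) \<le> qW x + qW y" by simp
next
  fix r :: real and x assume r: "0 < r"
  have "qW (r *\<^sub>R x) / r \<le> qW x"
  proof (rule qW_ge)
    fix w c assume "(w, c) \<in> W"
    then have "qW (r *\<^sub>R x) \<le> q (r *\<^sub>R x + r *\<^sub>R w) - r * c" using r by (intro qW_le W_scale)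
    also have "\<dots> = r * (q (x + w) - c)"
      using r by (simp flip: scaleR_add_right add: sublinear_scale[OF q] right_diff_distrib)
    finally show "qW (r *\<^sub>R x) / r \<le> q (x + w) - c" using r by (simp add: pos_divide_le_eq mult.commute)
  qed
  then show "qW (r *\<^sub>R x) \<le> r * qW x" using r by (simp add: pos_divide_le_eq mult.commute)
next
  have "0 \<le> qW 0" by (rule qW_ge) (simp add: W_le)
  then show "qW 0 = 0" using qW_le[OF W_zero, of 0] sublinear_zero[OF q] by simp
qed

lemma qW_le_q: "qW \<le> q"
  using qW_le[OF W_zero] by (simp add: le_fun_def)

end

lemma sublinear_cone_ray:
  assumes m: "sublinear m"
  shows "sublinear_cone m ((\<lambda>s. (s *\<^sub>R y, s * m y)) ` {0..})" (is "sublinear_cone m ?W")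
proof
  fix v w c d assume "(v, c) \<in> ?W" "(w, d) \<in> ?W"
  then obtain s t where "0 \<le> s" "0 \<le> t" "v = s *\<^sub>R y" "c = s * m y" "w = t *\<^sub>R y" "d = t * m y" by auto
  then show "(v + w, c + d) \<in> ?W"
    by (intro image_eqI[of _ _ "s + t"]) (auto simp: scaleR_add_left distrib_right)
next
  fix r :: real and w c assume "0 < r" "(w, c) \<in> ?W"
  then obtain s where "0 \<le> s" "w = s *\<^sub>R y" "c = s * m y" by auto
  then show "(r *\<^sub>R w, r * c) \<in> ?W" using \<open>0 < r\<close> by (intro image_eqI[of _ _ "r * s"]) auto
qed (auto simp: image_iff sublinear_scale[OF m] intro: m)

text \<open>Prescribing the lower bound \<open>m y\<close> at \<open>y\<close> lowers \<open>m\<close> unless \<open>m\<close> is superadditive.\<close>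

lemma sublinear_minimal_linear:
  assumes m: "sublinear m" and min: "\<And>q. sublinear q \<Longrightarrow> q \<le> m \<Longrightarrow> q = m"
  shows "linear m"
proof -
  have super: "m x + m y \<le> m (x + y)" for x y
  proof -
    define W where "W = (\<lambda>s. (s *\<^sub>R y, s * m y)) ` {0..}"
    interpret sublinear_cone m W unfolding W_def by (rule sublinear_cone_ray[OF m])
    have "qW = m" by (rule min[OF sublinear_qW qW_le_q])
    moreover have "qW x \<le> m (x + y) - m y" by (rule qW_le) (force simp: W_def image_iff)
    ultimately show ?thesis by simp
  qed
  have add: "m (x + y) = m x + m y" for x y
    using super sublinear_add[OF m] by (metis antisym)
  have neg: "m (- x) = - m x" for x using add[of x "- x"] sublinear_zero[OF m] by simp
  show ?thesis
  proof (rule linearI)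
    show "m (r *\<^sub>R x) = r *\<^sub>R m x" for r x
    proof (cases "0 \<le> r")
      case True then show ?thesis by (simp add: sublinear_scale[OF m])
    next
      case False
      then have "m ((- r) *\<^sub>R x) = - r * m x" by (intro sublinear_scale[OF m]) simp
      then show ?thesis using neg[of "r *\<^sub>R x"] by simp
    qed
  qed (rule add)
qed

lemma (in sublinear_cone) hahn_banach:
  obtains f where "linear f" "\<And>x. f x \<le> q x" "\<And>w c. (w, c) \<in> W \<Longrightarrow> c \<le> f w"
proof -
  obtain f where f: "sublinear f" "f \<le> qW" "\<And>g. sublinear g \<Longrightarrow> g \<le> f \<Longrightarrow> g = f"
    using sublinear_minimal_exists[OF sublinear_qW] by blast
  have lin: "linear f" by (rule sublinear_minimal_linear[OF f(1,3)])
  show ?thesis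
  proof
    show "f x \<le> q x" for x using f(2) qW_le_q by (meson le_fun_def order_trans)
    fix w c assume "(w, c) \<in> W"
    then have "qW (- w) \<le> - c" using qW_le[of w c "- w"] sublinear_zero[OF q] by simp
    then have "f (- w) \<le> - c" using f(2) by (meson le_fun_def order_trans)
    then show "c \<le> f w" using linear_neg[OF lin, of w] by simp
  qed (rule lin)
qed

definition positive_functional :: "('a::unital_cstar_algebra \<Rightarrow> complex) \<Rightarrow> bool" where
  "positive_functional F \<longleftrightarrow> (\<forall>x y. F (x + y) = F x + F y) \<and> (\<forall>c x. F (scaleC c x) = c * F x) \<and>
     (\<forall>x. F (star x) = cnj (F x)) \<and> (\<forall>x. 0 \<le> Re (F (star x * x)))"

definition hermitian_part :: "'a::unital_cstar_algebra \<Rightarrow> 'a" where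
  "hermitian_part x = (1/2) *\<^sub>R (x + star x)"

definition complexify :: "('a::unital_cstar_algebra \<Rightarrow> real) \<Rightarrow> 'a \<Rightarrow> complex" where
  "complexify f x = Complex (f (hermitian_part x)) (- f (hermitian_part (scaleC \<i> x)))"

lemma hermitian_part_self: "star x = x \<Longrightarrow> hermitian_part x = x"
  by (simp add: hermitian_part_def flip: scaleR_2)

context cstar_seminorm
begin

lemma sublinear_upper: "sublinear upper"
  by (simp add: sublinear_def upper_add upper_scaleR)

lemma complexify_self: "linear f \<Longrightarrow> star x = x \<Longrightarrow> complexify f x = of_real (f x)"
  by (simp add: complexify_def hermitian_part_self complex_eq_iff)
    (simp add: hermitian_part_def star_scaleC scaleC_minus_left linear_0)

lemma positive_functional_complexify:
  assumes f: "linear f" and f_le: "\<And>x. f x \<le> upper x"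
  shows "positive_functional (complexify f)"
proof -
  note [simp] = linear_add[OF f] linear_scale[OF f] linear_neg[OF f] linear_0[OF f]
  define g where "g x = f (hermitian_part x)" for x
  have g_add: "g (x + y) = g x + g y" for x y
    by (simp add: g_def hermitian_part_def star_add algebra_simps)
  have g_scale: "g (r *\<^sub>R x) = r * g x" for r x
    by (simp add: g_def hermitian_part_def algebra_simps)
  have g_minus: "g (- x) = - g x" for x using g_scale[of "-1" x] by simp
  have g_star: "g (star x) = g x" for x by (simp add: g_def hermitian_part_def star_star add.commute)
  have c: "complexify f x = Complex (g x) (- g (scaleC \<i> x))" for x by (simp add: complexify_def g_def)
  have "complexify f (scaleC c x) = c * complexify f x" for c x
  proof -
    have "scaleC c x = Re c *\<^sub>R x + Im c *\<^sub>R scaleC \<i> x"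
      by (subst complex_eq) (simp add: scaleC_add_left scaleC_of_real scaleC_scaleC[symmetric]
          scaleC_scaleR mult.commute)
    moreover have "scaleC \<i> (scaleC c x) = Re c *\<^sub>R scaleC \<i> x + Im c *\<^sub>R (- x)"
      unfolding \<open>scaleC c x = _\<close> by (simp add: scaleC_add_right scaleC_scaleR scaleC_ii_ii)
    ultimately show ?thesis
      using g_scale[of "Im c" "- x"] by (simp add: c g_add g_scale g_minus complex_eq_iff del: scaleR_minus_right)
  qed
  moreover have "complexify f (star x) = cnj (complexify f x)" for x
  proof -
    have "scaleC \<i> (star x) = - star (scaleC \<i> x)" by (simp add: star_scaleC scaleC_minus_left)
    then show ?thesis by (simp add: c g_star g_minus complex_eq_iff)
  qed
  moreover have "0 \<le> Re (complexify f (star x * x))" for x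
    using f_le[of "- (star x * x)"] upper_minus_star_mult[of x]
    by (simp add: complexify_self[OF f] star_mult star_star)
  moreover have "complexify f (x + y) = complexify f x + complexify f y" for x y
    by (simp add: c g_add scaleC_add_right complex_eq_iff)
  ultimately show ?thesis unfolding positive_functional_def by blast
qed

lemma complexify_null:
  assumes f: "linear f" and f_le: "\<And>x. f x \<le> upper x" and "p x = 0"
  shows "complexify f x = 0"
proof -
  have null: "f (hermitian_part y) = 0" if "p y = 0" for y
  proof -
    have "p (hermitian_part y) \<le> 0"
      using p_triangle[of y "star y"] that by (simp add: hermitian_part_def p_scaleR)
    then show ?thesis
      using f_le[of "hermitian_part y"] f_le[of "- hermitian_part y"] upper_le_p[of "hermitian_part y"]
        upper_le_p[of "- hermitian_part y"] by (simp add: linear_neg[OF f])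
  qed
  show ?thesis using assms(3) by (simp add: complexify_def null p_scaleC complex_eq_iff)
qed

text \<open>The Hahn-Banach theorem with the value \<open>upper (star a * a)\<close> prescribed at \<open>star a * a\<close>.\<close>

lemma separating_functional:
  assumes "0 < p a"
  obtains f where "linear f" "\<And>x. f x \<le> upper x" "0 < f (star a * a)"
proof -
  define k where "k = star a * a"
  define W where "W = (\<lambda>s. (s *\<^sub>R k, s * upper k)) ` {0..}"
  interpret sublinear_cone upper W unfolding W_def by (rule sublinear_cone_ray[OF sublinear_upper])
  obtain f where f: "linear f" "\<And>x. f x \<le> upper x" "\<And>w c. (w, c) \<in> W \<Longrightarrow> c \<le> f w"
    using hahn_banach by blast
  have "upper k \<le> f k" by (rule f(3)) (force simp: W_def image_iff)
  then have "0 < f (star a * a)" using upper_star_mult_pos[OF assms] by (simp add: k_def)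
  with f show ?thesis using that by blast
qed

end

text \<open>A functional that is dominated by the quotient seminorm vanishes on \<open>J\<close>.\<close>

lemma (in cstar_ideal) functional_vanishing_on_ideal:
  assumes "a \<notin> J"
  shows "\<exists>F. positive_functional F \<and> (\<forall>j\<in>J. F j = 0) \<and> F (star a * a) \<noteq> 0"
proof -
  interpret cstar_seminorm quotient_norm using assms by (rule cstar_seminorm_quotient)
  have "0 < quotient_norm a" using assms quotient_norm_eq_0_iff[of a] quotient_norm_nonneg[of a] by linarith
  then obtain f where f: "linear f" "\<And>x. f x \<le> upper x" "0 < f (star a * a)" using separating_functional by blast
  show ?thesis
    using positive_functional_complexify[OF f(1,2)] complexify_null[OF f(1,2)] f(3)
    by (intro exI[of _ "complexify f"])
      (auto simp: quotient_norm_eq_0_iff complexify_self[OF f(1)] star_mult star_star)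
qed

text \<open>A functional \<open>f \<le> upper\<close> for the limit seminorm lifts along \<open>\<delta>\<close>: since \<open>upper x \<le> upper (\<delta> x)\<close>, the
  function \<open>\<delta> x \<mapsto> f x\<close> on the range of \<open>\<delta>\<close> is dominated by \<open>upper\<close>, and it extends by Hahn-Banach. The inequality
  holds because compression by \<open>\<delta> 1\<close> turns \<open>t + \<delta> x\<close> into \<open>\<delta> (t + x)\<close>.\<close>

lemma (in star_endo) tower_exists:
  assumes "limit_norm a \<noteq> 0"
  shows "\<exists>T. (\<forall>k. positive_functional (T k)) \<and> (\<forall>k x. T (Suc k) (\<delta> x) = T k x) \<and> T 0 (star a * a) \<noteq> 0"
proof -
  interpret cstar_seminorm limit_norm using assms by (rule cstar_seminorm_limit)
  have upper_delta: "upper x \<le> upper (\<delta> x)" for x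
  proof (rule upper_ge)
    fix t :: real assume t: "0 \<le> t"
    have "upper x \<le> limit_norm (t *\<^sub>R 1 + x) - t" using t by (rule upper_le)
    also have "limit_norm (t *\<^sub>R 1 + x) = limit_norm (\<delta> 1 * (t *\<^sub>R 1 + \<delta> x))"
      using limit_norm_delta[of "t *\<^sub>R 1 + x"] by (simp add: d_add d_scaleR distrib_left d_unit)
    also have "\<dots> \<le> limit_norm (\<delta> 1) * limit_norm (t *\<^sub>R 1 + \<delta> x)" by (rule p_mult)
    also have "\<dots> = limit_norm (t *\<^sub>R 1 + \<delta> x)" by (simp add: limit_norm_delta p_one)
    finally show "upper x \<le> limit_norm (t *\<^sub>R 1 + \<delta> x) - t" by simp
  qed
  let ?P = "\<lambda>f. linear f \<and> (\<forall>x. f x \<le> upper x)"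
  have ext: "\<exists>g. ?P g \<and> (\<forall>x. g (\<delta> x) = f x)" if f: "?P f" for f
  proof -
    have lin: "linear f" and f_le: "\<And>x. f x \<le> upper x" using f by auto
    define W where "W = range (\<lambda>x. (\<delta> x, f x))"
    interpret sublinear_cone upper W
    proof
      show "(0, 0) \<in> W" unfolding W_def
        by (rule range_eqI[of _ _ 0]) (simp add: d_zero linear_0[OF lin])
      fix v c assume "(v, c) \<in> W"
      then obtain x where x: "v = \<delta> x" "c = f x" by (auto simp: W_def)
      show "c \<le> upper v" using f_le upper_delta order_trans unfolding x by blast
      show "(r *\<^sub>R v, r * c) \<in> W" for r
        unfolding W_def x by (rule range_eqI[of _ _ "r *\<^sub>R x"]) (simp add: d_scaleR linear_scale[OF lin])
      fix w d assume "(w, d) \<in> W"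
      then obtain y where y: "w = \<delta> y" "d = f y" by (auto simp: W_def)
      show "(v + w, c + d) \<in> W"
        unfolding W_def x y by (rule range_eqI[of _ _ "x + y"]) (simp add: d_add linear_add[OF lin])
    qed (rule sublinear_upper)
    obtain g where g: "linear g" "\<And>x. g x \<le> upper x" "\<And>w c. (w, c) \<in> W \<Longrightarrow> c \<le> g w"
      using hahn_banach by blast
    have "f x \<le> g (\<delta> x)" for x by (rule g(3)) (simp add: W_def)
    then have "g (\<delta> x) = f x" for x
      by (metis antisym d_minus linear_neg[OF g(1)] linear_neg[OF lin] neg_le_iff_le)
    with g show ?thesis by blast
  qed
  have "0 < limit_norm a" using assms p_nonneg[of a] by linarith
  then obtain f where f: "linear f" "\<And>x. f x \<le> upper x" "0 < f (star a * a)" using separating_functional by blast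
  have "\<exists>t. \<forall>n. (?P (t n) \<and> (n = 0 \<longrightarrow> t n = f)) \<and> (\<forall>x. t (Suc n) (\<delta> x) = t n x)"
  proof (rule dependent_nat_choice)
    show "\<exists>g. ?P g \<and> ((0::nat) = 0 \<longrightarrow> g = f)" using f by auto
    show "\<exists>h. (?P h \<and> (Suc n = 0 \<longrightarrow> h = f)) \<and> (\<forall>x. h (\<delta> x) = g x)"
      if "?P g \<and> (n = 0 \<longrightarrow> g = f)" for g n
      using ext[of g] that by auto
  qed
  then obtain t where t: "\<And>n. ?P (t n)" "t 0 = f" "\<And>n x. t (Suc n) (\<delta> x) = t n x" by blast
  have herm: "hermitian_part (\<delta> x) = \<delta> (hermitian_part x)" for x
    by (simp add: hermitian_part_def d_add d_scaleR d_star)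
  show ?thesis
  proof (intro exI conjI allI)
    show "positive_functional (complexify (t k))" for k
      using t(1) by (intro positive_functional_complexify) auto
    show "complexify (t (Suc k)) (\<delta> x) = complexify (t k) x" for k x
      by (simp add: complexify_def herm t(3) flip: d_scaleC)
    show "complexify (t 0) (star a * a) \<noteq> 0"
      using f by (simp add: t(2) complexify_self[OF f(1)] star_mult star_star)
  qed
qed

section \<open>Hilbert spaces from positive definite kernels\<close>

text \<open>Lists of pairs are formal linear combinations of points, appending is addition. \<open>ev K u\<close> is the function
  represented by \<open>u\<close>, \<open>form K\<close> the sesquilinear form that belongs to the kernel \<open>K\<close>.\<close>

definition ev :: "('x \<Rightarrow> 'x \<Rightarrow> complex) \<Rightarrow> (complex \<times> 'x) list \<Rightarrow> 'x \<Rightarrow> complex" where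
  "ev K u y = (\<Sum>(c, x)\<leftarrow>u. c * K x y)"

definition form :: "('x \<Rightarrow> 'x \<Rightarrow> complex) \<Rightarrow> (complex \<times> 'x) list \<Rightarrow> (complex \<times> 'x) list \<Rightarrow> complex" where
  "form K u v = (\<Sum>(d, y)\<leftarrow>v. cnj d * ev K u y)"

definition scal :: "complex \<Rightarrow> (complex \<times> 'x) list \<Rightarrow> (complex \<times> 'x) list" where
  "scal c = map (\<lambda>(d, x). (c * d, x))"

abbreviation dif :: "(complex \<times> 'x) list \<Rightarrow> (complex \<times> 'x) list \<Rightarrow> (complex \<times> 'x) list" where
  "dif u v \<equiv> u @ scal (-1) v"

abbreviation gmap :: "('x \<Rightarrow> 'y) \<Rightarrow> (complex \<times> 'x) list \<Rightarrow> (complex \<times> 'y) list" where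
  "gmap S \<equiv> map (\<lambda>(c, x). (c, S x))"

lemma ev_Nil [simp]: "ev K [] y = 0"
  and ev_Cons [simp]: "ev K ((c, x) # u) y = c * K x y + ev K u y"
  by (simp_all add: ev_def)

lemma ev_single: "ev K [(1, x)] = K x"
  by (rule ext) simp

lemma ev_append [simp]: "ev K (u @ v) y = ev K u y + ev K v y"
  by (simp add: ev_def)

lemma ev_scal [simp]: "ev K (scal c u) y = c * ev K u y"
  by (induction u) (auto simp: scal_def algebra_simps)

lemma form_Nil [simp]: "form K u [] = 0"
  and form_Cons [simp]: "form K u ((d, y) # v) = cnj d * ev K u y + form K u v"
  by (simp_all add: form_def)

lemma form_append_right [simp]: "form K u (v @ w) = form K u v + form K u w"
  by (simp add: form_def)

lemma form_scal_right [simp]: "form K u (scal c v) = cnj c * form K u v"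
  by (induction v) (auto simp: scal_def algebra_simps)

locale pd_kernel =
  fixes K :: "'x \<Rightarrow> 'x \<Rightarrow> complex"
  assumes herm: "K y x = cnj (K x y)"
    and psd: "0 \<le> Re (form K u u)"
begin

lemma form_cnj: "form K v u = cnj (form K u v)"
proof -
  have Nil: "form K [] w = 0" for w by (induction w) auto
  have fCons: "form K ((c, x) # u) w = c * cnj (ev K w x) + form K u w" for c x u w
  proof (induction w)
    case (Cons a w)
    obtain d y where "a = (d, y)" by force
    then show ?case using Cons by (simp add: algebra_simps herm[of x y])
  qed (simp add: Nil)
  show ?thesis
  proof (induction u)
    case (Cons a u)
    obtain c x where "a = (c, x)" by force
    then show ?case using Cons by (simp add: fCons)
  qed (simp add: Nil)
qed

lemma form_cong:
  assumes "ev K u = ev K u'" "ev K v = ev K v'" shows "form K u v = form K u' v'"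
proof -
  have r: "form K u w = form K u' w" if "ev K u = ev K u'" for u u' w
    using that by (simp add: form_def)
  show ?thesis using r[OF assms(1), of v] r[OF assms(2), of u'] form_cnj by metis
qed

lemma form_append_left [simp]: "form K (u @ v) w = form K u w + form K v w"
  using form_cnj[of "u @ v" w] form_cnj[of u w] form_cnj[of v w] by simp

lemma form_scal_left [simp]: "form K (scal c u) w = c * form K u w"
  using form_cnj[of "scal c u" w] form_cnj[of u w] by simp

definition nrm :: "(complex \<times> 'x) list \<Rightarrow> real" where
  "nrm u = sqrt (Re (form K u u))"

lemma nrm_nonneg [simp]: "0 \<le> nrm u" by (simp add: nrm_def psd)

lemma Re_of_real_times: "Re (of_real r * z) = r * Re z"
  by simp

lemma nrm_sq: "(nrm u)\<^sup>2 = Re (form K u u)"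
  by (simp add: nrm_def psd)

lemma form_self: "form K u u = of_real ((nrm u)\<^sup>2)"
  using form_cnj[of u u] by (simp add: nrm_def psd complex_eq_iff)

lemma nrm_cong: "ev K u = ev K v \<Longrightarrow> nrm u = nrm v"
  by (simp add: nrm_def form_cong[of u v u v])

lemma cauchy_schwarz: "cmod (form K u v) \<le> nrm u * nrm v"
proof -
  let ?b = "form K u v"
  have q: "0 \<le> (nrm u)\<^sup>2 - 2 * t * (cmod ?b)\<^sup>2 + t\<^sup>2 * (cmod ?b)\<^sup>2 * (nrm v)\<^sup>2" for t :: real
  proof -
    let ?c = "of_real t * ?b"
    have "form K (u @ scal (- ?c) v) (u @ scal (- ?c) v) =
      form K u u - cnj ?c * ?b - ?c * cnj ?b + ?c * cnj ?c * form K v v"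
      using form_cnj[of v u] by (simp add: algebra_simps)
    also have "\<dots> = of_real ((nrm u)\<^sup>2) - of_real (2 * t) * (?b * cnj ?b) + of_real (t\<^sup>2) * (?b * cnj ?b) * of_real ((nrm v)\<^sup>2)"
      unfolding form_self by (simp add: power2_eq_square algebra_simps)
    also have "?b * cnj ?b = of_real ((cmod ?b)\<^sup>2)" by (rule complex_norm_square[symmetric])
    finally have "form K (u @ scal (- ?c) v) (u @ scal (- ?c) v) =
      of_real ((nrm u)\<^sup>2 - 2 * t * (cmod ?b)\<^sup>2 + t\<^sup>2 * (cmod ?b)\<^sup>2 * (nrm v)\<^sup>2)" by simp
    then show ?thesis using psd[of "u @ scal (- ?c) v"] by simp
  qed
  show ?thesis
  proof (cases "nrm v = 0")
    case False
    then have v: "0 < (nrm v)\<^sup>2" by simp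
    define n where "n = (nrm v)\<^sup>2"
    have n: "0 < n" using v by (simp add: n_def)
    have "(1 / n)\<^sup>2 * (cmod ?b)\<^sup>2 * n = (cmod ?b)\<^sup>2 / n" using n by (simp add: power2_eq_square)
    then have "(cmod ?b)\<^sup>2 / n \<le> (nrm u)\<^sup>2" using q[of "1 / n"] unfolding n_def[symmetric] by simp
    then have "(cmod ?b)\<^sup>2 \<le> (nrm u * nrm v)\<^sup>2"
      using n by (simp add: pos_divide_le_eq power_mult_distrib n_def)
    then show ?thesis by (rule power2_le_imp_le) simp
  next
    case True
    have "?b = 0"
    proof (rule ccontr)
      assume "?b \<noteq> 0"
      then have b: "0 < (cmod ?b)\<^sup>2" by simp
      have "2 * (((nrm u)\<^sup>2 + 1) / (cmod ?b)\<^sup>2) * (cmod ?b)\<^sup>2 = 2 * ((nrm u)\<^sup>2 + 1)" using b by simp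
      then show False using q[of "((nrm u)\<^sup>2 + 1) / (cmod ?b)\<^sup>2"] True
        by simp (smt (verit) zero_le_power2)
    qed
    then show ?thesis by simp
  qed
qed

lemma ev_le: "cmod (ev K u x) \<le> nrm u * nrm [(1, x)]"
  using cauchy_schwarz[of u "[(1, x)]"] by simp

lemma nrm_scal: "nrm (scal c u) = cmod c * nrm u"
proof -
  have "form K (scal c u) (scal c u) = (c * cnj c) * form K u u" by simp
  also have "c * cnj c = of_real ((cmod c)\<^sup>2)" by (rule complex_norm_square[symmetric])
  finally have "Re (form K (scal c u) (scal c u)) = (cmod c)\<^sup>2 * Re (form K u u)"
    by (simp only: Re_of_real_times)
  then show ?thesis by (simp only: nrm_def) (simp add: real_sqrt_mult)
qed

lemma nrm_append: "nrm (u @ v) \<le> nrm u + nrm v"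
proof (rule power2_le_imp_le)
  have "(nrm (u @ v))\<^sup>2 = Re (form K u u + form K v v + (form K u v + cnj (form K u v)))"
    unfolding nrm_sq by (simp add: form_cnj[of v u])
  also have "\<dots> = (nrm u)\<^sup>2 + (nrm v)\<^sup>2 + 2 * Re (form K u v)" by (simp add: form_self)
  also have "Re (form K u v) \<le> nrm u * nrm v" using cauchy_schwarz complex_Re_le_cmod order_trans by blast
  finally show "(nrm (u @ v))\<^sup>2 \<le> (nrm u + nrm v)\<^sup>2" by (simp add: power2_eq_square algebra_simps)
qed simp

lemma nrm_dif_commute: "nrm (dif u v) = nrm (dif v u)"
proof -
  have "nrm (dif u v) = nrm (scal (-1) (dif v u))" by (rule nrm_cong) auto
  then show ?thesis by (simp add: nrm_scal)
qed

lemma nrm_le_dif: "nrm u \<le> nrm (dif u v) + nrm v"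
proof -
  have "nrm u = nrm (dif u v @ v)" by (rule nrm_cong) auto
  then show ?thesis by (metis nrm_append)
qed

text \<open>The completion is realised inside the functions on the set of points: its elements are the pointwise limits of
  Cauchy sequences of formal combinations.\<close>

definition approx :: "('x \<Rightarrow> complex) \<Rightarrow> (nat \<Rightarrow> (complex \<times> 'x) list) \<Rightarrow> bool" where
  "approx F v \<longleftrightarrow> (\<forall>e>0. \<exists>N. \<forall>m\<ge>N. \<forall>n\<ge>N. nrm (dif (v m) (v n)) < e) \<and>
     (\<forall>x. (\<lambda>n. ev K (v n) x) \<longlonglongrightarrow> F x)"

lemma approx_lim: "approx F v \<Longrightarrow> (\<lambda>n. ev K (v n) x) \<longlonglongrightarrow> F x"
  by (simp add: approx_def)

lemma approx_Cauchy: "approx F v \<Longrightarrow> 0 < e \<Longrightarrow> \<exists>N. \<forall>m\<ge>N. \<forall>n\<ge>N. nrm (dif (v m) (v n)) < e"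
  by (simp add: approx_def)

lemma approx_const: "approx (ev K u) (\<lambda>_. u)"
proof -
  have "nrm (dif u u) = nrm []" by (rule nrm_cong) auto
  then show ?thesis by (simp add: approx_def nrm_def)
qed

lemma approx_add: assumes "approx F v" "approx G w"
  shows "approx (\<lambda>x. F x + G x) (\<lambda>n. v n @ w n)"
  unfolding approx_def
proof (intro conjI allI impI)
  fix e :: real assume "0 < e"
  obtain N1 where N1: "\<forall>m\<ge>N1. \<forall>n\<ge>N1. nrm (dif (v m) (v n)) < e / 2"
    using approx_Cauchy[OF assms(1), of "e / 2"] \<open>0 < e\<close> by auto
  obtain N2 where N2: "\<forall>m\<ge>N2. \<forall>n\<ge>N2. nrm (dif (w m) (w n)) < e / 2"
    using approx_Cauchy[OF assms(2), of "e / 2"] \<open>0 < e\<close> by auto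
  have "nrm (dif (v m @ w m) (v n @ w n)) < e" if "m \<ge> max N1 N2" "n \<ge> max N1 N2" for m n
  proof -
    have "nrm (dif (v m @ w m) (v n @ w n)) = nrm (dif (v m) (v n) @ dif (w m) (w n))"
      by (rule nrm_cong) (auto simp: algebra_simps)
    also have "\<dots> \<le> nrm (dif (v m) (v n)) + nrm (dif (w m) (w n))" by (rule nrm_append)
    also have "\<dots> < e / 2 + e / 2" using N1 N2 that by (intro add_strict_mono) auto
    finally show ?thesis by simp
  qed
  then show "\<exists>N. \<forall>m\<ge>N. \<forall>n\<ge>N. nrm (dif (v m @ w m) (v n @ w n)) < e" by blast
next
  fix x
  show "(\<lambda>n. ev K (v n @ w n) x) \<longlonglongrightarrow> F x + G x"
    using approx_lim[OF assms(1)] approx_lim[OF assms(2)] by (simp add: tendsto_add)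
qed

lemma approx_bounded_image:
  assumes F: "approx F v" and bound: "\<And>u w. nrm (dif (T u) (T w)) \<le> C * nrm (dif u w)"
    and lim: "\<And>x. (\<lambda>n. ev K (T (v n)) x) \<longlonglongrightarrow> G x"
  shows "approx G (\<lambda>n. T (v n))"
  unfolding approx_def
proof (intro conjI allI impI lim)
  fix e :: real assume e: "0 < e"
  obtain N where N: "\<forall>m\<ge>N. \<forall>n\<ge>N. nrm (dif (v m) (v n)) < e / (\<bar>C\<bar> + 1)"
    using approx_Cauchy[OF F, of "e / (\<bar>C\<bar> + 1)"] e by auto
  have "nrm (dif (T (v m)) (T (v n))) < e" if "m \<ge> N" "n \<ge> N" for m n
  proof -
    have "nrm (dif (T (v m)) (T (v n))) \<le> C * nrm (dif (v m) (v n))" by (rule bound)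
    also have "\<dots> \<le> (\<bar>C\<bar> + 1) * nrm (dif (v m) (v n))" by (intro mult_right_mono) auto
    also have "\<dots> < (\<bar>C\<bar> + 1) * (e / (\<bar>C\<bar> + 1))" using N that by (intro mult_strict_left_mono) auto
    finally show ?thesis by simp
  qed
  then show "\<exists>N. \<forall>m\<ge>N. \<forall>n\<ge>N. nrm (dif (T (v m)) (T (v n))) < e" by blast
qed

lemma approx_scal: assumes F: "approx F v" shows "approx (\<lambda>x. c * F x) (\<lambda>n. scal c (v n))"
proof (rule approx_bounded_image[OF F])
  show "nrm (dif (scal c u) (scal c w)) \<le> cmod c * nrm (dif u w)" for u w
  proof -
    have "nrm (dif (scal c u) (scal c w)) = nrm (scal c (dif u w))"
      by (rule nrm_cong) (auto simp: algebra_simps)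
    then show ?thesis by (simp add: nrm_scal)
  qed
  show "(\<lambda>n. ev K (scal c (v n)) x) \<longlonglongrightarrow> c * F x" for x
    using approx_lim[OF F] by (simp add: tendsto_mult_left)
qed

lemma approx_dif: "approx F v \<Longrightarrow> approx G w \<Longrightarrow> approx (\<lambda>x. F x - G x) (\<lambda>n. dif (v n) (w n))"
  using approx_add[OF _ approx_scal[of G w "-1"], of F v] by simp

lemma approx_bounded: assumes "approx F v" obtains C where "0 \<le> C" "\<And>n. nrm (v n) \<le> C"
proof -
  obtain N where N: "\<forall>m\<ge>N. \<forall>n\<ge>N. nrm (dif (v m) (v n)) < 1"
    using approx_Cauchy[OF assms, of 1] by auto
  define C where "C = 1 + (\<Sum>i\<le>N. nrm (v i))"
  have part: "nrm (v i) \<le> (\<Sum>i\<le>N. nrm (v i))" if "i \<le> N" for i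
    using that by (intro member_le_sum) auto
  show ?thesis
  proof
    show "0 \<le> C" by (simp add: C_def sum_nonneg add_nonneg_nonneg)
    show "nrm (v n) \<le> C" for n
    proof (cases "n \<le> N")
      case True then show ?thesis using part[of n] by (simp add: C_def)
    next
      case False
      then show ?thesis using nrm_le_dif[of "v n" "v N"] N part[of N] by (smt (verit) C_def nle_le)
    qed
  qed
qed

text \<open>In \<open>(nrm (u n))\<^sup>2 = form K (u n) (u N) + form K (u n) (dif (u n) (u N))\<close> the last term is small for large
  \<open>N\<close>, and for fixed \<open>N\<close> the other term tends to \<open>0\<close> by pointwise convergence. So a function determines the
  limit of the norms of its approximations, and the inner product below is well defined.\<close>

lemma approx_null: assumes u: "approx (\<lambda>x. 0) u" shows "(\<lambda>n. nrm (u n)) \<longlonglongrightarrow> 0"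
proof -
  obtain C where C: "0 \<le> C" "\<And>n. nrm (u n) \<le> C" using approx_bounded[OF u] by blast
  have form0: "(\<lambda>n. form K (u n) w) \<longlonglongrightarrow> 0" for w
  proof (induction w)
    case (Cons a w)
    obtain d y where a: "a = (d, y)" by force
    have "(\<lambda>n. cnj d * ev K (u n) y + form K (u n) w) \<longlonglongrightarrow> cnj d * 0 + 0"
      by (intro tendsto_intros Cons approx_lim[OF u])
    then show ?case by (simp add: a)
  qed simp
  have "(\<lambda>n. (nrm (u n))\<^sup>2) \<longlonglongrightarrow> 0"
  proof (rule LIMSEQ_I)
    fix r :: real assume r: "0 < r"
    have "0 < r / (2 * (C + 1))" using r C by simp
    then obtain N where N: "\<forall>m\<ge>N. \<forall>n\<ge>N. nrm (dif (u m) (u n)) < r / (2 * (C + 1))"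
      using approx_Cauchy[OF u] by blast
    obtain N' where N': "\<forall>n\<ge>N'. norm (form K (u n) (u N) - 0) < r / 2"
      using LIMSEQ_D[OF form0[of "u N"], of "r / 2"] r by auto
    have "(nrm (u n))\<^sup>2 < r" if n: "n \<ge> max N N'" for n
    proof -
      have "form K (u n) (u n) = form K (u n) (u N) + form K (u n) (dif (u n) (u N))" by simp
      then have "(nrm (u n))\<^sup>2 \<le> cmod (form K (u n) (u N)) + cmod (form K (u n) (dif (u n) (u N)))"
        unfolding form_self by (metis norm_of_real abs_of_nonneg norm_triangle_ineq zero_le_power2)
      also have "cmod (form K (u n) (dif (u n) (u N))) \<le> nrm (u n) * nrm (dif (u n) (u N))"
        by (rule cauchy_schwarz)
      also have "\<dots> \<le> (C + 1) * (r / (2 * (C + 1)))"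
        using N n C(2)[of n] C(1) by (intro mult_mono) (auto simp: less_imp_le)
      also have "\<dots> = r / 2" using C by (simp add: field_simps)
      finally show ?thesis using N' n by auto
    qed
    then show "\<exists>no. \<forall>n\<ge>no. norm ((nrm (u n))\<^sup>2 - 0) < r"
      by (intro exI[of _ "max N N'"]) auto
  qed
  then have "(\<lambda>n. sqrt ((nrm (u n))\<^sup>2)) \<longlonglongrightarrow> sqrt 0" by (rule tendsto_real_sqrt)
  then show ?thesis by simp
qed

definition inner :: "('x \<Rightarrow> complex) \<Rightarrow> ('x \<Rightarrow> complex) \<Rightarrow> complex" where
  "inner F G = lim (\<lambda>n. form K ((SOME v. approx F v) n) ((SOME v. approx G v) n))"

lemma form_diff_le:
  "cmod (form K u w - form K u' w') \<le> nrm (dif u u') * nrm w + nrm u' * nrm (dif w w')"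
proof -
  have "form K u w - form K u' w' = form K (dif u u') w + form K u' (dif w w')" by simp
  then show ?thesis
    using order_trans[OF norm_triangle_ineq add_mono[OF cauchy_schwarz cauchy_schwarz]] by metis
qed

lemma inner_tendsto:
  assumes F: "approx F v" and G: "approx G w"
  shows "(\<lambda>n. form K (v n) (w n)) \<longlonglongrightarrow> inner F G"
proof -
  define v' where "v' = (SOME v. approx F v)"
  define w' where "w' = (SOME w. approx G w)"
  have F': "approx F v'" unfolding v'_def by (rule someI[where P = "approx F", OF F])
  have G': "approx G w'" unfolding w'_def by (rule someI[where P = "approx G", OF G])
  obtain C where C: "0 \<le> C" "\<And>n. nrm (v' n) \<le> C" using approx_bounded[OF F'] by blast
  obtain D where D: "0 \<le> D" "\<And>n. nrm (w' n) \<le> D" using approx_bounded[OF G'] by blast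
  obtain E where E: "0 \<le> E" "\<And>n. nrm (w n) \<le> E" using approx_bounded[OF G] by blast
  have "Cauchy (\<lambda>n. form K (v' n) (w' n))"
  proof (rule CauchyI)
    fix e :: real assume e: "0 < e"
    define r where "r = e / (2 * (C + D + 1))"
    have r: "0 < r" using e C D by (simp add: r_def)
    obtain N1 where N1: "\<forall>m\<ge>N1. \<forall>n\<ge>N1. nrm (dif (v' m) (v' n)) < r" using approx_Cauchy[OF F' r] by blast
    obtain N2 where N2: "\<forall>m\<ge>N2. \<forall>n\<ge>N2. nrm (dif (w' m) (w' n)) < r" using approx_Cauchy[OF G' r] by blast
    have "cmod (form K (v' m) (w' m) - form K (v' n) (w' n)) < e" if "m \<ge> max N1 N2" "n \<ge> max N1 N2" for m n
    proof -
      have "cmod (form K (v' m) (w' m) - form K (v' n) (w' n)) \<le>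
          nrm (dif (v' m) (v' n)) * nrm (w' m) + nrm (v' n) * nrm (dif (w' m) (w' n))"
        by (rule form_diff_le)
      also have "\<dots> \<le> r * D + C * r"
        using N1 N2 that C D r by (intro add_mono mult_mono) (auto simp: less_imp_le)
      also have "\<dots> < e"
      proof -
        have "r * D + C * r \<le> r * (C + D + 1)" using r by (simp add: algebra_simps)
        also have "\<dots> = e / 2" using C D by (simp add: r_def field_simps add_nonneg_pos)
        finally show ?thesis using e by simp
      qed
      finally show ?thesis .
    qed
    then show "\<exists>M. \<forall>m\<ge>M. \<forall>n\<ge>M. norm (form K (v' m) (w' m) - form K (v' n) (w' n)) < e" by blast
  qed
  then have "convergent (\<lambda>n. form K (v' n) (w' n))" by (rule Cauchy_convergent)
  then have lim': "(\<lambda>n. form K (v' n) (w' n)) \<longlonglongrightarrow> inner F G"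
    unfolding inner_def v'_def w'_def by (simp add: convergent_LIMSEQ_iff)
  have nv: "(\<lambda>n. nrm (dif (v n) (v' n))) \<longlonglongrightarrow> 0"
    using approx_null approx_dif[OF F F'] by simp
  have nw: "(\<lambda>n. nrm (dif (w n) (w' n))) \<longlonglongrightarrow> 0"
    using approx_null approx_dif[OF G G'] by simp
  have "(\<lambda>n. nrm (dif (v n) (v' n)) * E + C * nrm (dif (w n) (w' n))) \<longlonglongrightarrow> 0 * E + C * 0"
    by (intro tendsto_intros nv nw)
  then have lim0: "(\<lambda>n. nrm (dif (v n) (v' n)) * E + C * nrm (dif (w n) (w' n))) \<longlonglongrightarrow> 0" by simp
  have "(\<lambda>n. cmod (form K (v n) (w n) - form K (v' n) (w' n))) \<longlonglongrightarrow> 0"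
  proof (rule tendsto_sandwich[OF _ _ tendsto_const lim0])
    show "\<forall>\<^sub>F n in sequentially. cmod (form K (v n) (w n) - form K (v' n) (w' n)) \<le>
      nrm (dif (v n) (v' n)) * E + C * nrm (dif (w n) (w' n))"
      by (intro always_eventually allI order_trans[OF form_diff_le] add_mono mult_mono) (use C E in auto)
  qed simp
  then have "(\<lambda>n. form K (v n) (w n) - form K (v' n) (w' n)) \<longlonglongrightarrow> 0" by (rule tendsto_norm_zero_cancel)
  from tendsto_add[OF this lim'] show ?thesis by simp
qed

definition rk_carrier :: "('x \<Rightarrow> complex) set" where
  "rk_carrier = {F. \<exists>v. approx F v}"

lemma inner_add_left: assumes "F \<in> rk_carrier" "G \<in> rk_carrier" "H \<in> rk_carrier"
  shows "inner (\<lambda>x. F x + G x) H = inner F H + inner G H"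
proof -
  obtain u v w where a: "approx F u" "approx G v" "approx H w" using assms by (auto simp: rk_carrier_def)
  have "(\<lambda>n. form K (u n @ v n) (w n)) \<longlonglongrightarrow> inner F H + inner G H"
    using a by (simp add: tendsto_add inner_tendsto)
  then show ?thesis using inner_tendsto[OF approx_add[OF a(1,2)] a(3)] LIMSEQ_unique by blast
qed

lemma inner_scale_left: assumes "F \<in> rk_carrier" "H \<in> rk_carrier"
  shows "inner (\<lambda>x. c * F x) H = c * inner F H"
proof -
  obtain u w where a: "approx F u" "approx H w" using assms by (auto simp: rk_carrier_def)
  have "(\<lambda>n. form K (scal c (u n)) (w n)) \<longlonglongrightarrow> c * inner F H"
    using a by (simp add: tendsto_mult_left inner_tendsto)
  then show ?thesis using inner_tendsto[OF approx_scal[OF a(1)] a(2)] LIMSEQ_unique by blast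
qed

lemma inner_cnj: assumes "F \<in> rk_carrier" "G \<in> rk_carrier"
  shows "inner G F = cnj (inner F G)"
proof -
  obtain u v where a: "approx F u" "approx G v" using assms by (auto simp: rk_carrier_def)
  have "(\<lambda>n. form K (v n) (u n)) \<longlonglongrightarrow> cnj (inner F G)"
    using tendsto_cnj[OF inner_tendsto[OF a]] by (simp flip: form_cnj)
  then show ?thesis using inner_tendsto[OF a(2,1)] LIMSEQ_unique by blast
qed

definition rk_norm :: "('x \<Rightarrow> complex) \<Rightarrow> real" where
  "rk_norm F = sqrt (Re (inner F F))"

lemma rk_norm_tendsto: "approx F v \<Longrightarrow> (\<lambda>n. nrm (v n)) \<longlonglongrightarrow> rk_norm F"
  unfolding nrm_def rk_norm_def by (intro tendsto_real_sqrt tendsto_Re inner_tendsto)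

lemma inner_self_nonneg: assumes "F \<in> rk_carrier" shows "0 \<le> Re (inner F F)"
proof -
  obtain v where a: "approx F v" using assms by (auto simp: rk_carrier_def)
  show ?thesis by (rule LIMSEQ_le_const[OF tendsto_Re[OF inner_tendsto[OF a a]]]) (simp add: psd)
qed

lemma rk_norm_nonneg: "F \<in> rk_carrier \<Longrightarrow> 0 \<le> rk_norm F"
  by (simp add: rk_norm_def inner_self_nonneg)

lemma eval_le: assumes "F \<in> rk_carrier" shows "cmod (F x) \<le> rk_norm F * nrm [(1, x)]"
proof -
  obtain v where a: "approx F v" using assms by (auto simp: rk_carrier_def)
  show ?thesis
    by (rule LIMSEQ_le[OF tendsto_norm[OF approx_lim[OF a]] tendsto_mult_right[OF rk_norm_tendsto[OF a]]])
      (use ev_le in auto)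
qed

lemma rk_norm_triangle: assumes "F \<in> rk_carrier" "G \<in> rk_carrier"
  shows "rk_norm (\<lambda>x. F x + G x) \<le> rk_norm F + rk_norm G"
proof -
  obtain u v where a: "approx F u" "approx G v" using assms by (auto simp: rk_carrier_def)
  show ?thesis
    by (rule LIMSEQ_le[OF rk_norm_tendsto[OF approx_add[OF a]]
          tendsto_add[OF rk_norm_tendsto[OF a(1)] rk_norm_tendsto[OF a(2)]]]) (use nrm_append in auto)
qed

lemma rk_norm_ev: "rk_norm (ev K u) = nrm u"
  using rk_norm_tendsto[OF approx_const] by (simp add: LIMSEQ_const_iff)

lemma rk_add: "F \<in> rk_carrier \<Longrightarrow> G \<in> rk_carrier \<Longrightarrow> (\<lambda>x. F x + G x) \<in> rk_carrier"
  unfolding rk_carrier_def using approx_add by blast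

lemma rk_scale: "F \<in> rk_carrier \<Longrightarrow> (\<lambda>x. c * F x) \<in> rk_carrier"
  unfolding rk_carrier_def using approx_scal by blast

lemma rk_minus: "F \<in> rk_carrier \<Longrightarrow> (\<lambda>x. - F x) \<in> rk_carrier"
  using rk_scale[of F "-1"] by simp

lemma rk_diff: "F \<in> rk_carrier \<Longrightarrow> G \<in> rk_carrier \<Longrightarrow> (\<lambda>x. F x - G x) \<in> rk_carrier"
  using rk_add[of F "\<lambda>x. - G x"] rk_minus by simp

lemma rk_ev: "ev K u \<in> rk_carrier"
  unfolding rk_carrier_def using approx_const by blast

lemma rk_zero: "(\<lambda>x. 0) \<in> rk_carrier"
proof -
  have "ev K [] = (\<lambda>x. 0)" by auto
  then show ?thesis by (metis rk_ev)
qed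

lemma rk_kernel: "K x \<in> rk_carrier"
  using rk_ev[of "[(1, x)]"] by (simp only: ev_single)

lemma approx_norm_lim: assumes a: "approx F v" shows "(\<lambda>n. rk_norm (\<lambda>x. F x - ev K (v n) x)) \<longlonglongrightarrow> 0"
proof (rule LIMSEQ_I)
  fix r :: real assume r: "0 < r"
  obtain N where N: "\<forall>m\<ge>N. \<forall>n\<ge>N. nrm (dif (v m) (v n)) < r / 2"
    using approx_Cauchy[OF a, of "r / 2"] r by auto
  have "rk_norm (\<lambda>x. F x - ev K (v n) x) \<le> r / 2" if "n \<ge> N" for n
    by (rule LIMSEQ_le_const2[OF rk_norm_tendsto[OF approx_dif[OF a approx_const]]])
      (use N that less_imp_le in blast)
  moreover have "0 \<le> rk_norm (\<lambda>x. F x - ev K (v n) x)" for n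
    using a by (intro rk_norm_nonneg rk_diff rk_ev) (auto simp: rk_carrier_def)
  ultimately show "\<exists>no. \<forall>n\<ge>no. norm (rk_norm (\<lambda>x. F x - ev K (v n) x) - 0) < r"
    using r by (intro exI[of _ N]) (smt (verit) diff_zero field_sum_of_halves real_norm_def)
qed

text \<open>Each \<open>X n\<close> is replaced by a formal combination at distance less than \<open>1 / (n + 1)\<close>. These form a Cauchy
  sequence, and their values converge because evaluation at a point is bounded.\<close>

lemma rk_complete:
  assumes X: "\<And>n::nat. X n \<in> rk_carrier"
    and C: "\<And>e. 0 < e \<Longrightarrow> \<exists>N. \<forall>m\<ge>N. \<forall>n\<ge>N. rk_norm (\<lambda>x. X m x - X n x) < e"
  shows "\<exists>F\<in>rk_carrier. (\<lambda>n. rk_norm (\<lambda>x. X n x - F x)) \<longlonglongrightarrow> 0"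
proof -
  have "\<exists>u. rk_norm (\<lambda>x. X n x - ev K u x) < 1 / real (Suc n)" for n
  proof -
    obtain w where w: "approx (X n) w" using X[of n] by (auto simp: rk_carrier_def)
    obtain N where N: "\<forall>k\<ge>N. norm (rk_norm (\<lambda>x. X n x - ev K (w k) x) - 0) < 1 / real (Suc n)"
      using LIMSEQ_D[OF approx_norm_lim[OF w], of "1 / real (Suc n)"] by auto
    then have "rk_norm (\<lambda>x. X n x - ev K (w N) x) < 1 / real (Suc n)"
      using spec[OF N, of N] by auto
    then show ?thesis by blast
  qed
  then obtain v where v: "\<And>n. rk_norm (\<lambda>x. X n x - ev K (v n) x) < 1 / real (Suc n)" by metis
  have sym: "rk_norm (\<lambda>x. F x - G x) = rk_norm (\<lambda>x. G x - F x)" if "F \<in> rk_carrier" "G \<in> rk_carrier" for F G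
  proof -
    obtain u w where a: "approx F u" "approx G w" using \<open>F \<in> rk_carrier\<close> \<open>G \<in> rk_carrier\<close> by (auto simp: rk_carrier_def)
    have "(\<lambda>n. nrm (dif (w n) (u n))) \<longlonglongrightarrow> rk_norm (\<lambda>x. F x - G x)"
      using rk_norm_tendsto[OF approx_dif[OF a]] by (simp add: nrm_dif_commute)
    then show ?thesis using rk_norm_tendsto[OF approx_dif[OF a(2,1)]] LIMSEQ_unique by blast
  qed
  have tri: "rk_norm (\<lambda>x. F x - H x) \<le> rk_norm (\<lambda>x. F x - G x) + rk_norm (\<lambda>x. G x - H x)"
    if "F \<in> rk_carrier" "G \<in> rk_carrier" "H \<in> rk_carrier" for F G H
    using rk_norm_triangle[of "\<lambda>x. F x - G x" "\<lambda>x. G x - H x"] that by (simp add: rk_diff)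
  have inv: "(\<lambda>n. 1 / real (Suc n)) \<longlonglongrightarrow> 0" by (rule LIMSEQ_Suc[OF lim_const_over_n])
  have cau: "\<exists>N. \<forall>m\<ge>N. \<forall>n\<ge>N. nrm (dif (v m) (v n)) < e" if e: "0 < e" for e
  proof -
    obtain N1 where N1: "\<forall>m\<ge>N1. \<forall>n\<ge>N1. rk_norm (\<lambda>x. X m x - X n x) < e / 3" using C[of "e / 3"] e by auto
    obtain N2 where N2: "\<forall>n\<ge>N2. norm (1 / real (Suc n) - 0) < e / 3" using LIMSEQ_D[OF inv, of "e / 3"] e by auto
    have "nrm (dif (v m) (v n)) < e" if mn: "m \<ge> max N1 N2" "n \<ge> max N1 N2" for m n
    proof -
      have "ev K (dif (v m) (v n)) = (\<lambda>x. ev K (v m) x - ev K (v n) x)" by auto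
      then have "nrm (dif (v m) (v n)) = rk_norm (\<lambda>x. ev K (v m) x - ev K (v n) x)"
        using rk_norm_ev[of "dif (v m) (v n)"] by simp
      also have "\<dots> \<le> rk_norm (\<lambda>x. ev K (v m) x - X m x) + rk_norm (\<lambda>x. X m x - ev K (v n) x)"
        by (intro tri rk_ev X)
      also have "rk_norm (\<lambda>x. X m x - ev K (v n) x) \<le> rk_norm (\<lambda>x. X m x - X n x) + rk_norm (\<lambda>x. X n x - ev K (v n) x)"
        by (intro tri rk_ev X)
      also have "rk_norm (\<lambda>x. ev K (v m) x - X m x) = rk_norm (\<lambda>x. X m x - ev K (v m) x)"
        by (intro sym rk_ev X)
      also have "rk_norm (\<lambda>x. X m x - ev K (v m) x) + (rk_norm (\<lambda>x. X m x - X n x) + rk_norm (\<lambda>x. X n x - ev K (v n) x)) < e / 3 + (e / 3 + e / 3)"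
      proof (intro add_strict_mono)
        have "1 / real (Suc i) < e / 3" if "i \<ge> max N1 N2" for i
          using N2 that by (auto simp del: of_nat_Suc)
        then show "rk_norm (\<lambda>x. X m x - ev K (v m) x) < e / 3" "rk_norm (\<lambda>x. X n x - ev K (v n) x) < e / 3"
          using v mn less_trans by blast+
        show "rk_norm (\<lambda>x. X m x - X n x) < e / 3" using N1 mn by simp
      qed
      finally show ?thesis by simp
    qed
    then show ?thesis by blast
  qed
  have "\<exists>l. (\<lambda>n. ev K (v n) x) \<longlonglongrightarrow> l" for x
  proof -
    have "Cauchy (\<lambda>n. ev K (v n) x)"
    proof (rule CauchyI)
      fix e :: real assume e: "0 < e"
      let ?k = "nrm [(1, x)]"
      have k: "0 < ?k + 1" by (simp add: add_nonneg_pos)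
      obtain N where N: "\<forall>m\<ge>N. \<forall>n\<ge>N. nrm (dif (v m) (v n)) < e / (?k + 1)" using cau[of "e / (?k + 1)"] e k by auto
      have "cmod (ev K (v m) x - ev K (v n) x) < e" if "m \<ge> N" "n \<ge> N" for m n
      proof -
        have "cmod (ev K (v m) x - ev K (v n) x) \<le> nrm (dif (v m) (v n)) * ?k"
          using ev_le[of "dif (v m) (v n)" x] by simp
        also have "\<dots> \<le> nrm (dif (v m) (v n)) * (?k + 1)" by (intro mult_left_mono) auto
        also have "\<dots> < e" using N that k by (simp add: pos_less_divide_eq)
        finally show ?thesis .
      qed
      then show "\<exists>M. \<forall>m\<ge>M. \<forall>n\<ge>M. norm (ev K (v m) x - ev K (v n) x) < e" by blast
    qed
    then show ?thesis using Cauchy_convergent convergent_def by blast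
  qed
  then obtain F where F: "\<And>x. (\<lambda>n. ev K (v n) x) \<longlonglongrightarrow> F x" by metis
  have a: "approx F v" unfolding approx_def using cau F by blast
  then have Fc: "F \<in> rk_carrier" by (auto simp: rk_carrier_def)
  have "(\<lambda>n. rk_norm (\<lambda>x. X n x - F x)) \<longlonglongrightarrow> 0"
  proof (rule tendsto_sandwich[OF _ _ tendsto_const])
    show "(\<lambda>n. 1 / real (Suc n) + rk_norm (\<lambda>x. F x - ev K (v n) x)) \<longlonglongrightarrow> 0"
      using tendsto_add[OF inv approx_norm_lim[OF a]] by simp
    show "\<forall>\<^sub>F n in sequentially. 0 \<le> rk_norm (\<lambda>x. X n x - F x)"
      by (intro always_eventually allI rk_norm_nonneg rk_diff X Fc)
    have "rk_norm (\<lambda>x. X n x - F x) \<le> 1 / real (Suc n) + rk_norm (\<lambda>x. F x - ev K (v n) x)" for n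
      using tri[OF X[of n] rk_ev[of "v n"] Fc] v[of n] sym[OF Fc rk_ev[of "v n"]] by simp
    then show "\<forall>\<^sub>F n in sequentially. rk_norm (\<lambda>x. X n x - F x) \<le> 1 / real (Suc n) + rk_norm (\<lambda>x. F x - ev K (v n) x)"
      by simp
  qed
  then show ?thesis using Fc by blast
qed

definition rkhs :: "('x \<Rightarrow> complex) hilbert" where
  "rkhs = \<lparr>carrier = rk_carrier, mult = \<lambda>F G. F, one = \<lambda>x. 0, zero = \<lambda>x. 0, add = \<lambda>F G x. F x + G x,
     smult = \<lambda>c F x. c * F x, ip = inner\<rparr>"

lemma rkhs_simps [simp]: "carrier rkhs = rk_carrier" "\<zero>\<^bsub>rkhs\<^esub> = (\<lambda>x. 0)"
  "F \<oplus>\<^bsub>rkhs\<^esub> G = (\<lambda>x. F x + G x)" "c \<odot>\<^bsub>rkhs\<^esub> F = (\<lambda>x. c * F x)" "ip rkhs = inner"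
  "hnorm rkhs F = rk_norm F"
  by (simp_all add: rkhs_def hnorm_def rk_norm_def)

lemma abelian_group_rkhs: "abelian_group rkhs"
proof (rule abelian_groupI)
  fix F assume "F \<in> carrier rkhs"
  then show "\<exists>G\<in>carrier rkhs. G \<oplus>\<^bsub>rkhs\<^esub> F = \<zero>\<^bsub>rkhs\<^esub>"
    by (intro bexI[of _ "\<lambda>x. - F x"]) (auto simp: rk_minus)
qed (auto simp: rk_add rk_zero add_ac)

lemma rkhs_minus: "F \<in> rk_carrier \<Longrightarrow> G \<in> rk_carrier \<Longrightarrow> F \<ominus>\<^bsub>rkhs\<^esub> G = (\<lambda>x. F x - G x)"
proof -
  assume F: "F \<in> rk_carrier" and G: "G \<in> rk_carrier"
  have "\<ominus>\<^bsub>rkhs\<^esub> G = (\<lambda>x. - G x)"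
    by (rule abelian_group.minus_equality[OF abelian_group_rkhs]) (auto simp: G rk_minus)
  then show ?thesis by (simp add: a_minus_def)
qed

lemma module_rkhs: "module complex_ring rkhs"
proof (rule moduleI)
  show "cring complex_ring"
  proof (rule cringI)
    show "abelian_group complex_ring"
    proof (rule abelian_groupI)
      fix x :: complex assume "x \<in> carrier complex_ring"
      show "\<exists>y\<in>carrier complex_ring. y \<oplus>\<^bsub>complex_ring\<^esub> x = \<zero>\<^bsub>complex_ring\<^esub>"
        by (rule bexI[of _ "- x"]) (auto simp: complex_ring_def)
    qed (auto simp: complex_ring_def)
    show "Group.comm_monoid complex_ring"
      by unfold_locales (auto simp: complex_ring_def)
  qed (auto simp: complex_ring_def algebra_simps)
qed (auto simp: abelian_group_rkhs rk_scale complex_ring_def algebra_simps)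

theorem hilbert_space_rkhs: "hilbert_space rkhs"
proof -
  interpret module complex_ring rkhs by (rule module_rkhs)
  show ?thesis
  proof
    fix F assume F: "F \<in> carrier rkhs" and 0: "ip rkhs F F = 0"
    have "F x = 0" for x using eval_le[of F x] F 0 by (simp add: rk_norm_def)
    then show "F = \<zero>\<^bsub>rkhs\<^esub>" by auto
  next
    fix X :: "nat \<Rightarrow> 'x \<Rightarrow> complex"
    assume X: "\<And>n. X n \<in> carrier rkhs"
      and C: "\<And>e. 0 < e \<Longrightarrow> \<exists>N. \<forall>m\<ge>N. \<forall>n\<ge>N. hnorm rkhs (X m \<ominus>\<^bsub>rkhs\<^esub> X n) < e"
    have X': "X n \<in> rk_carrier" for n using X by simp
    have "\<exists>F\<in>rk_carrier. (\<lambda>n. rk_norm (\<lambda>x. X n x - F x)) \<longlonglongrightarrow> 0"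
      by (rule rk_complete[OF X']) (use C in \<open>simp add: rkhs_minus X'\<close>)
    then show "\<exists>F\<in>carrier rkhs. (\<lambda>n. hnorm rkhs (X n \<ominus>\<^bsub>rkhs\<^esub> F)) \<longlonglongrightarrow> 0"
      by (auto simp: rkhs_minus X')
  qed (auto simp: inner_add_left inner_scale_left inner_self_nonneg intro: inner_cnj)
qed

lemma inner_kernel: assumes "F \<in> rk_carrier" shows "inner F (K x) = F x"
proof -
  obtain v where a: "approx F v" using assms by (auto simp: rk_carrier_def)
  have "approx (K x) (\<lambda>_. [(1, x)])" using approx_const[of "[(1, x)]"] by (simp only: ev_single)
  from inner_tendsto[OF a this] have "(\<lambda>n. ev K (v n) x) \<longlonglongrightarrow> inner F (K x)" by simp
  then show ?thesis using approx_lim[OF a] LIMSEQ_unique by blast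
qed

text \<open>If the maps \<open>S\<close> and \<open>S'\<close> of points satisfy this, then the linear extension of \<open>S\<close> is the operator
  \<open>F \<mapsto> F \<circ> S'\<close> on functions, with adjoint \<open>F \<mapsto> F \<circ> S\<close>.\<close>

definition adjoint_maps :: "('x \<Rightarrow> 'x) \<Rightarrow> ('x \<Rightarrow> 'x) \<Rightarrow> bool" where
  "adjoint_maps S S' \<longleftrightarrow> (\<forall>x y. K (S x) y = K x (S' y)) \<and> (\<exists>C. \<forall>u. nrm (gmap S u) \<le> C * nrm u)"

lemma ev_gmap: "(\<And>x y. K (S x) y = K x (S' y)) \<Longrightarrow> ev K (gmap S u) y = ev K u (S' y)"
  by (induction u) auto

lemma form_gmap: "(\<And>x y. K (S x) y = K x (S' y)) \<Longrightarrow> form K (gmap S u) v = form K u (gmap S' v)"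
  by (induction v) (auto simp: ev_gmap)

lemma kernel_adjoint_sym: "(\<And>x y. K (S x) y = K x (S' y)) \<Longrightarrow> K (S' x) y = K x (S y)"
  by (metis herm)

lemma adjoint_maps_sym: assumes "adjoint_maps S S'" shows "adjoint_maps S' S"
proof -
  have adj: "K (S x) y = K x (S' y)" for x y using assms by (simp add: adjoint_maps_def)
  obtain C where C: "\<And>u. nrm (gmap S u) \<le> C * nrm u" using assms by (auto simp: adjoint_maps_def)
  have "nrm (gmap S' u) \<le> C * nrm u" for u
  proof (cases "nrm (gmap S' u) = 0")
    case True
    then show ?thesis using order_trans[OF nrm_nonneg C] by simp
  next
    case False
    have "(nrm (gmap S' u))\<^sup>2 = cmod (form K (gmap S' u) (gmap S' u))"
      unfolding form_self by (simp add: norm_power)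
    also have "form K (gmap S' u) (gmap S' u) = form K (gmap S (gmap S' u)) u"
      by (rule form_gmap[OF adj, symmetric])
    also have "cmod (form K (gmap S (gmap S' u)) u) \<le> nrm (gmap S (gmap S' u)) * nrm u" by (rule cauchy_schwarz)
    also have "\<dots> \<le> C * nrm (gmap S' u) * nrm u" by (intro mult_right_mono C) simp
    finally have "nrm (gmap S' u) * nrm (gmap S' u) \<le> nrm (gmap S' u) * (C * nrm u)"
      by (simp add: power2_eq_square mult_ac)
    then show ?thesis using False nrm_nonneg[of "gmap S' u"] by (simp add: mult_le_cancel_left)
  qed
  then show ?thesis using kernel_adjoint_sym[OF adj] by (auto simp: adjoint_maps_def)
qed

definition comp_op :: "('x \<Rightarrow> 'x) \<Rightarrow> ('x \<Rightarrow> complex) \<Rightarrow> ('x \<Rightarrow> complex)" where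
  "comp_op S = restrict (\<lambda>F. F \<circ> S) rk_carrier"

lemma approx_comp:
  assumes S: "adjoint_maps S S'" and F: "approx F v"
  shows "approx (F \<circ> S') (\<lambda>n. gmap S (v n))"
proof -
  have adj: "K (S x) y = K x (S' y)" for x y using S by (simp add: adjoint_maps_def)
  obtain C where C: "\<And>u. nrm (gmap S u) \<le> C * nrm u" using S by (auto simp: adjoint_maps_def)
  show ?thesis
  proof (rule approx_bounded_image[OF F, where C = C])
    fix u w
    have "nrm (dif (gmap S u) (gmap S w)) = nrm (gmap S (dif u w))"
      by (rule nrm_cong) (auto simp: ev_gmap[OF adj] simp del: map_append)
    then show "nrm (dif (gmap S u) (gmap S w)) \<le> C * nrm (dif u w)" using C by metis
  next
    show "(\<lambda>n. ev K (gmap S (v n)) x) \<longlonglongrightarrow> (F \<circ> S') x" for x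
      using approx_lim[OF F] by (simp add: ev_gmap[OF adj])
  qed
qed

lemma comp_carrier: "adjoint_maps S S' \<Longrightarrow> F \<in> rk_carrier \<Longrightarrow> F \<circ> S' \<in> rk_carrier"
  unfolding rk_carrier_def using approx_comp by blast

lemma comp_op_apply: "F \<in> rk_carrier \<Longrightarrow> comp_op S F = F \<circ> S"
  by (simp add: comp_op_def)

lemma comp_op_bounded: assumes S: "adjoint_maps S S'" shows "comp_op S' \<in> bounded_ops rkhs"
proof -
  obtain C where C: "\<And>u. nrm (gmap S u) \<le> C * nrm u" using S by (auto simp: adjoint_maps_def)
  have "rk_norm (F \<circ> S') \<le> C * rk_norm F" if "F \<in> rk_carrier" for F
  proof -
    obtain v where v: "approx F v" using \<open>F \<in> rk_carrier\<close> by (auto simp: rk_carrier_def)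
    show ?thesis
      by (rule LIMSEQ_le[OF rk_norm_tendsto[OF approx_comp[OF S v]] tendsto_mult_left[OF rk_norm_tendsto[OF v]]])
        (use C in auto)
  qed
  moreover have "comp_op S' \<in> rk_carrier \<rightarrow>\<^sub>E rk_carrier"
    using comp_carrier[OF S] by (auto simp: comp_op_def)
  ultimately show ?thesis
    by (auto simp: bounded_ops_def comp_op_apply rk_add rk_scale intro!: exI[of _ C])
qed

lemma comp_adjoint:
  assumes S: "adjoint_maps S S'" and F: "F \<in> rk_carrier" and G: "G \<in> rk_carrier"
  shows "inner (F \<circ> S') G = inner F (G \<circ> S)"
proof -
  have adj: "K (S x) y = K x (S' y)" for x y using S by (simp add: adjoint_maps_def)
  obtain v where v: "approx F v" using F by (auto simp: rk_carrier_def)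
  obtain w where w: "approx G w" using G by (auto simp: rk_carrier_def)
  have "(\<lambda>n. form K (gmap S (v n)) (w n)) \<longlonglongrightarrow> inner F (G \<circ> S)"
    unfolding form_gmap[OF adj] by (intro inner_tendsto v approx_comp[OF adjoint_maps_sym[OF S] w])
  then show ?thesis using inner_tendsto[OF approx_comp[OF S v] w] LIMSEQ_unique by blast
qed

lemma adjoint_comp_op: assumes S: "adjoint_maps S S'" shows "adjoint_op rkhs (comp_op S') = comp_op S"
  unfolding adjoint_op_def
proof (rule the_equality)
  show "comp_op S \<in> bounded_ops rkhs \<and>
    (\<forall>x\<in>carrier rkhs. \<forall>y\<in>carrier rkhs. ip rkhs (comp_op S' x) y = ip rkhs x (comp_op S y))"
    using comp_op_bounded[OF adjoint_maps_sym[OF S]] comp_adjoint[OF S] by (auto simp: comp_op_apply)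
next
  fix T assume T: "T \<in> bounded_ops rkhs \<and>
    (\<forall>x\<in>carrier rkhs. \<forall>y\<in>carrier rkhs. ip rkhs (comp_op S' x) y = ip rkhs x (T y))"
  then have Text: "T \<in> rk_carrier \<rightarrow>\<^sub>E rk_carrier" by (simp add: bounded_ops_def)
  show "T = comp_op S"
  proof
    fix G
    show "T G = comp_op S G"
    proof (cases "G \<in> rk_carrier")
      case False
      then show ?thesis using Text by (auto simp: comp_op_def PiE_def extensional_def)
    next
      case True
      have TG: "T G \<in> rk_carrier" using Text True by auto
      have SG: "G \<circ> S \<in> rk_carrier" using comp_carrier[OF adjoint_maps_sym[OF S] True] .
      have "T G x = (G \<circ> S) x" for x
      proof -
        have "inner (K x) (T G) = inner (K x) (G \<circ> S)"
          using T True rk_kernel comp_adjoint[OF S rk_kernel True, of x] by (auto simp: comp_op_apply)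
        then have "inner (T G) (K x) = inner (G \<circ> S) (K x)"
          using inner_cnj[OF rk_kernel TG] inner_cnj[OF rk_kernel SG] by metis
        then show ?thesis by (simp add: inner_kernel TG SG)
      qed
      then show ?thesis using True by (auto simp: comp_op_apply)
    qed
  qed
qed

lemma projection_contractive:
  assumes adj: "\<And>x y. K (P x) y = K x (P y)" and idem: "\<And>x. P (P x) = P x"
  shows "nrm (gmap P u) \<le> nrm u"
proof (cases "nrm (gmap P u) = 0")
  case False
  have c: "gmap P (gmap P u) = gmap P u" using idem by auto
  have "(nrm (gmap P u))\<^sup>2 = cmod (form K (gmap P u) (gmap P u))"
    unfolding form_self by (simp add: norm_power)
  also have "form K (gmap P u) (gmap P u) = form K u (gmap P u)"
    using form_gmap[OF adj, of u "gmap P u"] unfolding c .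
  also have "cmod (form K u (gmap P u)) \<le> nrm u * nrm (gmap P u)" by (rule cauchy_schwarz)
  finally show ?thesis using False nrm_nonneg[of "gmap P u"]
    by (simp add: power2_eq_square mult_le_cancel_right)
qed simp

text \<open>The map \<open>S' \<circ> S\<close> is a symmetric idempotent on combinations, hence a contraction, and
  \<open>(nrm (gmap S u))\<^sup>2\<close> is its quadratic form.\<close>

lemma adjoint_maps_partial_isometry:
  assumes adj: "\<And>x y. K (S x) y = K x (S' y)" and idem: "\<And>x. S' (S (S' (S x))) = S' (S x)"
  shows "adjoint_maps S S'"
  unfolding adjoint_maps_def
proof (intro conjI allI exI[of _ 1])
  show "K (S x) y = K x (S' y)" for x y by (rule adj)
  fix u
  have adj': "K (S' x) y = K x (S y)" for x y by (rule kernel_adjoint_sym[OF adj])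
  have c: "gmap S' (gmap S u) = gmap (\<lambda>x. S' (S x)) u" by auto
  have "(nrm (gmap S u))\<^sup>2 = cmod (form K (gmap S u) (gmap S u))"
    unfolding form_self by (simp add: norm_power)
  also have "form K (gmap S u) (gmap S u) = form K u (gmap (\<lambda>x. S' (S x)) u)"
    using form_gmap[OF adj, of u "gmap S u"] unfolding c .
  also have "cmod (form K u (gmap (\<lambda>x. S' (S x)) u)) \<le> nrm u * nrm (gmap (\<lambda>x. S' (S x)) u)" by (rule cauchy_schwarz)
  also have "\<dots> \<le> nrm u * nrm u"
  proof (rule mult_left_mono)
    show "nrm (gmap (\<lambda>x. S' (S x)) u) \<le> nrm u"
      by (rule projection_contractive) (simp_all only: adj adj' idem)
  qed simp
  finally have "(nrm (gmap S u))\<^sup>2 \<le> (nrm u)\<^sup>2" by (simp add: power2_eq_square)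
  then have "nrm (gmap S u) \<le> nrm u" by (rule power2_le_imp_le) simp
  then show "nrm (gmap S u) \<le> 1 * nrm u" by simp
qed

end

section \<open>The kernel of a $C^*$-dynamical system\<close>

context star_endo
begin

lemma dn_dn: "dn i (dn j x) = dn (i + j) x" by (simp add: funpow_add)

lemma dn_Suc_right: "dn n (\<delta> x) = dn (Suc n) x" by (simp add: funpow_swap1)

lemma dn_one_left: "i \<le> j \<Longrightarrow> dn i 1 * dn j x = dn j x"
proof -
  assume "i \<le> j"
  then have "dn j x = dn i (dn (j - i) x)" by (simp add: dn_dn)
  then show ?thesis by (simp flip: dn_mult)
qed

lemma dn_one_right: "i \<le> j \<Longrightarrow> dn j x * dn i 1 = dn j x"
proof -
  assume "i \<le> j"
  then have "dn j x = dn i (dn (j - i) x)" by (simp add: dn_dn)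
  then show ?thesis by (simp flip: dn_mult)
qed

lemma dn_one_left': "i \<le> j \<Longrightarrow> dn i 1 * (dn j x * y) = dn j x * y"
  by (simp add: dn_one_left flip: mult.assoc)

lemma dn_one_right': "i \<le> j \<Longrightarrow> dn j x * (dn i 1 * y) = dn j x * y"
  by (simp add: dn_one_right flip: mult.assoc)

lemma star_dn_one: "star (dn n 1) = dn n 1" by (simp flip: dn_star)

end

type_synonym ('l, 'a) gen = "'l \<times> nat \<times> nat \<times> 'a"

text \<open>The label \<open>l\<close> selects a sequence of functionals \<open>T l k\<close>. It is a tower unless \<open>fin l\<close>; for \<open>fin l\<close> only
  level \<open>0\<close> is present and vanishes on \<open>J\<close>. The bijection \<open>e\<close> encodes the generators in the type of points
  of the kernel.\<close>

locale tower_system = cstar_system \<delta> J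
  for \<delta> :: "'a::unital_cstar_algebra \<Rightarrow> 'a" and J :: "'a set" +
  fixes T :: "'l \<Rightarrow> nat \<Rightarrow> 'a \<Rightarrow> complex" and e :: "'x \<Rightarrow> ('l, 'a) gen" and fin :: "'l \<Rightarrow> bool"
  assumes bij: "bij e"
    and pos: "positive_functional (T l k)"
    and tower: "\<not> fin l \<Longrightarrow> T l (Suc k) (\<delta> x) = T l k x"
    and fin_Suc: "fin l \<Longrightarrow> T l (Suc k) x = 0"
    and fin_J: "fin l \<Longrightarrow> x \<in> J \<Longrightarrow> T l 0 x = 0"
    and sep_J: "a \<notin> J \<Longrightarrow> \<exists>l. fin l \<and> T l 0 (star a * a) \<noteq> 0"
    and sep_limit: "limit_norm a \<noteq> 0 \<Longrightarrow> \<exists>l. T l 0 (star a * a) \<noteq> 0"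
begin

lemma T_add: "T l k (x + y) = T l k x + T l k y"
  and T_scaleC: "T l k (scaleC c x) = c * T l k x"
  and T_star: "T l k (star x) = cnj (T l k x)"
  and T_pos: "0 \<le> Re (T l k (star x * x))"
  using pos[of l k] by (auto simp: positive_functional_def)

lemma T_zero: "T l k 0 = 0"
  using T_scaleC[of l k 0 0] by simp

lemma tower_dn: "\<not> fin l \<Longrightarrow> T l (k + d) (dn d x) = T l k x"
  by (induction d) (simp_all add: tower)

lemma fin_zero: "fin l \<Longrightarrow> 0 < k \<Longrightarrow> T l k x = 0"
  by (cases k) (auto simp: fin_Suc)

text \<open>The generator \<open>(l, j, k, a)\<close> stands for the vector \<open>\<delta>\<^sup>j 1 * a\<close> at level \<open>k\<close> of the inductive limit, placed in
  the component with number \<open>j - k\<close>, on which an element \<open>c\<close> of the algebra acts as \<open>\<delta>\<^sup>j c\<close> at level \<open>k\<close>. Two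
  generators are compared at the higher one of their levels.\<close>

fun K0 :: "('l, 'a) gen \<Rightarrow> ('l, 'a) gen \<Rightarrow> complex" where
  "K0 (l, j, k, a) (l', j', k', b) = (if l = l' \<and> j + k' = j' + k then
     (let m = max k k' in T l m (star (dn (m - k') b) * dn (j + (m - k)) 1 * dn (m - k) a)) else 0)"

lemma K0_herm: "K0 y x = cnj (K0 x y)"
proof -
  obtain l j k a where x: "x = (l, j, k, a)" by (metis prod_cases4)
  obtain l' j' k' b where y: "y = (l', j', k', b)" by (metis prod_cases4)
  have "j + (max k k' - k) = j' + (max k k' - k')" if "j + k' = j' + k" using that by (simp add: max_def)
  then show ?thesis
    by (auto simp: x y Let_def max.commute star_mult star_star star_dn_one mult.assoc simp flip: T_star)
qed

fun vec :: "nat \<Rightarrow> ('l, 'a) gen \<Rightarrow> 'a" where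
  "vec m (l, j, k, a) = dn (m - k) (dn j 1 * a)"

text \<open>Generators of different classes are orthogonal. For \<open>fin l\<close> the functionals above level \<open>0\<close> vanish, so that
  generators of different levels are orthogonal as well.\<close>

fun cls :: "('l, 'a) gen \<Rightarrow> 'l \<times> int \<times> nat" where
  "cls (l, j, k, a) = (l, int j - int k, if fin l then k else 0)"

abbreviation (input) lev :: "('l, 'a) gen \<Rightarrow> nat" where "lev x \<equiv> fst (snd (snd x))"

text \<open>Along a tower both generators can be moved up to a common level. For \<open>fin l\<close> they have the same level as soon
  as they are in the same class.\<close>

lemma K0_vec:
  assumes c: "cls x = cls y" and m: "lev x \<le> m" "lev y \<le> m" "fin (fst x) \<Longrightarrow> m = lev x"
  shows "K0 x y = T (fst x) m (star (vec m y) * vec m x)"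
proof -
  obtain l j k a where x: "x = (l, j, k, a)" by (metis prod_cases4)
  obtain l' j' k' b where y: "y = (l', j', k', b)" by (metis prod_cases4)
  have eq: "l' = l" "j + k' = j' + k" using c by (auto simp: x y split: if_splits)
  have km: "k \<le> m" "k' \<le> m" using m by (auto simp: x y)
  define r where "r = max k k'"
  have idx: "j' + (m - k') = j + (m - k)" using eq km by linarith
  have "star (vec m y) * vec m x = star (dn (m - k') b) * (dn (j + (m - k)) 1 * dn (j + (m - k)) 1) * dn (m - k) a"
    by (simp add: x y dn_mult star_mult star_dn_one dn_dn mult.assoc idx[symmetric] add.commute)
  also have "\<dots> = star (dn (m - k') b) * dn (j + (m - k)) 1 * dn (m - k) a" by (simp flip: dn_mult)
  finally have 1: "star (vec m y) * vec m x = star (dn (m - k') b) * dn (j + (m - k)) 1 * dn (m - k) a" .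
  have "T l r (star (dn (r - k') b) * dn (j + (r - k)) 1 * dn (r - k) a)
      = T l m (star (dn (m - k') b) * dn (j + (m - k)) 1 * dn (m - k) a)"
  proof (cases "fin l")
    case True
    then have "m = r" using m c by (auto simp: x y r_def eq split: if_splits)
    then show ?thesis by simp
  next
    case False
    have r: "r \<le> m" "k \<le> r" "k' \<le> r" using km by (auto simp: r_def)
    have "dn (m - r) (star (dn (r - k') b) * dn (j + (r - k)) 1 * dn (r - k) a)
      = star (dn (m - k') b) * dn (j + (m - k)) 1 * dn (m - k) a"
      using r by (simp add: dn_mult dn_star dn_dn add.left_commute)
    then show ?thesis
      using tower_dn[OF False, of r "m - r"] r by (metis le_add_diff_inverse)
  qed
  then show ?thesis unfolding 1 by (simp add: x y eq Let_def r_def)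
qed

lemma K0_cls: "cls x \<noteq> cls y \<Longrightarrow> K0 x y = 0"
proof -
  assume ne: "cls x \<noteq> cls y"
  obtain l j k a where x: "x = (l, j, k, a)" by (metis prod_cases4)
  obtain l' j' k' b where y: "y = (l', j', k', b)" by (metis prod_cases4)
  show ?thesis
  proof (cases "l = l' \<and> j + k' = j' + k")
    case True
    then have "fin l" "k \<noteq> k'" using ne by (auto simp: x y split: if_splits)
    then have "T l (max k k') z = 0" for z by (intro fin_zero) auto
    then show ?thesis using True by (simp add: x y Let_def)
  next
    case False
    then show ?thesis by (auto simp: x y)
  qed
qed

definition combo :: "nat \<Rightarrow> (complex \<times> ('l, 'a) gen) list \<Rightarrow> 'a" where
  "combo m u = (\<Sum>(c, x)\<leftarrow>u. scaleC c (vec m x))"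

lemma form_block:
  assumes u: "\<And>c x. (c, x) \<in> set u \<Longrightarrow> cls x = C \<and> lev x \<le> m \<and> (fin (fst C) \<longrightarrow> m = lev x)"
  shows "form K0 u u = T (fst C) m (star (combo m u) * combo m u)"
proof -
  have fst: "fst x = fst (cls x)" for x by (cases x) simp
  have ev: "ev K0 v y = T (fst C) m (star (vec m y) * combo m v)"
    if "set v \<subseteq> set u" "(d, y) \<in> set u" for v d y
    using that(1)
  proof (induction v)
    case (Cons a v)
    obtain c x where a: "a = (c, x)" by (cases a)
    have "K0 x y = T (fst C) m (star (vec m y) * vec m x)"
      using K0_vec[of x y m] u[of c x] u[OF that(2)] Cons.prems fst[of x] by (auto simp: a)
    then show ?case using Cons by (simp add: a combo_def distrib_left T_add mult_scaleC_right T_scaleC)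
  qed (simp add: combo_def T_zero)
  have "form K0 u v = T (fst C) m (star (combo m v) * combo m u)" if "set v \<subseteq> set u" for v
    using that
  proof (induction v)
    case (Cons a v)
    obtain d y where a: "a = (d, y)" by (cases a)
    have "ev K0 u y = T (fst C) m (star (vec m y) * combo m u)"
      using Cons.prems by (intro ev[of u d]) (auto simp: a)
    then show ?case using Cons
      by (simp add: a combo_def[of m "a # v"] combo_def[of m v, symmetric] star_add star_scaleC distrib_right T_add mult_scaleC_left T_scaleC)
        (simp add: combo_def star_add star_scaleC distrib_right T_add mult_scaleC_left T_scaleC)
  qed (simp add: combo_def T_zero)
  then show ?thesis by simp
qed

text \<open>The combination splits into its parts in the various classes, and on each class the form is
  \<open>F (star y * y)\<close> for a positive functional \<open>F\<close> by \<open>form_block\<close>.\<close>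

lemma K0_psd: "0 \<le> Re (form K0 u u)"
proof (induction "length u" arbitrary: u rule: less_induct)
  case less
  show ?case
  proof (cases u)
    case Nil then show ?thesis by simp
  next
    case (Cons a u')
    define C where "C = cls (snd a)"
    define P where "P = (\<lambda>(c :: complex, x). cls x = C)"
    let ?v = "filter P u" and ?w = "filter (\<lambda>z. \<not> P z) u"
    have ev_split: "ev K0 z y = ev K0 (filter P z) y + ev K0 (filter (\<lambda>z. \<not> P z) z) y" for z y
      by (induction z) auto
    have right: "form K0 z t = form K0 z (filter P t) + form K0 z (filter (\<lambda>z. \<not> P z) t)" for z t
      by (induction t) auto
    have left: "form K0 u t = form K0 ?v t + form K0 ?w t" for t
      by (induction t) (auto simp: ev_split[of u] algebra_simps)
    have ev0: "ev K0 z y = 0" if "\<And>c x. (c, x) \<in> set z \<Longrightarrow> cls x \<noteq> cls y" for z y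
      using that
    proof (induction z)
      case (Cons b z)
      obtain c x where b: "b = (c, x)" by (cases b)
      then have "K0 x y = 0" by (intro K0_cls Cons.prems[of c]) simp
      moreover have "ev K0 z y = 0" 
      proof (rule Cons.IH)
        show "cls x' \<noteq> cls y" if "(c', x') \<in> set z" for c' x' using Cons.prems[of c' x'] that by simp
      qed
      ultimately show ?case by (simp add: b)
    qed simp
    have form0: "form K0 z t = 0" if "\<And>c x d y. (c, x) \<in> set z \<Longrightarrow> (d, y) \<in> set t \<Longrightarrow> cls x \<noteq> cls y" for z t
      using that
    proof (induction t)
      case (Cons b t)
      obtain d y where b: "b = (d, y)" by (cases b)
      have "ev K0 z y = 0"
      proof (rule ev0)
        show "cls x \<noteq> cls y" if "(c, x) \<in> set z" for c x using Cons.prems[of c x d y] that b by simp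
      qed
      moreover have "form K0 z t = 0"
      proof (rule Cons.IH)
        show "cls x \<noteq> cls y'" if "(c, x) \<in> set z" "(d', y') \<in> set t" for c x d' y'
          using Cons.prems[of c x d' y'] that by simp
      qed
      ultimately show ?case by (simp add: b)
    qed simp
    have cross: "form K0 ?v ?w = 0" "form K0 ?w ?v = 0" by (rule form0; auto simp: P_def)+
    have "form K0 u u = form K0 ?v ?v + form K0 ?w ?w"
      unfolding left right[of _ u] cross by simp
    moreover have "0 \<le> Re (form K0 ?w ?w)"
    proof (rule less)
      have "P a" by (simp add: P_def C_def case_prod_unfold)
      then show "length ?w < length u" by (simp add: Cons length_filter_le le_imp_less_Suc)
    qed
    moreover have "0 \<le> Re (form K0 ?v ?v)"
    proof -
      define m where "m = (if fin (fst C) then snd (snd C) else Max (lev ` snd ` set ?v))"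
      have cf: "fin (fst (cls x)) \<Longrightarrow> snd (snd (cls x)) = lev x" for x by (cases x) auto
      have "cls x = C \<and> lev x \<le> m \<and> (fin (fst C) \<longrightarrow> m = lev x)" if "(c, x) \<in> set ?v" for c x
      proof -
        have cx: "cls x = C" using that by (auto simp: P_def)
        have "lev x \<le> Max (lev ` snd ` set ?v)" by (rule Max_ge) (use that in force)+
        then show ?thesis using cx cf[of x] by (auto simp: m_def)
      qed
      then have "form K0 ?v ?v = T (fst C) m (star (combo m ?v) * combo m ?v)" by (rule form_block)
      then show ?thesis by (simp add: T_pos)
    qed
    ultimately show ?thesis by simp
  qed
qed

definition K :: "'x \<Rightarrow> 'x \<Rightarrow> complex" where
  "K x y = K0 (e x) (e y)"

definition g :: "('l, 'a) gen \<Rightarrow> 'x" where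
  "g = inv_into UNIV e"

lemma e_g [simp]: "e (g z) = z"
  using bij by (simp add: g_def bij_is_surj surj_f_inv_f)

lemma g_e [simp]: "g (e x) = x"
  using bij by (simp add: g_def bij_is_inj)

sublocale pd_kernel K
proof
  show "K y x = cnj (K x y)" for x y unfolding K_def by (rule K0_herm)
  fix u
  have "ev K v y = ev K0 (gmap e v) (e y)" for v y by (induction v) (auto simp: K_def)
  then have "form K v w = form K0 (gmap e v) (gmap e w)" for v w by (induction w) auto
  then show "0 \<le> Re (form K u u)" using K0_psd by simp
qed

fun act0 :: "'a \<Rightarrow> ('l, 'a) gen \<Rightarrow> ('l, 'a) gen" where
  "act0 c (l, j, k, a) = (l, j, k, dn j c * a)"

text \<open>The shift \<open>U\<close> on generators lowers the number \<open>j - k\<close> of the component by one and keeps the vector. For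
  \<open>j = 0\<close> the vector moves up to the next level, which kills it if \<open>fin l\<close>.\<close>

fun down0 :: "('l, 'a) gen \<Rightarrow> ('l, 'a) gen" where
  "down0 (l, Suc j, k, a) = (l, j, k, dn (Suc j) 1 * a)"
| "down0 (l, 0, k, a) = (l, 0, Suc k, \<delta> a)"

text \<open>The adjoint of the shift: a vector is projected to the range of \<open>\<delta>\<^sup>j\<^sup>+\<^sup>1 1\<close> in the next component.\<close>

fun up0 :: "('l, 'a) gen \<Rightarrow> ('l, 'a) gen" where
  "up0 (l, j, k, a) = (l, Suc j, k, dn (Suc j) 1 * a)"

lemma act0_adj: "K0 (act0 c x) y = K0 x (act0 (star c) y)"
proof -
  obtain l j k a where x: "x = (l, j, k, a)" by (metis prod_cases4)
  obtain l' j' k' b where y: "y = (l', j', k', b)" by (metis prod_cases4)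
  show ?thesis
  proof (cases "l = l' \<and> j + k' = j' + k")
    case True
    define m where "m = max k k'"
    have idx: "m - k' + j' = m - k + j" using True by (auto simp: m_def max_def)
    have "star (dn (m - k') b) * dn (j + (m - k)) 1 * dn (m - k) (dn j c * a)
      = star (dn (m - k') (dn j' (star c) * b)) * dn (j + (m - k)) 1 * dn (m - k) a"
      by (simp add: dn_mult dn_dn star_mult dn_star star_star idx add.commute[of j] mult.assoc dn_one_left')
        (simp add: dn_one_right flip: mult.assoc)
    then show ?thesis using True by (simp add: x y m_def[symmetric])
  qed (auto simp: x y)
qed

lemma down0_adj: "K0 (down0 x) y = K0 x (up0 y)"
proof -
  obtain l j k a where x: "x = (l, j, k, a)" by (metis prod_cases4)
  obtain l' j' k' b where y: "y = (l', j', k', b)" by (metis prod_cases4)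
  show ?thesis
  proof (cases j)
    case (Suc i)
    show ?thesis
    proof (cases "l = l' \<and> i + k' = j' + k")
      case True
      define m where "m = max k k'"
      have idx: "m - k' + Suc j' = m - k + Suc i" using True by (auto simp: m_def max_def)
      have "star (dn (m - k') b) * dn (i + (m - k)) 1 * dn (m - k) (dn (Suc i) 1 * a)
        = star (dn (m - k') b) * (dn (m - k + i) 1 * (dn (m - k + Suc i) 1 * dn (m - k) a))"
        by (simp only: dn_mult dn_dn mult.assoc add.commute[of i])
      also have "\<dots> = star (dn (m - k') b) * (dn (m - k + Suc i) 1 * dn (m - k) a)"
        by (subst dn_one_left') auto
      also have "\<dots> = star (dn (m - k') b) * (dn (m - k + Suc i) 1 * (dn (m - k + Suc i) 1 * dn (m - k) a))"
        by (subst dn_one_left') auto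
      also have "\<dots> = star (dn (m - k') (dn (Suc j') 1 * b)) * dn (Suc i + (m - k)) 1 * dn (m - k) a"
        by (simp only: dn_mult dn_dn mult.assoc add.commute[of "Suc i"] star_mult star_dn_one idx)
      finally show ?thesis using True
        by (simp add: x y Suc m_def[symmetric] Let_def del: funpow.simps)
    qed (auto simp: x y Suc)
  next
    case 0
    show ?thesis
    proof (cases "l = l' \<and> k' = j' + Suc k")
      case True
      then have m: "max (Suc k) k' = k'" "max k k' = k'" "k' - Suc k = j'" "k' - k = Suc j'" by auto
      have "star b * dn j' 1 * dn j' (\<delta> a) = star b * (dn j' 1 * (dn (Suc j') a * 1))"
        by (simp only: dn_Suc_right mult.assoc mult_1_right)
      also have "\<dots> = star b * (dn (Suc j') 1 * (dn (Suc j') 1 * (dn (Suc j') a * 1)))"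
        by (subst dn_one_left', simp)+ simp
      also have "\<dots> = star (dn (Suc j') 1 * b) * dn (Suc j') 1 * dn (Suc j') a"
        by (simp only: mult.assoc mult_1_right star_mult star_dn_one)
      finally show ?thesis using True m by (simp add: x y 0 Let_def del: funpow.simps)
    qed (auto simp: x y 0)
  qed
qed

lemma act0_mult: "act0 c (act0 d x) = act0 (c * d) x"
  by (cases x) (simp add: dn_mult mult.assoc)

lemma up0_down0_up0: "up0 (down0 (up0 x)) = up0 x"
  by (cases x) (simp add: dn_one_left' del: funpow.simps)

lemma down0_act0_up0: "down0 (act0 c (up0 x)) = act0 (\<delta> c) x"
  by (cases x) (simp add: dn_one_left' dn_one_right' dn_Suc_right del: funpow.simps)

lemma up0_down0_act0: "up0 (down0 (act0 c x)) = act0 c (up0 (down0 x))"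
proof -
  obtain l j k a where x: "x = (l, j, k, a)" by (metis prod_cases4)
  show ?thesis
  proof (cases j)
    case 0
    then show ?thesis by (simp add: x d_mult) (simp add: d_unit flip: mult.assoc)
  next
    case (Suc i)
    then show ?thesis by (simp add: x dn_one_left' dn_one_right' del: funpow.simps)
  qed
qed

section \<open>The covariant representation\<close>

definition act :: "'a \<Rightarrow> 'x \<Rightarrow> 'x" where "act c x = g (act0 c (e x))"
definition down :: "'x \<Rightarrow> 'x" where "down x = g (down0 (e x))"
definition up :: "'x \<Rightarrow> 'x" where "up x = g (up0 (e x))"

lemma act_mult: "act c (act d x) = act (c * d) x"
  and up_down_up: "up (down (up x)) = up x"
  and down_act_up: "down (act c (up x)) = act (\<delta> c) x"
  and up_down_act: "up (down (act c x)) = act c (up (down x))"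
  by (simp_all add: act_def down_def up_def act0_mult up0_down0_up0 down0_act0_up0 up0_down0_act0)

lemma act_adj: "K (act c x) y = K x (act (star c) y)"
  and down_adj: "K (down x) y = K x (up y)"
  by (simp_all add: K_def act_def down_def up_def act0_adj down0_adj)

lemma K0_left_add: "K0 (act0 (c + d) x) y = K0 (act0 c x) y + K0 (act0 d x) y"
  by (cases x; cases y) (simp add: Let_def dn_add distrib_left distrib_right T_add)

lemma K0_left_scaleC: "K0 (act0 (scaleC r c) x) y = r * K0 (act0 c x) y"
  by (cases x; cases y) (simp add: Let_def dn_scaleC mult_scaleC_left mult_scaleC_right T_scaleC)

lemma K0_act_one: "K0 (act0 1 x) y = K0 x y"
proof -
  obtain l j k a where x: "x = (l, j, k, a)" by (metis prod_cases4)
  obtain l' j' k' b where y: "y = (l', j', k', b)" by (metis prod_cases4)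
  have "dn (j + n) 1 * dn n (dn j 1 * a) = dn (j + n) 1 * dn n a" for n
    by (simp add: dn_mult dn_dn dn_one_left add.commute flip: mult.assoc)
  then show ?thesis by (simp add: x y Let_def mult.assoc)
qed

lemma act_add: "K (act (c + d) x) y = K (act c x) y + K (act d x) y"
  and act_scaleC: "K (act (scaleC r c) x) y = r * K (act c x) y"
  and act_one: "K (act 1 x) y = K x y"
  by (simp_all add: K_def act_def K0_left_add K0_left_scaleC K0_act_one)

lemma ev_act_add: "ev K (gmap (act (c + d)) u) y = ev K (gmap (act c) u) y + ev K (gmap (act d) u) y"
  and ev_act_scaleC: "ev K (gmap (act (scaleC r c)) u) y = r * ev K (gmap (act c) u) y"
  and ev_act_one: "ev K (gmap (act 1) u) y = ev K u y"
  by (induction u) (auto simp: act_add act_scaleC act_one algebra_simps)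

text \<open>If \<open>star c * c + d * d = 1\<close>, then \<open>c\<close> and \<open>d\<close> act on the form like the columns of an isometry.\<close>

lemma act_contractive:
  assumes c: "norm c \<le> 1" shows "nrm (gmap (act c) u) \<le> nrm u"
proof -
  have "star (star c * c) = star c * c" "norm (star c * c) \<le> 1"
    using c by (simp_all add: star_mult star_star cstar_identity power_le_one)
  then obtain d where d: "star d = d" "d * d = 1 - star c * c" by (rule one_minus_square_exists)
  have sq: "form K (gmap (act b) u) (gmap (act b) u) = form K (gmap (act (star b * b)) u) u" for b
  proof -
    have "form K (gmap (act (star b)) (gmap (act b) u)) u = form K (gmap (act b) u) (gmap (act b) u)"
      using form_gmap[of "act (star b)" "act b"] act_adj[of "star b"] by (simp only: star_star)
    moreover have "gmap (act (star b)) (gmap (act b) u) = gmap (act (star b * b)) u" by (auto simp: act_mult)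
    ultimately show ?thesis by (simp only:)
  qed
  have "form K (gmap (act c) u) (gmap (act c) u) + form K (gmap (act d) u) (gmap (act d) u)
      = form K (gmap (act (star c * c)) u @ gmap (act (star d * d)) u) u"
    by (simp only: sq form_append_left)
  also have "\<dots> = form K (gmap (act (star c * c + star d * d)) u) u"
    by (rule form_cong) (auto simp: ev_act_add)
  also have "\<dots> = form K u u" by (rule form_cong) (auto simp: d ev_act_one)
  finally have "(nrm (gmap (act c) u))\<^sup>2 + (nrm (gmap (act d) u))\<^sup>2 = (nrm u)\<^sup>2"
    unfolding nrm_sq by (metis plus_complex.simps(1))
  then have "(nrm (gmap (act c) u))\<^sup>2 \<le> (nrm u)\<^sup>2" by (metis le_add_same_cancel1 zero_le_power2)
  then show ?thesis by (rule power2_le_imp_le) simp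
qed

lemma adjoint_act: "adjoint_maps (act c) (act (star c))"
  unfolding adjoint_maps_def
proof (intro conjI allI act_adj exI)
  fix u
  define r where "r = norm c + 1"
  have r: "0 < r" by (simp add: r_def add_nonneg_pos)
  define b where "b = scaleC (of_real (inverse r)) c"
  have c: "c = scaleC (of_real r) b" using r by (simp add: b_def scaleC_scaleC flip: of_real_mult)
  have "norm b = norm c / r"
    using r by (simp add: b_def norm_scaleC norm_inverse norm_of_real divide_inverse del: of_real_inverse)
  then have b: "norm b \<le> 1" using r by (simp add: r_def)
  have "nrm (gmap (act c) u) = nrm (scal (of_real r) (gmap (act b) u))"
    unfolding c by (rule nrm_cong) (auto simp: ev_act_scaleC)
  also have "\<dots> = r * nrm (gmap (act b) u)" using r by (simp add: nrm_scal)
  also have "\<dots> \<le> r * nrm u" using r act_contractive[OF b] by simp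
  finally show "nrm (gmap (act c) u) \<le> (norm c + 1) * nrm u" by (simp add: r_def)
qed

lemma adjoint_down: "adjoint_maps down up"
  by (rule adjoint_maps_partial_isometry) (simp_all add: down_adj up_down_up)

lemma adjoint_maps_comp:
  assumes "adjoint_maps S S'" "adjoint_maps R R'" shows "adjoint_maps (S \<circ> R) (R' \<circ> S')"
proof -
  obtain C where C: "\<And>u. nrm (gmap S u) \<le> C * nrm u" using assms by (auto simp: adjoint_maps_def)
  obtain D where D: "\<And>u. nrm (gmap R u) \<le> D * nrm u" using assms by (auto simp: adjoint_maps_def)
  have "nrm (gmap (S \<circ> R) u) \<le> \<bar>C\<bar> * \<bar>D\<bar> * nrm u" for u
  proof -
    have "gmap (S \<circ> R) u = gmap S (gmap R u)" by auto
    then have "nrm (gmap (S \<circ> R) u) \<le> C * nrm (gmap R u)" using C by metis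
    also have "\<dots> \<le> \<bar>C\<bar> * nrm (gmap R u)" by (intro mult_right_mono) auto
    also have "\<dots> \<le> \<bar>C\<bar> * (D * nrm u)" by (intro mult_left_mono D) auto
    also have "\<dots> \<le> \<bar>C\<bar> * (\<bar>D\<bar> * nrm u)" by (intro mult_left_mono mult_right_mono) auto
    finally show ?thesis by simp
  qed
  then show ?thesis using assms by (auto simp: adjoint_maps_def)
qed

lemma comp_op_compose:
  assumes "adjoint_maps S R"
  shows "compose rk_carrier (comp_op f) (comp_op R) = comp_op (R \<circ> f)"
  using comp_carrier[OF assms] by (auto simp: compose_def comp_op_def fun_eq_iff)

text \<open>A linear relation among the kernel functions of three points passes to all functions of the space.\<close>

lemma rk_relation:
  assumes "\<And>x. K x y = r * K x y1 + s * K x y2" and F: "F \<in> rk_carrier"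
  shows "F y = r * F y1 + s * F y2"
proof -
  obtain v where v: "approx F v" using F by (auto simp: rk_carrier_def)
  have "ev K u y = r * ev K u y1 + s * ev K u y2" for u
    by (induction u) (auto simp: assms(1) algebra_simps)
  then have "(\<lambda>n. ev K (v n) y) \<longlonglongrightarrow> r * F y1 + s * F y2"
    by (simp add: tendsto_add tendsto_mult_left approx_lim[OF v])
  then show ?thesis using approx_lim[OF v] LIMSEQ_unique by blast
qed

text \<open>The linear extension of \<open>act c\<close>, expressed on functions: composition is with the adjoint map.\<close>

definition rep :: "'a \<Rightarrow> ('x \<Rightarrow> complex) \<Rightarrow> 'x \<Rightarrow> complex" where
  "rep c = comp_op (act (star c))"

abbreviation U :: "('x \<Rightarrow> complex) \<Rightarrow> 'x \<Rightarrow> complex" where "U \<equiv> comp_op up"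

lemma rep_bounded: "rep c \<in> bounded_ops rkhs"
  unfolding rep_def by (rule comp_op_bounded[OF adjoint_act])

lemma rep_adjoint: "rep (star c) = adjoint_op rkhs (rep c)"
  unfolding rep_def adjoint_comp_op[OF adjoint_act] by (simp add: star_star)

lemma U_adjoint: "adjoint_op rkhs U = comp_op down"
  by (rule adjoint_comp_op[OF adjoint_down])

lemma K_act_add_right: "K x (act (c + d) y) = K x (act c y) + K x (act d y)"
  using act_adj[of "star c" x y] act_adj[of "star d" x y] act_adj[of "star (c + d)" x y]
  by (simp add: star_star star_add act_add)

lemma K_act_scaleC_right: "K x (act (scaleC r c) y) = cnj r * K x (act c y)"
  using act_adj[of "star c" x y] act_adj[of "star (scaleC r c)" x y]
  by (simp add: star_star star_scaleC act_scaleC)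

lemma K_act_one_right: "K x (act 1 y) = K x y"
  using act_adj[of 1 x y] act_one[of x y] by simp

lemma star_representation_rep: "star_representation rkhs rep"
  unfolding star_representation_def
proof (intro conjI allI ballI)
  fix a b and F assume "F \<in> carrier rkhs"
  then have F: "F \<in> rk_carrier" by simp
  have "F (act (star a + star b) x) = F (act (star a) x) + F (act (star b) x)" for x
    using rk_relation[of "act (star a + star b) x" 1 "act (star a) x" 1 "act (star b) x" F] F
    by (simp add: K_act_add_right)
  then show "rep (a + b) F = rep a F \<oplus>\<^bsub>rkhs\<^esub> rep b F"
    using F by (auto simp: rep_def comp_op_apply star_add)
next
  fix c a and F assume "F \<in> carrier rkhs"
  then have F: "F \<in> rk_carrier" by simp
  have "F (act (scaleC (cnj c) (star a)) x) = c * F (act (star a) x)" for x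
    using rk_relation[of "act (scaleC (cnj c) (star a)) x" c "act (star a) x" 0 x F] F
    by (simp add: K_act_scaleC_right)
  then show "rep (scaleC c a) F = c \<odot>\<^bsub>rkhs\<^esub> rep a F"
    using F by (auto simp: rep_def comp_op_apply star_scaleC)
next
  fix a b
  show "rep (a * b) = compose (carrier rkhs) (rep a) (rep b)"
    by (simp add: rep_def comp_op_compose[OF adjoint_act] star_mult comp_def act_mult)
qed (simp_all add: rep_bounded rep_adjoint)

lemma rep_one: assumes "F \<in> rk_carrier" shows "rep 1 F = F"
proof -
  have "F (act 1 x) = F x" for x
    using rk_relation[of "act 1 x" 1 x 0 x F] assms by (simp add: K_act_one_right)
  then show ?thesis using assms by (auto simp: rep_def comp_op_apply)
qed

lemma nondegenerate_rep: "nondegenerate rkhs rep"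
  unfolding nondegenerate_def
proof (intro ballI allI impI)
  fix F and \<epsilon> :: real assume "F \<in> carrier rkhs" and \<epsilon>: "0 < \<epsilon>"
  then have F: "F \<in> rk_carrier" by simp
  interpret abelian_group rkhs by (rule abelian_group_rkhs)
  have "(\<Oplus>\<^bsub>rkhs\<^esub>i\<in>{..<1::nat}. rep 1 F) = F"
    using F by (simp add: rep_one lessThan_Suc finsum_insert)
  then have "hnorm rkhs (F \<ominus>\<^bsub>rkhs\<^esub> (\<Oplus>\<^bsub>rkhs\<^esub>i\<in>{..<1::nat}. rep 1 F)) < \<epsilon>"
  proof -
    have "ev K [] = (\<lambda>x. 0)" by auto
    then have "rk_norm (\<lambda>x. 0) = 0" using rk_norm_ev[of "[]"] by (simp add: nrm_def)
    then show ?thesis using F \<epsilon> \<open>_ = F\<close> by (simp add: rkhs_minus)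
  qed
  then show "\<exists>(n::nat) a h. (\<forall>i<n. h i \<in> carrier rkhs) \<and>
      hnorm rkhs (F \<ominus>\<^bsub>rkhs\<^esub> (\<Oplus>\<^bsub>rkhs\<^esub>i\<in>{..<n}. rep (a i) (h i))) < \<epsilon>"
    using F by (intro exI[of _ "1::nat"] exI[of _ "\<lambda>_. 1"] exI[of _ "\<lambda>_. F"]) auto
qed

text \<open>If \<open>rep a = rep b\<close>, the functionals of the labels with \<open>fin l\<close> show that all \<open>\<delta>\<^sup>j (a - b)\<close> lie in \<open>J\<close>. So
  \<open>limit_norm (a - b) = norm (a - b)\<close>, and this is \<open>0\<close> by the towers.\<close>

lemma inj_rep: "inj rep"
proof (rule injI)
  fix a b assume ab: "rep a = rep b"
  define c where "c = a - b"
  have eq: "K x (act (star a) y) = K x (act (star b) y)" for x y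
    using fun_cong[OF fun_cong[OF ab, of "K x"], of y] by (simp add: rep_def comp_op_apply rk_kernel)
  have zero: "T l 0 (star (dn j c) * dn j c) = 0" for l j
  proof -
    have "T l 0 (dn j (star c * a)) = T l 0 (dn j (star c * b))"
      using eq[of "g (l, j, 0, 1)" "g (l, j, 0, dn j c)"]
      by (simp add: K_def act_def star_mult dn_mult dn_star star_star mult.assoc dn_one_right)
    then have "T l 0 (dn j (star c * a)) + T l 0 (scaleC (-1) (dn j (star c * b))) = 0"
      by (simp add: T_scaleC)
    also have "T l 0 (dn j (star c * a)) + T l 0 (scaleC (-1) (dn j (star c * b))) = T l 0 (dn j (star c * a) + scaleC (-1) (dn j (star c * b)))"
      by (simp add: T_add)
    also have "dn j (star c * a) + scaleC (-1) (dn j (star c * b)) = dn j (star c * c)"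
      unfolding dn_scaleC[symmetric] dn_add[symmetric]
      by (simp add: c_def right_diff_distrib scaleC_minus_left)
    finally show ?thesis by (simp add: dn_mult dn_star)
  qed
  have "dn j c \<in> J" for j using sep_J[of "dn j c"] zero by blast
  then have "limit_norm c = norm c" by (rule limit_norm_on_J)
  moreover have "limit_norm c = 0" using sep_limit[of c] zero[of _ 0] by auto
  ultimately show "a = b" by (simp add: c_def)
qed

lemma U_U_adjoint: "compose rk_carrier (comp_op down) U = comp_op (up \<circ> down)"
  by (rule comp_op_compose[OF adjoint_down])

text \<open>The maps satisfy \<open>up \<circ> down \<circ> up = up\<close>, so \<open>F - F \<circ> up \<circ> down\<close> is in the kernel of \<open>U\<close>, hence
  orthogonal to \<open>F\<close>.\<close>

lemma partial_isometry_U: "partial_isometry rkhs U"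
  unfolding partial_isometry_def
proof (intro conjI ballI impI)
  show "U \<in> bounded_ops rkhs" by (rule comp_op_bounded[OF adjoint_down])
  fix F assume "F \<in> carrier rkhs" and perp: "\<forall>G\<in>carrier rkhs. U G = \<zero>\<^bsub>rkhs\<^esub> \<longrightarrow> ip rkhs F G = 0"
  then have F: "F \<in> rk_carrier" by simp
  have Fu: "F \<circ> up \<in> rk_carrier" by (rule comp_carrier[OF adjoint_down F])
  let ?P = "F \<circ> up \<circ> down"
  have P: "?P \<in> rk_carrier" by (rule comp_carrier[OF adjoint_maps_sym[OF adjoint_down] Fu])
  have D: "(\<lambda>x. F x - ?P x) \<in> rk_carrier" by (rule rk_diff[OF F P])
  have "U (\<lambda>x. F x - ?P x) = (\<lambda>x. 0)" using D by (auto simp: comp_op_apply up_down_up)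
  then have "inner F (\<lambda>x. F x - ?P x) = 0" using perp D by simp
  then have "inner (\<lambda>x. F x - ?P x) F = 0" using inner_cnj[OF F D] by simp
  moreover have "inner (\<lambda>x. F x + (-1) * ?P x) F = inner F F + (-1) * inner ?P F"
    by (subst inner_add_left[OF F rk_scale[OF P] F]) (simp only: inner_scale_left[OF P F])
  ultimately have "inner F F = inner ?P F" by simp
  also have "inner ?P F = inner (F \<circ> up) (F \<circ> up)"
    by (rule comp_adjoint[OF adjoint_maps_sym[OF adjoint_down] Fu F])
  finally show "hnorm rkhs (U F) = hnorm rkhs F" using F by (simp add: rk_norm_def comp_op_apply)
qed

theorem covariant_representation_rkhs: "covariant_representation \<delta> rkhs rep U"
  unfolding covariant_representation_def
proof (intro conjI allI)
  show "compose (carrier rkhs) (compose (carrier rkhs) U (rep a)) (adjoint_op rkhs U) = rep (\<delta> a)" for a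
  proof -
    have "compose rk_carrier (compose rk_carrier U (rep a)) (comp_op down) = comp_op (down \<circ> (act (star a) \<circ> up))"
      unfolding rep_def comp_op_compose[OF adjoint_act]
      by (rule comp_op_compose[OF adjoint_maps_sym[OF adjoint_down]])
    also have "down \<circ> (act (star a) \<circ> up) = act (star (\<delta> a))"
      by (rule ext) (simp add: down_act_up d_star)
    finally show ?thesis by (simp add: U_adjoint rep_def)
  qed
  have PP: "adjoint_maps (up \<circ> down) (up \<circ> down)"
    by (rule adjoint_maps_comp[OF adjoint_maps_sym[OF adjoint_down] adjoint_down])
  show "compose (carrier rkhs) (adjoint_op rkhs U) U \<in> commutant rkhs (range rep)"
    unfolding commutant_def
  proof (clarsimp simp: U_adjoint U_U_adjoint comp_op_bounded[OF PP])
    fix c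
    have "compose rk_carrier (comp_op (up \<circ> down)) (rep c) = comp_op (act (star c) \<circ> (up \<circ> down))"
      unfolding rep_def by (rule comp_op_compose[OF adjoint_act])
    also have "act (star c) \<circ> (up \<circ> down) = (up \<circ> down) \<circ> act (star c)"
      by (rule ext) (simp add: up_down_act)
    also have "comp_op ((up \<circ> down) \<circ> act (star c)) = compose rk_carrier (rep c) (comp_op (up \<circ> down))"
      unfolding rep_def by (rule comp_op_compose[OF PP, symmetric])
    finally show "compose rk_carrier (comp_op (up \<circ> down)) (rep c) = compose rk_carrier (rep c) (comp_op (up \<circ> down))" .
  qed
qed (simp_all add: hilbert_space_rkhs star_representation_rep nondegenerate_rep inj_rep partial_isometry_U)

text \<open>For a tower the vector \<open>w\<close> at level \<open>k\<close> is the vector \<open>\<delta> w\<close> at level \<open>k + 1\<close>.\<close>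

lemma K0_level_shift:
  assumes "\<not> fin l" shows "K0 z (l, Suc 0, Suc k, \<delta> w) = K0 z (l, 0, k, w)"
proof -
  obtain l' j' k' c where z: "z = (l', j', k', c)" by (metis prod_cases4)
  consider "k' = k" "j' = 0" | "k' = j' + k" "0 < j'" | "j' + k \<noteq> k'" by linarith
  then show ?thesis
  proof cases
    case 1
    have "T l (Suc k) (star (\<delta> w) * \<delta> 1 * \<delta> c) = T l k (star w * c)"
    proof -
      have "star (\<delta> w) * \<delta> 1 * \<delta> c = \<delta> (star w * c)" by (simp add: d_mult d_star d_unit mult.assoc)
      then show ?thesis by (simp add: tower[OF assms])
    qed
    then show ?thesis by (auto simp: z 1 Let_def)
  next
    case 2
    then obtain i where i: "j' = Suc i" using gr0_implies_Suc by blast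
    show ?thesis by (auto simp: z 2(1) i Let_def funpow_swap1)
  qed (auto simp: z)
qed

text \<open>The projection \<open>U\<^sup>*U\<close> fixes the generators with \<open>j > 0\<close> and, by \<open>K0_level_shift\<close>, everything that comes from a
  tower. It kills the generators with \<open>fin l\<close> and \<open>j = 0\<close>, but those of the form \<open>act0 a x\<close> with \<open>a \<in> J\<close> are
  null vectors, because the functional vanishes on \<open>J\<close>.\<close>

lemma K0_up_down:
  assumes "a \<in> J" shows "K0 z (up0 (down0 (act0 a x))) = K0 z (act0 a x)"
proof -
  obtain l j k b where x: "x = (l, j, k, b)" by (metis prod_cases4)
  show ?thesis
  proof (cases j)
    case (Suc i)
    then show ?thesis by (simp add: x dn_one_left' del: funpow.simps)
  next
    case 0
    let ?w = "a * b"
    have ud: "up0 (down0 (act0 a x)) = (l, Suc 0, Suc k, \<delta> ?w)" by (simp add: x 0 d_unit)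
    have ax: "act0 a x = (l, 0, k, ?w)" by (simp add: x 0)
    show ?thesis
    proof (cases "fin l")
      case False
      then show ?thesis unfolding ud unfolding ax by (rule K0_level_shift)
    next
      case True
      obtain l' j' k' c where z: "z = (l', j', k', c)" by (metis prod_cases4)
      have "K0 z (l, Suc 0, Suc k, \<delta> ?w) = 0"
        using fin_zero[OF True, of "max k' (Suc k)"] by (auto simp: z Let_def max_def)
      moreover have "K0 z (l, 0, k, ?w) = 0"
      proof (cases "max k' k = 0")
        case True': True
        have "T l 0 (star ?w * c) = 0"
          by (rule fin_J[OF True]) (simp add: star_mult J_right J_left J_star assms)
        then show ?thesis using True' by (auto simp: z Let_def)
      next
        case False
        then show ?thesis using fin_zero[OF True, of "max k' k"] by (auto simp: z Let_def)
      qed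
      ultimately show ?thesis unfolding ud unfolding ax by simp
    qed
  qed
qed

text \<open>If \<open>a \<notin> J\<close>, some functional with \<open>fin l\<close> does not vanish at \<open>star a * a\<close>; then \<open>rep a\<close> maps the generator
  \<open>(l, 0, 0, 1)\<close> to a nonzero vector that is annihilated by \<open>U\<close>.\<close>

theorem associated_with_rkhs: "associated_with rkhs rep U J"
  unfolding associated_with_def
proof (rule Set.set_eqI, unfold mem_Collect_eq)
  fix a
  have comp: "compose (carrier rkhs) (compose (carrier rkhs) (adjoint_op rkhs U) U) (rep a)
      = comp_op (act (star a) \<circ> (up \<circ> down))"
    unfolding U_adjoint rkhs_simps U_U_adjoint rep_def by (rule comp_op_compose[OF adjoint_act])
  have "comp_op (act (star a) \<circ> (up \<circ> down)) = rep a \<longleftrightarrow> a \<in> J"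
  proof
    assume a: "a \<in> J"
    have "F (act (star a) (up (down x))) = F (act (star a) x)" if F: "F \<in> rk_carrier" for F x
    proof -
      have "K z (act (star a) (up (down x))) = K z (act (star a) x)" for z
        using K0_up_down[OF J_star[OF a], of "e z" "e x"]
        unfolding up_down_act[symmetric] by (simp add: K_def up_def down_def act_def)
      then have "K z (act (star a) (up (down x))) = 1 * K z (act (star a) x) + 0 * K z x" for z
        by (simp only: mult_1_left mult_zero_left add_0_right)
      then have "F (act (star a) (up (down x))) = 1 * F (act (star a) x) + 0 * F x"
        using F by (rule rk_relation)
      then show ?thesis by simp
    qed
    then show "comp_op (act (star a) \<circ> (up \<circ> down)) = rep a"
      by (auto simp: rep_def comp_op_def restrict_def fun_eq_iff)
  next
    assume eq: "comp_op (act (star a) \<circ> (up \<circ> down)) = rep a"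
    show "a \<in> J"
    proof (rule ccontr)
      assume "a \<notin> J"
      then obtain l where l: "fin l" "T l 0 (star a * a) \<noteq> 0" using sep_J by blast
      have "K x (act (star a) (up (down y))) = K x (act (star a) y)" for x y
        using fun_cong[OF fun_cong[OF eq, of "K x"], of y] by (simp add: rep_def comp_op_apply rk_kernel)
      from this[of "g (l, 0, 0, 1)" "g (l, 0, 0, a)"] show False
        using l by (simp add: K_def act_def up_def down_def Let_def fin_Suc star_mult star_star)
    qed
  qed
  then show "a \<in> J \<longleftrightarrow> compose (carrier rkhs) (compose (carrier rkhs) (adjoint_op rkhs U) U) (rep a) = rep a"
    unfolding comp by blast
qed

end

lemma bij_rep_index:
  "bij (\<lambda>(f :: 'b, a :: 'c, n). let (i, r) = prod_decode n; (j, k) = prod_decode r in ((f, i), j, k, a))"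
  (is "bij ?e")
proof (rule o_bij)
  let ?d = "\<lambda>((f, i), j, k, a). (f, a, prod_encode (i, prod_encode (j, k)))"
  show "?d \<circ> ?e = id"
  proof
    fix x :: "'b \<times> 'c \<times> nat"
    obtain f a n where x: "x = (f, a, n)" by (metis prod_cases3)
    obtain i r where n: "prod_decode n = (i, r)" by (metis surj_pair)
    obtain j k where r: "prod_decode r = (j, k)" by (metis surj_pair)
    show "(?d \<circ> ?e) x = id x"
      by (simp add: x n r) (metis n r prod_decode_inverse)
  qed
  show "?e \<circ> ?d = id" by (auto simp: Let_def)
qed

theorem theorem1p6:
  fixes \<delta> :: "'a::unital_cstar_algebra \<Rightarrow> 'a" and J :: "'a set"
  assumes "star_endomorphism \<delta>"
    and "closed_ideal J"
    and "J \<inter> {a. \<delta> a = 0} = {0}"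
  shows "\<exists>(H :: 'a rep_vec hilbert) \<pi> U.
    covariant_representation \<delta> H \<pi> U \<and> associated_with H \<pi> U J"
proof -
  interpret cstar_system \<delta> J using assms by unfold_locales
  define good where "good F S \<longleftrightarrow> (\<forall>k. positive_functional (S k)) \<and> (\<forall>k x. S (Suc k) (\<delta> x) = S k x) \<and> S 0 = F"
    for F :: "'a \<Rightarrow> complex" and S
  define tow where "tow F = (SOME S. good F S)" for F
  \<comment> \<open>A label is a functional with a flag: flag \<open>0\<close> for functionals that vanish on \<open>J\<close>, any other flag for
    towers that start with the functional. All other labels get the zero functional.\<close>
  define T :: "('a \<Rightarrow> complex) \<times> nat \<Rightarrow> nat \<Rightarrow> 'a \<Rightarrow> complex" where
    "T = (\<lambda>(F, i) k. if i = 0 then (if k = 0 \<and> positive_functional F \<and> (\<forall>x\<in>J. F x = 0) then F else (\<lambda>x. 0))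
      else if Ex (good F) then tow F k else (\<lambda>x. 0))"
  have zero: "positive_functional (\<lambda>x :: 'a. 0)" by (simp add: positive_functional_def)
  have "good F (tow F)" if "Ex (good F)" for F unfolding tow_def using that by (rule someI_ex)
  then have tow: "positive_functional (tow F k)" "tow F (Suc k) (\<delta> x) = tow F k x" "tow F 0 = F"
    if "Ex (good F)" for F k x using that unfolding good_def by blast+
  interpret tower_system \<delta> J T
    "\<lambda>(f, a, n). let (i, r) = prod_decode n; (j, k) = prod_decode r in ((f, i), j, k, a)" "\<lambda>l. snd l = 0"
  proof
    show "bij (\<lambda>(f :: 'a \<Rightarrow> complex, a :: 'a, n). let (i, r) = prod_decode n; (j, k) = prod_decode r in ((f, i), j, k, a))"
      by (rule bij_rep_index)
    fix l :: "('a \<Rightarrow> complex) \<times> nat" and k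
    obtain F i where l: "l = (F, i)" by (cases l)
    show "positive_functional (T l k)"
      using tow(1) zero by (simp add: T_def l)
    show "T l (Suc k) (\<delta> x) = T l k x" if "snd l \<noteq> 0" for x
      using tow(2) that by (auto simp: T_def l)
    show "T l (Suc k) x = 0" if "snd l = 0" for x using that by (simp add: T_def l)
    show "T l 0 x = 0" if "snd l = 0" "x \<in> J" for x using that by (simp add: T_def l)
  next
    fix a assume "a \<notin> J"
    then obtain F where "positive_functional F" "\<forall>j\<in>J. F j = 0" "F (star a * a) \<noteq> 0"
      using functional_vanishing_on_ideal by blast
    then show "\<exists>l. snd l = 0 \<and> T l 0 (star a * a) \<noteq> 0"
      by (intro exI[of _ "(F, 0)"]) (simp add: T_def)
  next
    fix a assume "limit_norm a \<noteq> 0"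
    then obtain S where S: "\<forall>k. positive_functional (S k)" "\<forall>k x. S (Suc k) (\<delta> x) = S k x" "S 0 (star a * a) \<noteq> 0"
      using tower_exists by blast
    then have "good (S 0) S" by (simp add: good_def)
    then have "Ex (good (S 0))" by blast
    then have "T (S 0, 1) 0 = S 0" using tow(3) by (simp add: T_def)
    then show "\<exists>l. T l 0 (star a * a) \<noteq> 0" using S(3) by (intro exI[of _ "(S 0, 1)"]) simp
  qed
  show ?thesis using covariant_representation_rkhs associated_with_rkhs by blast
qed

end
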